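(* Let $n\ge2$ and $\pi/2\le\theta<n\pi/2$. There exist a fixed ball $\Omega\subset\mathbb R^n$, a constant $\delta_0>0$, and a family of smooth strictly convex solutions $u_\delta\in C^\infty(\overline\Omega)$, $0<\delta<\delta_0$, of $F(A[u_\delta])=\theta$ such that $\delta_*(u_\delta)=\delta$ and $$\sup_{0<\delta<\delta_0}\Bigl(\|u_\delta\|_{C^1(\overline\Omega)}+\|u_\delta\|_{C^3(\partial\Omega)}+\sup_{x\in\partial\Omega}\sup_{\substack{\xi\in T_x\partial\Omega\\|\xi|=1}}|D^2u_\delta(\xi,\nu)|\Bigr)<\infty,$$ where the $C^3(\partial\Omega)$ norm is the intrinsic norm of the boundary trace. Nevertheless, $$\sup_{x\in\partial\Omega}(u_\delta)_{\nu\nu}(x)\asymp\delta^{-1}.$$ Moreover, the $C^4$ norm of the boundary trace $u_\delta|_{\partial\Omega}$ diverges at order $\delta^{-1}$ as $\delta\to0$.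
   Context: $\nu$ is the inward unit normal of $\partial\Omega$ and $\mathrm{II}_{\partial\Omega}$ the second fundamental form, positive for convex boundaries. $f\asymp g$ means $cg\le f\le Cg$ with positive constants independent of $\delta$; "diverges at order $\delta^{-1}$" means the quantity is $\asymp\delta^{-1}$. $F(M)=\sum_{i=1}^n\arctan\lambda_i(M)$ and $$A[u]=\frac1{\sqrt{1+|Du|^2}}\,B\,D^2u\,B,\qquad B=(I+Du\otimes Du)^{-1/2}.$$ For a convex $u$ with boundary trace $\varphi=u|_{\partial\Omega}$ and $x\in\partial\Omega$, $s\in\mathbb R$, put $q=D_T\varphi(x)$ (tangential gradient), $M(x,s)=D^2_{\partial\Omega}\varphi(x)-s\,\mathrm{II}_{\partial\Omega}(x)$ (intrinsic boundary Hessian; it is the tangential block of $D^2u$ when $s=u_\nu(x)$), $C_{1,T}=\sqrt{1+|q|^2+s^2}\,(I_T+q\otimes q)$ on $T_x\partial\Omega$, and when $M(x,s)\ge0$ $$\mathcal B(x,s)=\frac\pi2+\sum_{\alpha=1}^{n-1}\arctan\lambda_\alpha\bigl(C_{1,T}^{-1/2}M(x,s)C_{1,T}^{-1/2}\bigr).$$ Then $\delta_*(u)=\min_{x\in\partial\Omega}\bigl(\mathcal B(x,u_\nu(x))-\theta\bigr)$. *)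

theory Defs
  imports "HOL-Analysis.Analysis"
begin

section \<open>Calculus in Euclidean space\<close>

fun Ck_on :: "nat \<Rightarrow> ('a::real_normed_vector \<Rightarrow> real) \<Rightarrow> 'a set \<Rightarrow> bool" where
  "Ck_on 0 f U \<longleftrightarrow> continuous_on U f"
| "Ck_on (Suc k) f U \<longleftrightarrow>
     (\<forall>x\<in>U. f differentiable (at x)) \<and>
     (\<forall>v. Ck_on k (\<lambda>x. frechet_derivative f (at x) v) U)"

text \<open>Smoothness up to the boundary: the function is \<open>C\<^sup>\<infinity>\<close> on an open neighbourhood of the
  closed set \<open>S\<close>. When \<open>S\<close> is the closure of a smooth domain all derivatives at points of \<open>S\<close>
  are then determined by the values on \<open>S\<close>.\<close>

definition smooth_up_to :: "('a::real_normed_vector \<Rightarrow> real) \<Rightarrow> 'a set \<Rightarrow> bool" where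
  "smooth_up_to f S \<longleftrightarrow> (\<exists>U. open U \<and> S \<subseteq> U \<and> (\<forall>k. Ck_on k f U))"

text \<open>The vector representing a linear form with respect to the inner product.\<close>

definition riesz :: "('a::euclidean_space \<Rightarrow> real) \<Rightarrow> 'a" where
  "riesz l = (\<Sum>b\<in>Basis. l b *\<^sub>R b)"

definition grad :: "('a::euclidean_space \<Rightarrow> real) \<Rightarrow> 'a \<Rightarrow> 'a" where
  "grad f x = riesz (frechet_derivative f (at x))"

text \<open>The Hessian as an operator; as a bilinear form it is \<open>(v, w) \<mapsto> v \<bullet> hess f x w\<close>.\<close>

definition hess :: "('a::euclidean_space \<Rightarrow> real) \<Rightarrow> 'a \<Rightarrow> 'a \<Rightarrow> 'a" where
  "hess f x = frechet_derivative (grad f) (at x)"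

definition strictly_convex_on :: "'a set \<Rightarrow> ('a::euclidean_space \<Rightarrow> real) \<Rightarrow> bool" where
  "strictly_convex_on S f \<longleftrightarrow> (\<forall>x\<in>S. \<forall>v. v \<noteq> 0 \<longrightarrow> v \<bullet> hess f x v > 0)"

section \<open>Self-adjoint operators on a subspace\<close>

text \<open>The sum of \<open>arctan \<lambda>\<^sub>i(L)\<close> over the eigenvalues of a self-adjoint operator \<open>L\<close> of the
  subspace \<open>V\<close>, each eigenvalue being repeated according to its multiplicity. As \<open>L\<close> is
  self-adjoint this is the dimension of the eigenspace.\<close>

definition sum_arctan_eig :: "'a::euclidean_space set \<Rightarrow> ('a \<Rightarrow> 'a) \<Rightarrow> real" where
  "sum_arctan_eig V L =
     (\<Sum>\<mu> \<in> {\<mu>. \<exists>v\<in>V. v \<noteq> 0 \<and> L v = \<mu> *\<^sub>R v}.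
        real (dim {v\<in>V. L v = \<mu> *\<^sub>R v}) * arctan \<mu>)"

text \<open>\<open>inv_sqrt_on V C\<close> is \<open>C\<^sup>-\<^sup>1\<^sup>/\<^sup>2\<close> for a positive definite self-adjoint operator \<open>C\<close> of the
  subspace \<open>V\<close>. The value on the orthogonal complement is set to \<open>0\<close> only to make the operator
  unique as a function on the whole space.\<close>

definition inv_sqrt_on :: "'a::euclidean_space set \<Rightarrow> ('a \<Rightarrow> 'a) \<Rightarrow> ('a \<Rightarrow> 'a)" where
  "inv_sqrt_on V C = (THE S. linear S
      \<and> (\<forall>v\<in>V. S v \<in> V)
      \<and> (\<forall>v\<in>V. \<forall>w\<in>V. S v \<bullet> w = v \<bullet> S w)
      \<and> (\<forall>v\<in>V. v \<noteq> 0 \<longrightarrow> v \<bullet> S v > 0)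
      \<and> (\<forall>v\<in>V. S (S (C v)) = v)
      \<and> (\<forall>v. (\<forall>w\<in>V. v \<bullet> w = 0) \<longrightarrow> S v = 0))"

section \<open>The operator \<open>F(A[u])\<close>\<close>

definition F :: "('a::euclidean_space \<Rightarrow> 'a) \<Rightarrow> real" where
  "F L = sum_arctan_eig UNIV L"

definition B_op :: "('a::euclidean_space \<Rightarrow> real) \<Rightarrow> 'a \<Rightarrow> 'a \<Rightarrow> 'a" where
  "B_op u x = inv_sqrt_on UNIV (\<lambda>v. v + (grad u x \<bullet> v) *\<^sub>R grad u x)"

definition A_op :: "('a::euclidean_space \<Rightarrow> real) \<Rightarrow> 'a \<Rightarrow> 'a \<Rightarrow> 'a" where
  "A_op u x v = (1 / sqrt (1 + (norm (grad u x))\<^sup>2)) *\<^sub>R B_op u x (hess u x (B_op u x v))"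

section \<open>Geometry of the boundary of a ball\<close>

text \<open>For a ball with centre \<open>c\<close>, \<open>nu c\<close> is the inward unit normal of the boundary, extended to a
  unit field off the centre, namely the inward unit normal of the concentric spheres. The maps
  below depend on the radius only through the point \<open>x\<close>.\<close>

definition nu :: "'a::euclidean_space \<Rightarrow> 'a \<Rightarrow> 'a" where
  "nu c x = sgn (c - x)"

definition tangent :: "'a::euclidean_space \<Rightarrow> 'a \<Rightarrow> 'a set" where
  "tangent c x = {v. v \<bullet> nu c x = 0}"

definition tproj :: "'a::euclidean_space \<Rightarrow> 'a \<Rightarrow> 'a \<Rightarrow> 'a" where
  "tproj c x v = v - (v \<bullet> nu c x) *\<^sub>R nu c x"

text \<open>\<open>II(X, Y) = - D\<^sub>X \<nu> \<bullet> Y\<close> on the tangent space, which is positive on the boundary of a ball;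
  arbitrary arguments are projected first.\<close>

definition second_ff :: "'a::euclidean_space \<Rightarrow> 'a \<Rightarrow> 'a \<Rightarrow> 'a \<Rightarrow> real" where
  "second_ff c x X Y = - (frechet_derivative (nu c) (at x) (tproj c x X) \<bullet> tproj c x Y)"

text \<open>Iterated intrinsic covariant derivatives of the trace of \<open>f\<close> on the sphere:
  \<open>cov_deriv c f [X\<^sub>1, \<dots>, X\<^sub>j] x\<close> is \<open>(\<nabla>\<^sup>j f)(X\<^sub>1, \<dots>, X\<^sub>j)\<close> at \<open>x\<close>, with arbitrary arguments
  projected to the tangent space. The Levi-Civita connection of a submanifold of Euclidean space
  is the tangential projection of the ambient derivative. Hence, if \<open>T\<close> is a covariant tensor of
  the sphere and \<open>T'\<close> is \<open>T\<close> composed with the tangential projection in every argument, then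
  \<open>(\<nabla>\<^sub>X T)(Y\<^sub>1, \<dots>)\<close> is, for tangent vectors at \<open>x\<close>, the derivative in direction \<open>X\<close> of
  \<open>y \<mapsto> T'\<^sub>y(Y\<^sub>1, \<dots>)\<close> with constant vectors \<open>Y\<^sub>i\<close>. Only derivatives in tangential directions
  occur, so the values on the sphere depend only on the trace of \<open>f\<close>.\<close>

function cov_deriv :: "'a::euclidean_space \<Rightarrow> ('a \<Rightarrow> real) \<Rightarrow> 'a list \<Rightarrow> 'a \<Rightarrow> real" where
  "cov_deriv c f [] x = f x"
| "cov_deriv c f (X # Ys) x =
     frechet_derivative (\<lambda>y. cov_deriv c f (map (tproj c x) Ys) y) (at x) (tproj c x X)"
  by pat_completeness auto
termination
  by (relation "Wellfounded.measure (\<lambda>(c, f, Xs, x). length Xs)") auto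

text \<open>The norm of the tensor \<open>\<nabla>\<^sup>j f\<close> at \<open>x\<close> in the induced metric. Since the normal direction is
  projected away, the sum over an orthonormal basis of the ambient space equals the sum over an
  orthonormal basis of the tangent space.\<close>

definition cov_norm :: "nat \<Rightarrow> 'a::euclidean_space \<Rightarrow> ('a \<Rightarrow> real) \<Rightarrow> 'a \<Rightarrow> real" where
  "cov_norm j c f x =
     L2_set (\<lambda>Xs. cov_deriv c f Xs x) {Xs. set Xs \<subseteq> Basis \<and> length Xs = j}"

definition Ck_norm_sphere :: "nat \<Rightarrow> 'a::euclidean_space \<Rightarrow> real \<Rightarrow> ('a \<Rightarrow> real) \<Rightarrow> real" where
  "Ck_norm_sphere k c r f = (\<Sum>j\<le>k. SUP x\<in>sphere c r. cov_norm j c f x)"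

definition C1_norm :: "'a::euclidean_space set \<Rightarrow> ('a \<Rightarrow> real) \<Rightarrow> real" where
  "C1_norm S f = (SUP x\<in>S. \<bar>f x\<bar>) + (SUP x\<in>S. norm (grad f x))"

section \<open>The boundary quantity \<open>\<delta>\<^sub>*\<close>\<close>

definition tgrad :: "'a::euclidean_space \<Rightarrow> ('a \<Rightarrow> real) \<Rightarrow> 'a \<Rightarrow> 'a" where
  "tgrad c u x = riesz (\<lambda>Y. cov_deriv c u [Y] x)"

text \<open>The bilinear form \<open>D\<^sup>2 \<phi> - s II\<close> on the tangent space, turned into an operator; it vanishes
  on the normal line.\<close>

definition M_op :: "'a::euclidean_space \<Rightarrow> ('a \<Rightarrow> real) \<Rightarrow> 'a \<Rightarrow> real \<Rightarrow> 'a \<Rightarrow> 'a" where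
  "M_op c u x s X = riesz (\<lambda>Y. cov_deriv c u [X, Y] x - s * second_ff c x X Y)"

definition C1T_op :: "'a::euclidean_space \<Rightarrow> ('a \<Rightarrow> real) \<Rightarrow> 'a \<Rightarrow> real \<Rightarrow> 'a \<Rightarrow> 'a" where
  "C1T_op c u x s v =
     sqrt (1 + (norm (tgrad c u x))\<^sup>2 + s\<^sup>2) *\<^sub>R (v + (tgrad c u x \<bullet> v) *\<^sub>R tgrad c u x)"

definition calB :: "'a::euclidean_space \<Rightarrow> ('a \<Rightarrow> real) \<Rightarrow> 'a \<Rightarrow> real \<Rightarrow> real" where
  "calB c u x s =
     (let R = inv_sqrt_on (tangent c x) (C1T_op c u x s)
      in pi / 2 + sum_arctan_eig (tangent c x) (\<lambda>v. R (M_op c u x s (R v))))"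

definition normal_deriv :: "'a::euclidean_space \<Rightarrow> ('a \<Rightarrow> real) \<Rightarrow> 'a \<Rightarrow> real" where
  "normal_deriv c u x = grad u x \<bullet> nu c x"

text \<open>For \<open>u\<close> smooth up to the boundary the infimum is attained, since the sphere is compact. For
  convex \<open>u\<close> the form \<open>M(x, u\<^sub>\<nu>(x))\<close> is the tangential block of the Hessian, hence nonnegative.\<close>

definition delta_star :: "'a::euclidean_space \<Rightarrow> real \<Rightarrow> real \<Rightarrow> ('a \<Rightarrow> real) \<Rightarrow> real" where
  "delta_star c r \<theta> u = (INF x\<in>sphere c r. calB c u x (normal_deriv c u x) - \<theta>)"

definition sup_mixed :: "'a::euclidean_space \<Rightarrow> real \<Rightarrow> ('a \<Rightarrow> real) \<Rightarrow> real" where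
  "sup_mixed c r u =
     (SUP x\<in>sphere c r. SUP \<xi>\<in>{\<xi>\<in>tangent c x. norm \<xi> = 1}. \<bar>\<xi> \<bullet> hess u x (nu c x)\<bar>)"

definition sup_double_normal :: "'a::euclidean_space \<Rightarrow> real \<Rightarrow> ('a \<Rightarrow> real) \<Rightarrow> real" where
  "sup_double_normal c r u = (SUP x\<in>sphere c r. nu c x \<bullet> hess u x (nu c x))"

text \<open>\<open>f \<asymp> g\<close> uniformly on \<open>D\<close>.\<close>

definition comparable_on :: "real set \<Rightarrow> (real \<Rightarrow> real) \<Rightarrow> (real \<Rightarrow> real) \<Rightarrow> bool" where
  "comparable_on D f g \<longleftrightarrow>
     (\<exists>a>0. \<exists>b>0. \<forall>\<delta>\<in>D. a * g \<delta> \<le> f \<delta> \<and> f \<delta> \<le> b * g \<delta>)"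

end

theory Submission
  imports Defs
begin

text \<open>The solutions are radial, \<open>u(x) = U(|x - p|)\<close>. For such graphs the equation is a first order
  ODE in the radius for the spherical curvature \<open>T\<close>, and it becomes singular along the
  sphere where \<open>(n - 1) arctan T = \<theta> - \<pi>/2\<close>: there the radial curvature is infinite and \<open>U\<close> behaves
  like a smooth function plus the \<open>3/2\<close>-th power of the distance to this edge. The domain is a
  fixed ball, and \<open>p\<close> is chosen so that the ball lies outside the edge sphere at distance of order \<open>\<delta>\<^sup>2\<close>. At the
  boundary point nearest to \<open>p\<close> the normal is radial, so \<open>u\<^sub>\<nu>\<^sub>\<nu>\<close> is of order \<open>\<delta>\<^sup>-\<^sup>1\<close>. Along the boundary
  the distance to the edge is \<open>\<delta>\<^sup>2\<close> plus a quadratic function, so the trace looks like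
  \<open>(\<delta>\<^sup>2 + |y|\<^sup>2)\<^sup>3\<^sup>/\<^sup>2\<close>, whose third derivatives are bounded while its fourth derivatives are of order
  \<open>\<delta>\<^sup>-\<^sup>1\<close>.\<close>

section \<open>Calculus of smooth functions\<close>

text \<open>The obstacle is that the profile is not smooth at the edge in any radial variable. Let
  \<open>s\<close> be the squared radius and \<open>cot t\<close> the radial curvature. The equation
  then reads \<open>m * arctan T = \<theta> - pi/2 + t\<close> with \<open>m = n - 1\<close>, so
  \<open>T\<close> is explicit in \<open>t\<close>. What remains is the Codazzi equation d(\<rho>
  T)/d\<rho> = cot t in the radius \<rho>; with \<open>t\<close> as variable it is linear in
  \<open>s\<close> and regular across t = 0, where \<open>s\<close> has a nondegenerate minimum. All
  singular behaviour comes from inverting \<open>s\<close>: \<open>t\<close> is of the order of the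
  square root of the distance to the edge, and for j \<ge> 2 the j-th derivative of the profile in
  \<open>s\<close> is a smooth function of \<open>t\<close> over the (2j - 3)-th power of
  \<open>sin t\<close>. Along the boundary the differential of \<open>s\<close> is O(t); counting
  powers bounds three derivatives and leaves 1/t for the fourth. The gap \<open>t\<close> also makes
  the value of \<delta>_* exact. At the boundary point nearest to \<open>p\<close> the tangent space
  is orthogonal to the radius, all tangential curvatures equal \<open>T\<close>, and
  \<open>pi/2 + m * arctan T - \<theta> = t\<close>. So \<open>p\<close> is placed such that t =
  \<delta> there. One profile serves all \<delta>; only \<open>p\<close> moves.\<close>

lemma Ck_on_cong:
  assumes "open U" "\<And>x. x \<in> U \<Longrightarrow> f x = g x" "Ck_on k f U"
  shows "Ck_on k g U"
  using assms(2,3)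
proof (induction k arbitrary: f g)
  case 0
  then show ?case by (simp cong: continuous_on_cong)
next
  case (Suc k)
  have D: "(g has_derivative frechet_derivative f (at x)) (at x)" if "x \<in> U" for x
    using has_derivative_transform_within_open[OF _ assms(1) that] Suc.prems that
      frechet_derivative_works by (metis Ck_on.simps(2))
  have E: "frechet_derivative f (at x) = frechet_derivative g (at x)" if "x \<in> U" for x
    using frechet_derivative_at[OF D[OF that]] .
  show ?case unfolding Ck_on.simps
  proof (intro conjI allI ballI)
    fix x assume "x \<in> U" then show "g differentiable at x" using D differentiable_def by blast
  next
    fix v show "Ck_on k (\<lambda>x. frechet_derivative g (at x) v) U"
      by (rule Suc.IH[of "\<lambda>x. frechet_derivative f (at x) v"]) (use E Suc.prems in auto)
  qed
qed

lemma Ck_on_SucI: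
  assumes "open U" "\<And>x. x \<in> U \<Longrightarrow> (f has_derivative f' x) (at x)"
    "\<And>v. Ck_on k (\<lambda>x. f' x v) U"
  shows "Ck_on (Suc k) f U"
  unfolding Ck_on.simps
proof (intro conjI allI ballI)
  fix x assume "x \<in> U" then show "f differentiable at x" using assms(2) differentiable_def by blast
next
  fix v
  have "f' x v = frechet_derivative f (at x) v" if "x \<in> U" for x
    using frechet_derivative_at[OF assms(2)[OF that]] by simp
  then show "Ck_on k (\<lambda>x. frechet_derivative f (at x) v) U"
    by (rule Ck_on_cong[OF assms(1) _ assms(3)])
qed

lemma Ck_on_SucE:
  assumes "Ck_on (Suc k) f U" "x \<in> U"
  shows "(f has_derivative frechet_derivative f (at x)) (at x)"
  using assms frechet_derivative_works by auto

lemma Ck_on_lower: "Ck_on (Suc k) f U \<Longrightarrow> Ck_on k f U"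
proof (induction k arbitrary: f)
  case 0
  then have "\<forall>x\<in>U. continuous (at x) f" by (auto intro: differentiable_imp_continuous_within)
  then show ?case by (simp add: continuous_at_imp_continuous_on)
next
  case (Suc k)
  then show ?case by (metis Ck_on.simps(2))
qed

lemma Ck_on_subset: "Ck_on k f U \<Longrightarrow> V \<subseteq> U \<Longrightarrow> Ck_on k f V"
  by (induction k arbitrary: f) (auto intro: continuous_on_subset)

lemma Ck_on_const: "open U \<Longrightarrow> Ck_on k (\<lambda>x. c) U"
proof (induction k arbitrary: c)
  case (Suc k)
  then show ?case by (intro Ck_on_SucI[of _ _ "\<lambda>x v. 0"]) auto
qed auto

lemma Ck_on_bounded_linear:
  assumes "open U" "bounded_linear f" shows "Ck_on k f U"
proof (cases k)
  case 0
  then show ?thesis using assms by (simp add: linear_continuous_on)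
next
  case (Suc j)
  show ?thesis unfolding Suc
    by (rule Ck_on_SucI[of _ _ "\<lambda>x. f"])
       (use assms in \<open>auto intro: bounded_linear_imp_has_derivative Ck_on_const\<close>)
qed

lemma Ck_on_ident: "open U \<Longrightarrow> Ck_on k (\<lambda>x::real. x) U"
  by (rule Ck_on_bounded_linear) (auto intro: bounded_linear_ident)

lemma Ck_on_add:
  assumes "open U" "Ck_on k f U" "Ck_on k g U" shows "Ck_on k (\<lambda>x. f x + g x) U"
  using assms(2,3)
proof (induction k arbitrary: f g)
  case (Suc k)
  show ?case
    by (rule Ck_on_SucI[OF assms(1), where
          f' = "\<lambda>x v. frechet_derivative f (at x) v + frechet_derivative g (at x) v"])
       (use Suc in \<open>auto intro!: has_derivative_add Ck_on_SucE[OF Suc.prems(1)] Ck_on_SucE[OF Suc.prems(2)]\<close>)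
qed (auto intro: continuous_on_add)

lemma Ck_on_mult:
  assumes "open U" "Ck_on k f U" "Ck_on k g U" shows "Ck_on k (\<lambda>x. f x * g x) U"
  using assms(2,3)
proof (induction k arbitrary: f g)
  case (Suc k)
  have fg: "Ck_on k f U" "Ck_on k g U" using Suc.prems Ck_on_lower by auto
  show ?case
    by (rule Ck_on_SucI[OF assms(1), where
          f' = "\<lambda>x v. f x * frechet_derivative g (at x) v + frechet_derivative f (at x) v * g x"])
       (use Suc fg in \<open>auto intro!: has_derivative_mult Ck_on_SucE[OF Suc.prems(1)]
          Ck_on_SucE[OF Suc.prems(2)] Ck_on_add[OF assms(1)]\<close>)
qed (auto intro: continuous_on_mult)

text \<open>The induction generalises \<open>h\<close> but keeps \<open>f\<close>: the derivative is
  \<open>h'(f)\<close> times that of \<open>f\<close>, and the hypothesis for \<open>h'\<close>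
  needs only one order less of the same \<open>f\<close>.\<close>

lemma Ck_on_compose:
  fixes h :: "real \<Rightarrow> real"
  assumes "open U" "Ck_on k h V" "Ck_on k f U" "f ` U \<subseteq> V"
  shows "Ck_on k (\<lambda>x. h (f x)) U"
  using assms(2,3)
proof (induction k arbitrary: h)
  case 0
  then show ?case using assms(4) continuous_on_compose2 by fastforce
next
  case (Suc k)
  have f: "Ck_on k f U" using Suc.prems Ck_on_lower by blast
  let ?h = "\<lambda>s. frechet_derivative h (at s) 1"
  show ?case
  proof (rule Ck_on_SucI[OF assms(1), where f' = "\<lambda>x v. ?h (f x) * frechet_derivative f (at x) v"])
    fix x assume x: "x \<in> U"
    have h: "(h has_derivative frechet_derivative h (at (f x))) (at (f x))"
      using Suc.prems(1) assms(4) x Ck_on_SucE by blast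
    have "frechet_derivative h (at (f x)) (frechet_derivative f (at x) v)
        = ?h (f x) * frechet_derivative f (at x) v" for v
      using linear_cmul[OF has_derivative_linear[OF h], of "frechet_derivative f (at x) v" 1]
      by (simp add: mult.commute)
    then show "((\<lambda>x. h (f x)) has_derivative (\<lambda>v. ?h (f x) * frechet_derivative f (at x) v)) (at x)"
      using diff_chain_at[OF Ck_on_SucE[OF Suc.prems(2) x] h] by (simp add: o_def)
  next
    fix v
    show "Ck_on k (\<lambda>x. ?h (f x) * frechet_derivative f (at x) v) U"
      by (rule Ck_on_mult[OF assms(1) Suc.IH]) (use Suc.prems f in auto)
  qed
qed

lemma Ck_on_real_SucI:
  assumes "open U" "\<And>x. x \<in> U \<Longrightarrow> (f has_real_derivative f' x) (at x)" "Ck_on k f' U"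
  shows "Ck_on (Suc k) f U"
  by (rule Ck_on_SucI[OF assms(1), where f' = "\<lambda>x v. f' x * v"])
     (use assms in \<open>auto simp: has_field_derivative_def intro!: Ck_on_const Ck_on_mult\<close>)

lemma Ck_on_inverse: "Ck_on k (inverse :: real \<Rightarrow> real) (- {0})"
proof (induction k)
  case 0 then show ?case by (auto intro!: continuous_intros)
next
  case (Suc k)
  have o: "open (- {0::real})" by auto
  show ?case
  proof (rule Ck_on_real_SucI[OF o])
    show "Ck_on k (\<lambda>x. (-1) * (inverse x * inverse x) :: real) (- {0})"
      by (intro Ck_on_mult Ck_on_const o Suc)
  qed (auto intro!: derivative_eq_intros simp: power2_eq_square)
qed

lemma Ck_on_sqrt: "Ck_on k sqrt {0<..}"
proof (induction k)
  case 0 then show ?case by (auto intro!: continuous_intros)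
next
  case (Suc k)
  show ?case
  proof (rule Ck_on_real_SucI)
    show "Ck_on k (\<lambda>x. (1/2) * inverse (sqrt x) :: real) {0<..}"
      by (intro Ck_on_mult Ck_on_const Ck_on_compose[OF _ Ck_on_inverse] Suc) auto
  qed (auto intro!: derivative_eq_intros simp: field_simps)
qed

lemma Ck_on_exp: "Ck_on k (exp :: real \<Rightarrow> real) UNIV"
proof (induction k)
  case 0 then show ?case by (auto intro!: continuous_intros)
next
  case (Suc k)
  show ?case
    by (rule Ck_on_real_SucI[where f' = exp]) (auto intro!: derivative_eq_intros Suc)
qed

lemma Ck_on_sin_cos: "Ck_on k (sin :: real \<Rightarrow> real) UNIV \<and> Ck_on k (cos :: real \<Rightarrow> real) UNIV"
proof (induction k)
  case 0 then show ?case by (auto intro!: continuous_intros)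
next
  case (Suc k)
  have "Ck_on k (\<lambda>x. (-1) * sin x :: real) UNIV"
    by (rule Ck_on_mult) (auto intro: Ck_on_const Suc conjunct1[OF Suc])
  then show ?case
    by (intro conjI Ck_on_real_SucI[where f=sin and f' = cos]
        Ck_on_real_SucI[where f=cos and f' = "\<lambda>x. (-1) * sin x"] conjunct2[OF Suc])
      (auto intro!: derivative_eq_intros)
qed

section \<open>Closure rules for smooth functions on open sets\<close>

definition smooth_on :: "('a::real_normed_vector \<Rightarrow> real) \<Rightarrow> 'a set \<Rightarrow> bool" where
  "smooth_on f U \<longleftrightarrow> (\<forall>k. Ck_on k f U)"

named_theorems smooth_intros

lemma smooth_on_const [smooth_intros]: "open U \<Longrightarrow> smooth_on (\<lambda>x. c) U"
  by (simp add: smooth_on_def Ck_on_const)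

lemma smooth_on_ident [smooth_intros]: "open U \<Longrightarrow> smooth_on (\<lambda>x::real. x) U"
  by (simp add: smooth_on_def Ck_on_ident)

lemma smooth_on_add [smooth_intros]:
  "open U \<Longrightarrow> smooth_on f U \<Longrightarrow> smooth_on g U \<Longrightarrow> smooth_on (\<lambda>x. f x + g x) U"
  by (simp add: smooth_on_def Ck_on_add)

lemma smooth_on_mult [smooth_intros]:
  "open U \<Longrightarrow> smooth_on f U \<Longrightarrow> smooth_on g U \<Longrightarrow> smooth_on (\<lambda>x. f x * g x) U"
  by (simp add: smooth_on_def Ck_on_mult)

lemma smooth_on_diff [smooth_intros]:
  assumes "open U" "smooth_on f U" "smooth_on g U" shows "smooth_on (\<lambda>x. f x - g x) U"
  using smooth_on_add[OF assms(1,2) smooth_on_mult[OF assms(1) smooth_on_const[OF assms(1), of "-1"] assms(3)]]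
  by simp

lemma smooth_on_power [smooth_intros]:
  "open U \<Longrightarrow> smooth_on f U \<Longrightarrow> smooth_on (\<lambda>x. f x ^ j) U"
  by (induction j) (auto intro!: smooth_intros)

lemma smooth_on_compose:
  fixes h :: "real \<Rightarrow> real"
  assumes "smooth_on h V" "open U" "smooth_on f U" "f ` U \<subseteq> V"
  shows "smooth_on (\<lambda>x. h (f x)) U"
  using assms Ck_on_compose by (metis smooth_on_def)

lemma smooth_on_divide [smooth_intros]:
  assumes "open U" "smooth_on f U" "smooth_on g U" "\<And>x. x \<in> U \<Longrightarrow> g x \<noteq> 0"
  shows "smooth_on (\<lambda>x. f x / g x) U"
proof -
  have "smooth_on (\<lambda>x. inverse (g x)) U"
    by (rule smooth_on_compose[of inverse "-{0}"]) (use assms Ck_on_inverse in \<open>auto simp: smooth_on_def\<close>)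
  then show ?thesis unfolding divide_inverse using assms smooth_on_mult by blast
qed

lemma smooth_on_sqrt [smooth_intros]:
  assumes "open U" "smooth_on f U" "\<And>x. x \<in> U \<Longrightarrow> f x > 0"
  shows "smooth_on (\<lambda>x. sqrt (f x)) U"
  by (rule smooth_on_compose[of sqrt "{0<..}"]) (use assms Ck_on_sqrt in \<open>auto simp: smooth_on_def\<close>)

lemma smooth_on_exp [smooth_intros]:
  assumes "open U" "smooth_on f U" shows "smooth_on (\<lambda>x. exp (f x)) U"
  by (rule smooth_on_compose[of exp UNIV]) (use assms Ck_on_exp in \<open>auto simp: smooth_on_def\<close>)

lemma smooth_on_sin [smooth_intros]:
  assumes "open U" "smooth_on f U" shows "smooth_on (\<lambda>x. sin (f x)) U"
  by (rule smooth_on_compose[of sin UNIV]) (use assms Ck_on_sin_cos in \<open>auto simp: smooth_on_def\<close>)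

lemma smooth_on_cos [smooth_intros]:
  assumes "open U" "smooth_on f U" shows "smooth_on (\<lambda>x. cos (f x)) U"
  by (rule smooth_on_compose[of cos UNIV]) (use assms Ck_on_sin_cos in \<open>auto simp: smooth_on_def\<close>)

lemma smooth_on_inner_left [smooth_intros]:
  "open U \<Longrightarrow> smooth_on (\<lambda>x. x \<bullet> v) U"
  by (simp add: smooth_on_def Ck_on_bounded_linear bounded_linear_inner_left)

lemma smooth_on_sum [smooth_intros]:
  "open U \<Longrightarrow> (\<And>i. i \<in> A \<Longrightarrow> smooth_on (f i) U) \<Longrightarrow> smooth_on (\<lambda>x. \<Sum>i\<in>A. f i x) U"
  by (induction A rule: infinite_finite_induct) (auto intro!: smooth_intros)

lemma smooth_on_subset: "smooth_on f U \<Longrightarrow> V \<subseteq> U \<Longrightarrow> smooth_on f V"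
  unfolding smooth_on_def using Ck_on_subset by blast

lemma smooth_on_imp_continuous_on: "smooth_on f U \<Longrightarrow> continuous_on U f"
  unfolding smooth_on_def by (metis Ck_on.simps(1))

lemma smooth_on_real_deriv:
  fixes f :: "real \<Rightarrow> real"
  assumes "open U" "smooth_on f U"
  shows "smooth_on (deriv f) U" "\<And>x. x \<in> U \<Longrightarrow> (f has_real_derivative deriv f x) (at x)"
proof -
  show D: "(f has_real_derivative deriv f x) (at x)" if "x \<in> U" for x
    using assms(2) that unfolding smooth_on_def
    by (metis Ck_on.simps(2) DERIV_deriv_iff_real_differentiable)
  have "Ck_on k (deriv f) U" for k
  proof (rule Ck_on_cong[OF assms(1)])
    show "Ck_on k (\<lambda>x. frechet_derivative f (at x) 1) U"
      using assms(2) unfolding smooth_on_def by (metis Ck_on.simps(2))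
    fix x assume "x \<in> U"
    then show "frechet_derivative f (at x) 1 = deriv f x"
      using fun_cong[OF frechet_derivative_at[OF D[unfolded has_field_derivative_def]], of x 1] by simp
  qed
  then show "smooth_on (deriv f) U" by (simp add: smooth_on_def)
qed

lemma smooth_on_antideriv:
  fixes f :: "real \<Rightarrow> real"
  assumes "open U" "\<And>x. x \<in> U \<Longrightarrow> (f has_real_derivative f' x) (at x)" "smooth_on f' U"
  shows "smooth_on f U"
  unfolding smooth_on_def
  using assms Ck_on_lower Ck_on_real_SucI unfolding smooth_on_def by blast

text \<open>Bootstrapping of an autonomous equation; the case \<open>h = 1 / S'\<close> gives the smoothness of the
  inverse function of \<open>S\<close>.\<close>

lemma smooth_on_ode:
  fixes f h :: "real \<Rightarrow> real"
  assumes "open U" "\<And>x. x \<in> U \<Longrightarrow> (f has_real_derivative h (f x)) (at x)" "smooth_on h V" "f ` U \<subseteq> V"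
  shows "smooth_on f U"
proof -
  have "Ck_on k f U" for k
  proof (induction k)
    case 0
    show ?case using assms(2) by (auto intro!: continuous_at_imp_continuous_on DERIV_isCont)
  next
    case (Suc k)
    show ?case
      by (rule Ck_on_real_SucI[OF assms(1) assms(2)])
         (use assms Suc Ck_on_compose[OF assms(1) _ Suc assms(4)] in \<open>auto simp: smooth_on_def\<close>)
  qed
  then show ?thesis by (simp add: smooth_on_def)
qed

section \<open>Rank-one perturbations of multiples of the identity\<close>

text \<open>The definite description needs existence and uniqueness. \<open>C\<close> is
  \<open>\<gamma> * (1 + c)\<close> on the line of \<open>e\<close> and \<open>\<gamma>\<close> on
  its complement in \<open>V\<close>, so the explicit square root acts by scalars on both pieces.
  Uniqueness holds because any admissible root must act by these same scalars. \<open>P\<close> is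
  the orthogonal projection to \<open>V\<close>.\<close>

lemma inv_sqrt_on_rank_one:
  fixes V :: "'a::euclidean_space set"
  assumes V: "subspace V" and e: "e \<in> V" "norm e = 1" and g: "\<gamma> > 0"
    and P: "linear P" "\<And>v. P v \<in> V" "\<And>v. v \<in> V \<Longrightarrow> P v = v"
      "\<And>v w. w \<in> V \<Longrightarrow> (v - P v) \<bullet> w = 0"
    and C: "\<And>v. v \<in> V \<Longrightarrow> C v = \<gamma> *\<^sub>R (v + (c * (e \<bullet> v)) *\<^sub>R e)" and c: "c \<ge> 0"
    and v: "v \<in> V"
  shows "inv_sqrt_on V C v = (1 / sqrt \<gamma>) *\<^sub>R (v + ((1 / sqrt (1 + c) - 1) * (e \<bullet> v)) *\<^sub>R e)"
proof -
  define k where "k = 1 / sqrt (1 + c)"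
  have k: "k > 0" "k * k * (1 + c) = 1" using c by (auto simp: k_def field_simps)
  have rg: "sqrt \<gamma> > 0" "sqrt \<gamma> * sqrt \<gamma> = \<gamma>" using g by auto
  have ee: "e \<bullet> e = 1" using e(2) by (simp add: norm_eq_1)
  let ?Q = "\<lambda>S. linear S
      \<and> (\<forall>v\<in>V. S v \<in> V)
      \<and> (\<forall>v\<in>V. \<forall>w\<in>V. S v \<bullet> w = v \<bullet> S w)
      \<and> (\<forall>v\<in>V. v \<noteq> 0 \<longrightarrow> v \<bullet> S v > 0)
      \<and> (\<forall>v\<in>V. S (S (C v)) = v)
      \<and> (\<forall>v. (\<forall>w\<in>V. v \<bullet> w = 0) \<longrightarrow> S v = 0)"
  \<comment> \<open>On \<open>V\<close> the factor is \<open>k / sqrt \<gamma>\<close> along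
    \<open>e\<close> and \<open>1 / sqrt \<gamma>\<close> across it; composing with \<open>P\<close>
    gives the required value 0 on the orthogonal complement.\<close>
  define S0 where "S0 v = (1 / sqrt \<gamma>) *\<^sub>R (P v + ((k - 1) * (e \<bullet> P v)) *\<^sub>R e)" for v
  have S0V: "S0 v = (1 / sqrt \<gamma>) *\<^sub>R (v + ((k - 1) * (e \<bullet> v)) *\<^sub>R e)" if "v \<in> V" for v
    using P(3)[OF that] by (simp add: S0_def)
  have S0in: "S0 v \<in> V" for v
    unfolding S0_def by (intro subspace_scale subspace_add V P e)
  have CV: "C v \<in> V" if "v \<in> V" for v
    unfolding C[OF that] by (intro subspace_scale subspace_add V that e)
  have lin: "linear S0"
    unfolding S0_def
    by (rule linearI) (simp_all add: linear_add[OF P(1)] linear_cmul[OF P(1)] algebra_simps)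
  have pos: "v \<bullet> S0 v > 0" if "v \<in> V" "v \<noteq> 0" for v
  proof -
    have "(e \<bullet> v)\<^sup>2 \<le> v \<bullet> v"
      using Cauchy_Schwarz_ineq[of e v] ee by simp
    moreover have "v \<bullet> v > 0" using that by simp
    moreover have "v \<bullet> v + (k - 1) * (e \<bullet> v)\<^sup>2 > 0"
    proof (cases "(e \<bullet> v)\<^sup>2 > 0")
      case True
      then have "k * (e \<bullet> v)\<^sup>2 > 0" using k by simp
      then show ?thesis using calculation by (simp add: algebra_simps)
    next
      case False then show ?thesis using calculation by simp
    qed
    ultimately show ?thesis using rg(1)
      by (simp add: S0V[OF that(1)] inner_add_right inner_commute[of v e] power2_eq_square mult.assoc)
  qed
  have inv: "S0 (S0 (C v)) = v" if "v \<in> V" for v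
  proof -
    define w where "w = v + (c * (e \<bullet> v)) *\<^sub>R e"
    have ew: "e \<bullet> w = (1 + c) * (e \<bullet> v)" by (simp add: w_def inner_add_right ee algebra_simps)
    have wV: "w \<in> V" unfolding w_def by (intro subspace_scale subspace_add V that e)
    have "S0 (S0 (C v)) = \<gamma> *\<^sub>R S0 (S0 w)"
      unfolding C[OF that] w_def[symmetric] by (simp add: linear_cmul[OF lin])
    also have "S0 (S0 w) = (1 / \<gamma>) *\<^sub>R (w + ((k * k - 1) * (e \<bullet> w)) *\<^sub>R e)"
    proof -
      have "e \<bullet> S0 w = (1 / sqrt \<gamma>) * (k * (e \<bullet> w))"
        by (simp add: S0V[OF wV] inner_add_right ee algebra_simps)
      then have "S0 (S0 w) = (1 / sqrt \<gamma> * (1 / sqrt \<gamma>)) *\<^sub>R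
          (w + ((k - 1) * (e \<bullet> w)) *\<^sub>R e + ((k - 1) * (k * (e \<bullet> w))) *\<^sub>R e)"
        unfolding S0V[OF S0in, of w]
        by (simp only: S0V[OF wV] scaleR_add_right scaleR_scaleR mult_ac)
      also have "\<dots> = (1 / \<gamma>) *\<^sub>R (w + ((k - 1) * (e \<bullet> w) + (k - 1) * (k * (e \<bullet> w))) *\<^sub>R e)"
        using rg by (simp add: scaleR_add_left add.assoc)
      also have "(k - 1) * (e \<bullet> w) + (k - 1) * (k * (e \<bullet> w)) = (k * k - 1) * (e \<bullet> w)"
        by (simp add: algebra_simps)
      finally show ?thesis .
    qed
    also have "\<gamma> *\<^sub>R \<dots> = w + ((k * k - 1) * (e \<bullet> w)) *\<^sub>R e" using g by simp
    also have "\<dots> = v + ((c + (k * k * (1 + c) - (1 + c))) * (e \<bullet> v)) *\<^sub>R e"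
      unfolding ew by (simp add: w_def algebra_simps)
    also have "\<dots> = v" by (simp add: k(2))
    finally show ?thesis .
  qed
  have Q0: "?Q S0"
  proof (intro conjI ballI allI impI)
    show "S0 v \<bullet> w = v \<bullet> S0 w" if "v \<in> V" "w \<in> V" for v w
      unfolding S0V[OF that(1)] S0V[OF that(2)]
      by (simp add: inner_add_right inner_add_left inner_commute)
    show "S0 v = 0" if "\<forall>w\<in>V. v \<bullet> w = 0" for v
    proof -
      have "P v \<bullet> P v = 0" using that P(4)[OF P(2), of v v] P(2) by (simp add: inner_diff_left)
      then show ?thesis by (simp add: S0_def)
    qed
  qed (use lin S0in pos inv in blast)+
  \<comment> \<open>If \<open>w = S v - v / sqrt \<mu>\<close> were nonzero, then S^2 v = v / \<mu>
    would make \<open>w\<close> an eigenvector of \<open>S\<close> with eigenvalue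
    \<open>-1 / sqrt \<mu>\<close>, against positivity of \<open>S\<close>.\<close>
  have eig: "S v = (1 / sqrt \<mu>) *\<^sub>R v" if S: "?Q S" and v: "v \<in> V" "C v = \<mu> *\<^sub>R v" "\<mu> > 0" for S v \<mu>
  proof (rule ccontr)
    define w where "w = S v - (1 / sqrt \<mu>) *\<^sub>R v"
    assume "\<not> ?thesis"
    then have w0: "w \<noteq> 0" by (simp add: w_def)
    have wV: "w \<in> V" unfolding w_def using S v by (auto intro!: subspace_diff subspace_scale V)
    have l: "linear S" using S by blast
    have "S (S (\<mu> *\<^sub>R v)) = v" using S v by force
    then have "\<mu> *\<^sub>R S (S v) = v" by (simp add: linear_cmul[OF l])
    then have "(1 / \<mu>) *\<^sub>R (\<mu> *\<^sub>R S (S v)) = (1 / \<mu>) *\<^sub>R v" by (rule arg_cong)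
    then have "S (S v) = (1 / \<mu>) *\<^sub>R v" using v(3) by simp
    moreover have "1 / \<mu> = (1 / sqrt \<mu>) * (1 / sqrt \<mu>)" using v(3) by simp
    ultimately have "S w = - (1 / sqrt \<mu>) *\<^sub>R w"
      by (simp add: w_def linear_diff[OF l] linear_cmul[OF l] algebra_simps)
    then have "w \<bullet> S w \<le> 0" using v(3) by simp
    moreover have "w \<bullet> S w > 0" using S w0 wV by blast
    ultimately show False by simp
  qed
  have uniq: "S = S0" if S: "?Q S" for S
  proof
    fix v
    have l: "linear S" using S by blast
    define w where "w = P v"
    define z where "z = w - (e \<bullet> w) *\<^sub>R e"
    have wV: "w \<in> V" and zV: "z \<in> V"
      unfolding w_def z_def by (auto intro!: subspace_diff subspace_scale V P e)
    have ez: "e \<bullet> z = 0" by (simp add: z_def inner_diff_right ee)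
    have ker: "T v = T w" if "?Q T" for T
    proof -
      have "\<forall>u\<in>V. (v - w) \<bullet> u = 0" by (simp add: w_def P(4))
      then have "T (v - w) = 0" using that by blast
      then show ?thesis using that linear_diff[of T v w] by simp
    qed
    have Ce: "C e = (\<gamma> * (1 + c)) *\<^sub>R e"
      by (simp add: C[OF e(1)] ee algebra_simps)
    have gc: "\<gamma> * (1 + c) > 0" using c g by simp
    have "S z = (1 / sqrt \<gamma>) *\<^sub>R z"
      by (rule eig[OF S zV]) (simp_all add: C[OF zV] ez g)
    moreover have "S0 z = (1 / sqrt \<gamma>) *\<^sub>R z"
      by (rule eig[OF Q0 zV]) (simp_all add: C[OF zV] ez g)
    moreover note eig[OF S e(1) Ce gc] eig[OF Q0 e(1) Ce gc]
    ultimately have "S (z + (e \<bullet> w) *\<^sub>R e) = S0 (z + (e \<bullet> w) *\<^sub>R e)"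
      by (simp add: linear_add[OF l] linear_cmul[OF l] linear_add[OF lin] linear_cmul[OF lin])
    then have "S w = S0 w" by (simp add: z_def)
    then show "S v = S0 v" using ker[OF S] ker[OF Q0] by simp
  qed
  have "inv_sqrt_on V C = S0"
    unfolding inv_sqrt_on_def
  proof (rule the_equality)
    show "?Q S0" by (fact Q0)
    fix S assume "?Q S"
    then show "S = S0" by (rule uniq)
  qed
  then show ?thesis using S0V[OF v] by (simp add: k_def)
qed

text \<open>The eigenspaces are the line of \<open>e\<close> and its complement in \<open>V\<close>.
  Two degenerate cases need separate treatment because the sum runs over distinct eigenvalues: for
  \<open>\<alpha> = \<beta>\<close> the two spaces merge, and for \<open>dim V = 1\<close> only
  \<open>\<alpha>\<close> is an eigenvalue, while the coefficient of \<open>arctan \<beta>\<close>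
  is 0. The latter is the case of the boundary tangent line when n = 2.\<close>

lemma sum_arctan_eig_rank_one:
  fixes V :: "'a::euclidean_space set"
  assumes V: "subspace V" and e: "e \<in> V" "norm e = 1"
    and L: "\<And>v. v \<in> V \<Longrightarrow> L v = \<beta> *\<^sub>R v + ((\<alpha> - \<beta>) * (e \<bullet> v)) *\<^sub>R e"
  shows "sum_arctan_eig V L = arctan \<alpha> + (real (dim V) - 1) * arctan \<beta>"
proof -
  have ee: "e \<bullet> e = 1" "e \<noteq> 0" using e(2) by (auto simp: norm_eq_1)
  let ?W = "{v \<in> V. e \<bullet> v = 0}"
  let ?E = "\<lambda>\<mu>. {v \<in> V. L v = \<mu> *\<^sub>R v}"
  have dspan: "dim (span {e}) = 1" using ee by simp
  have "dim {y \<in> V. \<forall>x\<in>span {e}. orthogonal x y} + dim (span {e}) = dim V"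
    by (rule dim_subspace_orthogonal_to_vectors)
       (use V e in \<open>auto intro: subspace_span span_minimal simp: span_minimal\<close>)
  moreover have "{y \<in> V. \<forall>x\<in>span {e}. orthogonal x y} = ?W"
    by (auto simp: orthogonal_def span_singleton)
  ultimately have dW: "dim ?W + 1 = dim V" using dspan by simp
  have eq: "L v = \<mu> *\<^sub>R v \<longleftrightarrow> (\<mu> - \<beta>) *\<^sub>R v = ((\<alpha> - \<beta>) * (e \<bullet> v)) *\<^sub>R e" if "v \<in> V" for v \<mu>
    unfolding L[OF that] by (auto simp: algebra_simps)
  have Ea: "(\<mu> - \<alpha>) * (e \<bullet> v) = 0" if "v \<in> V" "L v = \<mu> *\<^sub>R v" for v \<mu>
    using arg_cong[OF that(2)[unfolded eq[OF that(1)]], of "\<lambda>z. e \<bullet> z"] ee by (simp add: algebra_simps)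
  have Eab: "\<mu> = \<alpha> \<or> \<mu> = \<beta> \<and> e \<bullet> v = 0" if "v \<in> V" "v \<noteq> 0" "L v = \<mu> *\<^sub>R v" for v \<mu>
    using Ea[OF that(1,3)] that(3)[unfolded eq[OF that(1)]] that(2) by auto
  have aE: "L e = \<alpha> *\<^sub>R e" unfolding L[OF e(1)] ee by (simp add: algebra_simps)
  show ?thesis
  proof (cases "\<alpha> = \<beta>")
    case True
    then have Lv: "L v = \<beta> *\<^sub>R v" if "v \<in> V" for v using L[OF that] by simp
    have "{\<mu>. \<exists>v\<in>V. v \<noteq> 0 \<and> L v = \<mu> *\<^sub>R v} = {\<beta>}"
      using Lv e ee by auto
    moreover have "?E \<beta> = V" using Lv by auto
    ultimately show ?thesis unfolding sum_arctan_eig_def by (simp add: True algebra_simps)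
  next
    case False
    have "?E \<alpha> = span {e}"
    proof
      show "?E \<alpha> \<subseteq> span {e}"
      proof
        fix v assume "v \<in> ?E \<alpha>"
        then have "(\<alpha> - \<beta>) *\<^sub>R v = (\<alpha> - \<beta>) *\<^sub>R ((e \<bullet> v) *\<^sub>R e)"
          using eq[of v \<alpha>] unfolding scaleR_scaleR by blast
        then have "v = (e \<bullet> v) *\<^sub>R e" using False by (subst (asm) scaleR_cancel_left) simp
        then show "v \<in> span {e}" by (metis rangeI span_singleton)
      qed
      show "span {e} \<subseteq> ?E \<alpha>"
      proof
        fix v assume "v \<in> span {e}"
        then obtain d where v: "v = d *\<^sub>R e" by (auto simp: span_singleton)
        have "v \<in> V" unfolding v by (rule subspace_scale[OF V e(1)])
        moreover from this have "L v = \<alpha> *\<^sub>R v"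
          using L[OF \<open>v \<in> V\<close>] by (simp add: v ee scaleR_add_left[symmetric]) (simp add: algebra_simps)
        ultimately show "v \<in> ?E \<alpha>" by simp
      qed
    qed
    then have dA: "dim (?E \<alpha>) = 1" using dspan by metis
    have "L v = \<beta> *\<^sub>R v \<longleftrightarrow> e \<bullet> v = 0" if "v \<in> V" for v
      unfolding eq[OF that] using False ee by simp
    then have "?E \<beta> = ?W" by blast
    then have dB: "dim (?E \<beta>) = dim V - 1" using dW by (metis add_diff_cancel_right')
    show ?thesis
    proof (cases "dim V = 1")
      case True
      then have W0: "?W \<subseteq> {0}" using dW by (simp add: dim_eq_0)
      have "{\<mu>. \<exists>v\<in>V. v \<noteq> 0 \<and> L v = \<mu> *\<^sub>R v} = {\<alpha>}"
      proof
        show "{\<mu>. \<exists>v\<in>V. v \<noteq> 0 \<and> L v = \<mu> *\<^sub>R v} \<subseteq> {\<alpha>}"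
        proof
          fix \<mu> assume "\<mu> \<in> {\<mu>. \<exists>v\<in>V. v \<noteq> 0 \<and> L v = \<mu> *\<^sub>R v}"
          then obtain v where "v \<in> V" "v \<noteq> 0" "L v = \<mu> *\<^sub>R v" by blast
          then show "\<mu> \<in> {\<alpha>}" using Eab[of v \<mu>] W0 by blast
        qed
        show "{\<alpha>} \<subseteq> {\<mu>. \<exists>v\<in>V. v \<noteq> 0 \<and> L v = \<mu> *\<^sub>R v}" using aE e ee by auto
      qed
      then show ?thesis unfolding sum_arctan_eig_def using dA True by simp
    next
      case False2: False
      then have "dim ?W \<noteq> 0" using dW by linarith
      then have "\<not> ?W \<subseteq> {0}" by (metis dim_eq_0)
      then obtain w where w: "w \<in> V" "e \<bullet> w = 0" "w \<noteq> 0" by (metis (mono_tags, lifting) insertI1 mem_Collect_eq subsetI)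
      then have "L w = \<beta> *\<^sub>R w" using L[OF w(1)] by simp
      have "{\<mu>. \<exists>v\<in>V. v \<noteq> 0 \<and> L v = \<mu> *\<^sub>R v} = {\<alpha>, \<beta>}"
      proof (intro equalityI subsetI)
        fix \<mu> assume "\<mu> \<in> {\<mu>. \<exists>v\<in>V. v \<noteq> 0 \<and> L v = \<mu> *\<^sub>R v}"
        then obtain v where "v \<in> V" "v \<noteq> 0" "L v = \<mu> *\<^sub>R v" by blast
        then show "\<mu> \<in> {\<alpha>, \<beta>}" using Eab[of v \<mu>] by blast
      next
        fix \<mu> assume "\<mu> \<in> {\<alpha>, \<beta>}"
        then show "\<mu> \<in> {\<mu>. \<exists>v\<in>V. v \<noteq> 0 \<and> L v = \<mu> *\<^sub>R v}"
          using aE e ee w \<open>L w = \<beta> *\<^sub>R w\<close> by blast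
      qed
      moreover have "real (dim V - 1) = real (dim V) - 1" using dW by simp
      ultimately show ?thesis unfolding sum_arctan_eig_def using dA dB False by simp
    qed
  qed
qed

text \<open>One formula serves both curvature operators. For \<open>A_op\<close> the scalar factor
  stands outside, as \<open>s\<close>, and \<open>\<gamma> = 1\<close>; for \<open>calB\<close> it
  is part of \<open>C1T_op\<close>, as \<open>\<gamma>\<close>, and \<open>s = 1\<close>.\<close>

lemma sum_arctan_eig_conj_inv_sqrt:
  fixes V :: "'a::euclidean_space set"
  assumes V: "subspace V" and e: "e \<in> V" "norm e = 1" and g: "\<gamma> > 0"
    and P: "linear P" "\<And>v. P v \<in> V" "\<And>v. v \<in> V \<Longrightarrow> P v = v"
      "\<And>v w. w \<in> V \<Longrightarrow> (v - P v) \<bullet> w = 0"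
    and C: "\<And>v. v \<in> V \<Longrightarrow> C v = \<gamma> *\<^sub>R (v + (c * (e \<bullet> v)) *\<^sub>R e)" and c: "c \<ge> 0"
    and H: "\<And>v. v \<in> V \<Longrightarrow> H v = b *\<^sub>R v + (d * (e \<bullet> v)) *\<^sub>R e"
  shows "sum_arctan_eig V (\<lambda>v. s *\<^sub>R inv_sqrt_on V C (H (inv_sqrt_on V C v)))
    = arctan (s * (b + d) / (\<gamma> * (1 + c))) + (real (dim V) - 1) * arctan (s * b / \<gamma>)"
proof (rule sum_arctan_eig_rank_one[OF V e])
  fix v assume v: "v \<in> V"
  let ?R = "inv_sqrt_on V C"
  define k where "k = 1 / sqrt \<gamma>"
  define j where "j = 1 / sqrt (1 + c)"
  have ee: "e \<bullet> e = 1" using e(2) by (simp add: norm_eq_1)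
  have R: "?R v = k *\<^sub>R (v + ((j - 1) * (e \<bullet> v)) *\<^sub>R e)" if "v \<in> V" for v
    unfolding k_def j_def by (rule inv_sqrt_on_rank_one[OF V e g P C c that])
  define w where "w = v + ((j - 1) * (e \<bullet> v)) *\<^sub>R e"
  define z where "z = b *\<^sub>R w + (d * (e \<bullet> w)) *\<^sub>R e"
  have wV: "w \<in> V" and zV: "z \<in> V"
    unfolding w_def z_def by (intro subspace_add subspace_scale V v e)+
  have ew: "e \<bullet> w = j * (e \<bullet> v)" by (simp add: w_def inner_add_right ee algebra_simps)
  have ez: "e \<bullet> z = (b + d) * (j * (e \<bullet> v))" by (simp add: z_def inner_add_right ee ew algebra_simps)
  have "H (?R v) = k *\<^sub>R z"
    unfolding R[OF v] w_def[symmetric] H[OF subspace_scale[OF V wV]] z_def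
    by (simp add: scaleR_add_right mult_ac)
  moreover have "?R (k *\<^sub>R z) = (k * k) *\<^sub>R (z + ((j - 1) * (e \<bullet> z)) *\<^sub>R e)"
    unfolding R[OF subspace_scale[OF V zV]] by (simp add: scaleR_add_right mult_ac)
  moreover have "z + ((j - 1) * (e \<bullet> z)) *\<^sub>R e = b *\<^sub>R v + (((j * j) * (b + d) - b) * (e \<bullet> v)) *\<^sub>R e"
  proof -
    have "z + ((j - 1) * (e \<bullet> z)) *\<^sub>R e
      = b *\<^sub>R v + (b * ((j - 1) * (e \<bullet> v)) + d * (e \<bullet> w) + (j - 1) * (e \<bullet> z)) *\<^sub>R e"
      unfolding z_def w_def by (simp add: scaleR_add_right scaleR_add_left)
    also have "b * ((j - 1) * (e \<bullet> v)) + d * (e \<bullet> w) + (j - 1) * (e \<bullet> z)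
      = ((j * j) * (b + d) - b) * (e \<bullet> v)" unfolding ez ew by (simp add: algebra_simps)
    finally show ?thesis .
  qed
  moreover have "k * k = 1 / \<gamma>" "j * j = 1 / (1 + c)" using g c by (auto simp: k_def j_def)
  ultimately have "s *\<^sub>R ?R (H (?R v)) = (s / \<gamma>) *\<^sub>R (b *\<^sub>R v + (((b + d) / (1 + c) - b) * (e \<bullet> v)) *\<^sub>R e)"
    by simp
  moreover have "s / \<gamma> * (((b + d) / (1 + c) - b) * (e \<bullet> v))
      = (s * (b + d) / (\<gamma> * (1 + c)) - s * b / \<gamma>) * (e \<bullet> v)"
    by (simp add: right_diff_distrib left_diff_distrib diff_divide_distrib)
  ultimately show "s *\<^sub>R ?R (H (?R v)) = (s * b / \<gamma>) *\<^sub>R v +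
      ((s * (b + d) / (\<gamma> * (1 + c)) - s * b / \<gamma>) * (e \<bullet> v)) *\<^sub>R e"
    by (simp add: scaleR_add_right)
qed

section \<open>Radial functions and their covariant derivatives on spheres\<close>

text \<open>\<open>frechet_derivative\<close> is total, so its value alone permits no product rule.
  Recording differentiability together with a single directional value gives rules that compose and
  can be applied to frozen tangent vectors.\<close>

definition dir_deriv :: "('a::real_normed_vector \<Rightarrow> real) \<Rightarrow> 'a \<Rightarrow> 'a \<Rightarrow> real \<Rightarrow> bool" where
  "dir_deriv f x v d \<longleftrightarrow> f differentiable (at x) \<and> frechet_derivative f (at x) v = d"

lemma dir_derivI: "(f has_derivative D) (at x) \<Longrightarrow> D v = d \<Longrightarrow> dir_deriv f x v d"
  unfolding dir_deriv_def using frechet_derivative_at differentiable_def by metis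

lemma dir_derivD: "dir_deriv f x v d \<Longrightarrow> (f has_derivative frechet_derivative f (at x)) (at x)"
  unfolding dir_deriv_def using frechet_derivative_works by blast

lemma dir_deriv_add: "dir_deriv f x v a \<Longrightarrow> dir_deriv g x v b \<Longrightarrow> dir_deriv (\<lambda>y. f y + g y) x v (a + b)"
  by (rule dir_derivI[OF has_derivative_add[OF dir_derivD dir_derivD]]) (auto simp: dir_deriv_def)

lemma dir_deriv_diff: "dir_deriv f x v a \<Longrightarrow> dir_deriv g x v b \<Longrightarrow> dir_deriv (\<lambda>y. f y - g y) x v (a - b)"
  by (rule dir_derivI[OF has_derivative_diff[OF dir_derivD dir_derivD]]) (auto simp: dir_deriv_def)

lemma dir_deriv_mult:
  "dir_deriv f x v a \<Longrightarrow> dir_deriv g x v b \<Longrightarrow> dir_deriv (\<lambda>y. f y * g y) x v (f x * b + a * g x)"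
  by (rule dir_derivI[OF has_derivative_mult[OF dir_derivD dir_derivD]]) (auto simp: dir_deriv_def)

lemma dir_deriv_const: "dir_deriv (\<lambda>y. c) x v 0"
  by (rule dir_derivI[OF has_derivative_const]) simp

lemma dir_deriv_inner: "dir_deriv (\<lambda>y. y \<bullet> w) x v (v \<bullet> w)"
  by (rule dir_derivI[OF bounded_linear_imp_has_derivative[OF bounded_linear_inner_left]]) simp

lemma dir_deriv_cong:
  assumes "dir_deriv f x v d" "open U" "x \<in> U" "\<And>y. y \<in> U \<Longrightarrow> f y = g y"
  shows "dir_deriv g x v d"
  using dir_derivI[OF has_derivative_transform_within_open[OF dir_derivD[OF assms(1)] assms(2,3,4)]]
    assms(1) by (simp add: dir_deriv_def)

lemma dir_deriv_eq: "dir_deriv f x v d \<Longrightarrow> d = d' \<Longrightarrow> dir_deriv f x v d'" by simp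

lemmas dir_deriv_intros = dir_deriv_add dir_deriv_diff dir_deriv_mult dir_deriv_const

lemma riesz_inner: "riesz (\<lambda>v. w \<bullet> v) = w"
  unfolding riesz_def by (rule euclidean_representation)

section \<open>Spheres centred at the origin\<close>

lemma nu_0: "x \<noteq> 0 \<Longrightarrow> nu 0 x = - (x /\<^sub>R norm x)"
  by (simp add: nu_def sgn_div_norm)

lemma tproj_0: "x \<noteq> 0 \<Longrightarrow> tproj 0 x v = v - ((x \<bullet> v) / (x \<bullet> x)) *\<^sub>R x"
  by (simp add: tproj_def nu_0 inner_commute dot_square_norm power2_eq_square field_simps)

lemma inner_tproj_0: "x \<noteq> 0 \<Longrightarrow> x \<bullet> tproj 0 x v = 0"
  by (simp add: tproj_0 inner_diff_right)

lemma tproj_tproj_0: "x \<noteq> 0 \<Longrightarrow> tproj 0 x (tproj 0 x v) = tproj 0 x v"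
  by (subst tproj_0) (simp_all add: inner_tproj_0)

lemma tangent_0: "x \<noteq> 0 \<Longrightarrow> tangent 0 x = {v. x \<bullet> v = 0}"
  by (auto simp: tangent_def nu_0 inner_commute)

lemma tproj_eq_self: "x \<noteq> 0 \<Longrightarrow> v \<in> tangent 0 x \<Longrightarrow> tproj 0 x v = v"
  by (simp add: tangent_0 tproj_0)

lemma linear_tproj: "linear (tproj c x)"
  by (rule linearI) (simp_all add: tproj_def inner_add_left algebra_simps)

lemma subspace_tangent: "subspace (tangent c x)"
  unfolding tangent_def by (rule subspaceI) (auto simp: inner_add_left)

lemma dim_tangent_0:
  fixes x :: "'a::euclidean_space"
  assumes "x \<noteq> 0" shows "dim (tangent 0 x) = DIM('a) - 1"
  using dim_hyperplane[of x] assms by (simp add: tangent_0)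

lemma tproj_self_adjoint: "tproj c x v \<bullet> w = v \<bullet> tproj c x w"
  by (simp add: tproj_def inner_diff_left inner_diff_right inner_commute)

lemma norm_tproj:
  assumes "x \<noteq> 0" shows "(norm (tproj 0 x v))\<^sup>2 + (v \<bullet> nu 0 x)\<^sup>2 = (norm v)\<^sup>2"
proof -
  have "nu 0 x \<bullet> nu 0 x = 1"
    using assms by (simp add: nu_def norm_sgn flip: power2_norm_eq_inner)
  then show ?thesis
    unfolding power2_norm_eq_inner tproj_def
    by (simp add: inner_diff_left inner_diff_right inner_commute power2_eq_square)
qed

lemma second_ff_0:
  assumes x: "x \<noteq> 0" shows "second_ff 0 x X Y = (tproj 0 x X \<bullet> tproj 0 x Y) / norm x"
proof -
  let ?D = "\<lambda>v. - (inverse (norm x) *\<^sub>R v + (- (inverse (norm x) * (v \<bullet> sgn x) * inverse (norm x))) *\<^sub>R x)"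
  have "((\<lambda>y. - (inverse (norm y) *\<^sub>R y)) has_derivative ?D) (at x)"
    using x by (intro derivative_intros has_derivative_norm) auto
  then have "(nu 0 has_derivative ?D) (at x)"
    by (rule has_derivative_transform_within_open[of _ _ _ _ "-{0}"]) (use x in \<open>auto simp: nu_0\<close>)
  then have "frechet_derivative (nu 0) (at x) = ?D" by (rule frechet_derivative_at[symmetric])
  then have "frechet_derivative (nu 0) (at x) (tproj 0 x X) = - (inverse (norm x) *\<^sub>R tproj 0 x X)"
    using x by (simp add: sgn_div_norm inner_tproj_0 inner_commute[of _ x])
  then show ?thesis by (simp add: second_ff_def divide_inverse)
qed

text \<open>The profile is a function of the squared distance to \<open>p\<close>, a polynomial, so
  no square root enters the derivatives. Four explicit derivatives suffice for the intrinsic fourth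
  derivatives of the trace.\<close>

locale radial_profile =
  fixes p :: "'a::euclidean_space" and I :: "real set" and \<phi>0 \<phi>1 \<phi>2 \<phi>3 \<phi>4 :: "real \<Rightarrow> real"
  assumes open_I: "open I"
    and d0: "\<And>s. s \<in> I \<Longrightarrow> (\<phi>0 has_real_derivative \<phi>1 s) (at s)"
    and d1: "\<And>s. s \<in> I \<Longrightarrow> (\<phi>1 has_real_derivative \<phi>2 s) (at s)"
    and d2: "\<And>s. s \<in> I \<Longrightarrow> (\<phi>2 has_real_derivative \<phi>3 s) (at s)"
    and d3: "\<And>s. s \<in> I \<Longrightarrow> (\<phi>3 has_real_derivative \<phi>4 s) (at s)"
begin

definition \<sigma> :: "'a \<Rightarrow> real" where "\<sigma> x = (x - p) \<bullet> (x - p)"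
definition u :: "'a \<Rightarrow> real" where "u x = \<phi>0 (\<sigma> x)"
definition N :: "'a set" where "N = {x. \<sigma> x \<in> I}"

lemma continuous_on_\<sigma>: "continuous_on S \<sigma>"
  unfolding \<sigma>_def by (intro continuous_intros)

lemma open_N: "open N"
  using open_vimage[OF open_I continuous_on_\<sigma>] unfolding N_def vimage_def .

lemma has_derivative_\<sigma>: "(\<sigma> has_derivative (\<lambda>v. 2 * ((x - p) \<bullet> v))) (at x)"
  unfolding \<sigma>_def by (auto intro!: derivative_eq_intros simp: inner_commute)

lemma has_derivative_compose_\<sigma>:
  assumes "(h has_real_derivative h') (at (\<sigma> x))"
  shows "((\<lambda>y. h (\<sigma> y)) has_derivative (\<lambda>v. h' * (2 * ((x - p) \<bullet> v)))) (at x)"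
  using diff_chain_at[OF has_derivative_\<sigma> assms[unfolded has_field_derivative_def]] by (simp add: o_def)

lemma smooth_u:
  assumes "smooth_on \<phi>0 I" shows "smooth_on u N"
proof -
  have "\<sigma> = (\<lambda>x. (\<Sum>b\<in>Basis. (x \<bullet> b - p \<bullet> b) ^ 2))"
    unfolding \<sigma>_def by (subst euclidean_inner) (simp add: inner_diff_left power2_eq_square)
  then have "smooth_on \<sigma> N" by (auto intro!: smooth_intros open_N)
  then show ?thesis
    unfolding u_def by (intro smooth_on_compose[OF assms open_N]) (auto simp: N_def)
qed

lemma grad_u:
  assumes "x \<in> N" shows "grad u x = (2 * \<phi>1 (\<sigma> x)) *\<^sub>R (x - p)"
proof -
  have "(u has_derivative (\<lambda>v. \<phi>1 (\<sigma> x) * (2 * ((x - p) \<bullet> v)))) (at x)"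
    unfolding u_def by (rule has_derivative_compose_\<sigma>[OF d0]) (use assms in \<open>simp add: N_def\<close>)
  then have "frechet_derivative u (at x) = (\<lambda>v. ((2 * \<phi>1 (\<sigma> x)) *\<^sub>R (x - p)) \<bullet> v)"
    by (simp add: frechet_derivative_at[symmetric] mult_ac)
  then show ?thesis unfolding grad_def by (simp only: riesz_inner)
qed

lemma hess_u:
  assumes "x \<in> N"
  shows "hess u x v = (2 * \<phi>1 (\<sigma> x)) *\<^sub>R v + (4 * \<phi>2 (\<sigma> x) * ((x - p) \<bullet> v)) *\<^sub>R (x - p)"
proof -
  have "((\<lambda>y. (2 * \<phi>1 (\<sigma> y)) *\<^sub>R (y - p)) has_derivative
      (\<lambda>v. (2 * \<phi>1 (\<sigma> x)) *\<^sub>R v + (2 * (\<phi>2 (\<sigma> x) * (2 * ((x - p) \<bullet> v)))) *\<^sub>R (x - p))) (at x)"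
    by (rule has_derivative_eq_rhs, (rule derivative_intros has_derivative_compose_\<sigma>[OF d1])+)
       (use assms in \<open>auto simp: N_def intro!: derivative_eq_intros\<close>)
  then have "(grad u has_derivative
      (\<lambda>v. (2 * \<phi>1 (\<sigma> x)) *\<^sub>R v + (2 * (\<phi>2 (\<sigma> x) * (2 * ((x - p) \<bullet> v)))) *\<^sub>R (x - p))) (at x)"
    by (rule has_derivative_transform_within_open[OF _ open_N assms]) (simp add: grad_u)
  then show ?thesis unfolding hess_def by (simp add: frechet_derivative_at[symmetric] mult_ac)
qed

text \<open>On the sphere through \<open>x\<close> centred at the origin, \<open>d\<sigma> = dg\<close> with \<open>g = - 2 p \<bullet> x\<close>, and the
  covariant Hessian of \<open>g\<close> is \<open>- \<kappa> G\<close>, where \<open>G\<close> is the metric. All covariant derivatives of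
  \<open>u\<close> are thus polynomials in \<open>\<alpha> = d\<sigma>\<close>, \<open>G\<close>, \<open>\<kappa>\<close> and \<open>\<iota> = |x|\<^sup>-\<^sup>2\<close>.\<close>

definition \<iota> :: "'a \<Rightarrow> real" where "\<iota> x = inverse (x \<bullet> x)"
definition \<kappa> :: "'a \<Rightarrow> real" where "\<kappa> x = (-2) * (x \<bullet> p) * \<iota> x"
definition \<alpha> :: "'a \<Rightarrow> 'a \<Rightarrow> real" where "\<alpha> X x = (-2) * (p \<bullet> X) - \<kappa> x * (x \<bullet> X)"
definition G :: "'a \<Rightarrow> 'a \<Rightarrow> 'a \<Rightarrow> real" where "G X Y x = X \<bullet> Y - (x \<bullet> X) * (x \<bullet> Y) * \<iota> x"

context
  fixes x :: 'a assumes x: "x \<in> N" "x \<noteq> 0"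
begin

private abbreviation "pr \<equiv> tproj 0 x"

lemma \<alpha>_inner: "\<alpha> X x = (-2) * (p \<bullet> pr X)"
  using x by (simp add: \<alpha>_def \<kappa>_def \<iota>_def tproj_0 inner_diff_right inner_commute field_simps)

lemma \<alpha>_inner2: "\<alpha> X x = 2 * (pr (x - p) \<bullet> X)"
  using x by (simp add: \<alpha>_inner tproj_self_adjoint inner_diff_left inner_tproj_0)

lemma G_inner: "G X Y x = pr X \<bullet> pr Y"
  using x by (simp add: G_def \<iota>_def tproj_0 inner_diff_right inner_diff_left inner_commute field_simps)

lemma G_inner2: "G X Y x = pr X \<bullet> Y"
  using x by (simp add: G_def \<iota>_def tproj_0 inner_diff_right inner_diff_left inner_commute field_simps)

lemma \<alpha>_pr: "\<alpha> (pr X) x = \<alpha> X x" and G_pr: "G (pr X) (pr Y) x = G X Y x"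
  using x by (simp_all add: \<alpha>_inner G_inner tproj_tproj_0)

lemma dir_deriv_\<iota>: "dir_deriv \<iota> x (pr X) 0"
proof (rule dir_derivI)
  show "(\<iota> has_derivative (\<lambda>v. - (inverse (x \<bullet> x) * (2 * (x \<bullet> v)) * inverse (x \<bullet> x)))) (at x)"
    unfolding \<iota>_def using x by (auto intro!: derivative_eq_intros simp: inner_commute)
qed (use x in \<open>simp add: inner_tproj_0\<close>)

lemma dir_deriv_\<kappa>: "dir_deriv \<kappa> x (pr X) (\<alpha> X x * \<iota> x)"
  unfolding \<kappa>_def
  by (rule dir_deriv_eq, (rule dir_deriv_intros dir_deriv_inner dir_deriv_\<iota>)+)
     (simp add: \<alpha>_inner inner_commute)

lemma dir_deriv_\<alpha>: "dir_deriv (\<alpha> (pr Y)) x (pr X) (- \<kappa> x * G X Y x)"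
  unfolding \<alpha>_def
  by (rule dir_deriv_eq, (rule dir_deriv_intros dir_deriv_inner dir_deriv_\<kappa>)+)
     (use x in \<open>simp add: inner_tproj_0 G_inner\<close>)

lemma dir_deriv_G: "dir_deriv (G (pr Y) (pr Z)) x (pr X) 0"
  unfolding G_def
  by (rule dir_deriv_eq, (rule dir_deriv_intros dir_deriv_inner dir_deriv_\<iota>)+)
     (use x in \<open>simp add: inner_tproj_0\<close>)

lemma dir_deriv_compose_\<sigma>:
  assumes "\<And>s. s \<in> I \<Longrightarrow> (h has_real_derivative h' s) (at s)"
  shows "dir_deriv (\<lambda>y. h (\<sigma> y)) x (pr X) (h' (\<sigma> x) * \<alpha> X x)"
  by (rule dir_derivI[OF has_derivative_compose_\<sigma>[OF assms]])
     (use x in \<open>auto simp: N_def \<alpha>_inner inner_diff_left inner_tproj_0\<close>)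

lemmas dir_deriv_basic = dir_deriv_\<iota> dir_deriv_\<kappa> dir_deriv_\<alpha> dir_deriv_G
  dir_deriv_compose_\<sigma>[OF d0] dir_deriv_compose_\<sigma>[OF d1]
  dir_deriv_compose_\<sigma>[OF d2] dir_deriv_compose_\<sigma>[OF d3]

text \<open>The recursion differentiates with the arguments projected at the fixed point
  \<open>x\<close>, whereas the formula for the lower order must hold at all nearby
  \<open>y\<close>. Hence the arguments \<open>pr Ys\<close> stay frozen while \<open>y\<close>
  varies; \<open>\<alpha>_pr\<close> and \<open>G_pr\<close> remove these projections once the
  derivative is evaluated at \<open>x\<close>.\<close>

lemma cov_deriv_step:
  assumes "\<And>y. y \<in> N \<Longrightarrow> y \<noteq> 0 \<Longrightarrow> cov_deriv 0 u (map pr Ys) y = f y"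
    and "dir_deriv f x (pr X) d"
  shows "cov_deriv 0 u (X # Ys) x = d"
proof -
  have "open (N - {0})" using open_N by (rule open_Diff) simp
  then have "dir_deriv (cov_deriv 0 u (map pr Ys)) x (pr X) d"
    using x by (intro dir_deriv_cong[OF assms(2), of "N - {0}"]) (auto simp: assms(1))
  then show ?thesis by (simp add: dir_deriv_def)
qed

end

lemma cov_deriv_1:
  assumes "x \<in> N" "x \<noteq> 0" shows "cov_deriv 0 u [X] x = \<phi>1 (\<sigma> x) * \<alpha> X x"
  by (rule cov_deriv_step[OF assms _ dir_deriv_compose_\<sigma>[OF assms d0]]) (auto simp: u_def)

lemma cov_deriv_2:
  assumes "x \<in> N" "x \<noteq> 0"
  shows "cov_deriv 0 u [X, Y] x = \<phi>2 (\<sigma> x) * (\<alpha> X x * \<alpha> Y x) - \<phi>1 (\<sigma> x) * (\<kappa> x * G X Y x)"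
proof (rule cov_deriv_step[OF assms, where f = "\<lambda>y. \<phi>1 (\<sigma> y) * \<alpha> (tproj 0 x Y) y"])
  fix y assume "y \<in> N" "y \<noteq> 0"
  then show "cov_deriv 0 u (map (tproj 0 x) [Y]) y = \<phi>1 (\<sigma> y) * \<alpha> (tproj 0 x Y) y"
    by (simp add: cov_deriv_1 del: cov_deriv.simps)
qed (rule dir_deriv_eq, (rule dir_deriv_intros dir_deriv_basic[OF assms] | assumption)+,
    simp add: \<alpha>_pr[OF assms] G_pr[OF assms] algebra_simps power2_eq_square)

text \<open>The last term comes from differentiating \<open>\<kappa>\<close>, whose differential is
  \<open>\<iota> * \<alpha>\<close>. It is not symmetric in the three arguments:
  \<open>\<iota>\<close> is the curvature of the sphere, and covariant derivatives do not
  commute.\<close>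

lemma cov_deriv_3:
  assumes "x \<in> N" "x \<noteq> 0"
  shows "cov_deriv 0 u [X, Y, Z] x = \<phi>3 (\<sigma> x) * (\<alpha> X x * (\<alpha> Y x * \<alpha> Z x))
    - \<phi>2 (\<sigma> x) * (\<kappa> x * (G X Y x * \<alpha> Z x + G X Z x * \<alpha> Y x + G Y Z x * \<alpha> X x))
    - \<phi>1 (\<sigma> x) * (\<iota> x * (\<alpha> X x * G Y Z x))"
proof (rule cov_deriv_step[OF assms, where f = "\<lambda>y. \<phi>2 (\<sigma> y) * (\<alpha> (tproj 0 x Y) y * \<alpha> (tproj 0 x Z) y) - \<phi>1 (\<sigma> y) * (\<kappa> y * G (tproj 0 x Y) (tproj 0 x Z) y)"])
  fix y assume "y \<in> N" "y \<noteq> 0"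
  then show "cov_deriv 0 u (map (tproj 0 x) [Y, Z]) y = \<phi>2 (\<sigma> y) * (\<alpha> (tproj 0 x Y) y * \<alpha> (tproj 0 x Z) y) - \<phi>1 (\<sigma> y) * (\<kappa> y * G (tproj 0 x Y) (tproj 0 x Z) y)"
    by (simp add: cov_deriv_2 del: cov_deriv.simps)
qed (rule dir_deriv_eq, (rule dir_deriv_intros dir_deriv_basic[OF assms] | assumption)+,
    simp add: \<alpha>_pr[OF assms] G_pr[OF assms] algebra_simps power2_eq_square)

lemma cov_deriv_4:
  assumes "x \<in> N" "x \<noteq> 0"
  shows "cov_deriv 0 u [W, X, Y, Z] x = \<phi>4 (\<sigma> x) * (\<alpha> W x * (\<alpha> X x * (\<alpha> Y x * \<alpha> Z x)))
    - \<phi>3 (\<sigma> x) * (\<kappa> x * (G W X x * (\<alpha> Y x * \<alpha> Z x) + G W Y x * (\<alpha> X x * \<alpha> Z x)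
        + G W Z x * (\<alpha> X x * \<alpha> Y x) + G X Y x * (\<alpha> W x * \<alpha> Z x) + G X Z x * (\<alpha> W x * \<alpha> Y x)
        + G Y Z x * (\<alpha> W x * \<alpha> X x)))
    - \<phi>2 (\<sigma> x) * (\<iota> x * (G X Y x * (\<alpha> W x * \<alpha> Z x) + G X Z x * (\<alpha> W x * \<alpha> Y x)
        + 2 * (G Y Z x * (\<alpha> W x * \<alpha> X x))))
    + \<phi>2 (\<sigma> x) * ((\<kappa> x)\<^sup>2 * (G X Y x * G W Z x + G X Z x * G W Y x + G W X x * G Y Z x))
    + \<phi>1 (\<sigma> x) * (\<iota> x * (\<kappa> x * (G W X x * G Y Z x)))"
proof (rule cov_deriv_step[OF assms, where f = "\<lambda>y. \<phi>3 (\<sigma> y) * (\<alpha> (tproj 0 x X) y * (\<alpha> (tproj 0 x Y) y * \<alpha> (tproj 0 x Z) y))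
    - \<phi>2 (\<sigma> y) * (\<kappa> y * (G (tproj 0 x X) (tproj 0 x Y) y * \<alpha> (tproj 0 x Z) y + G (tproj 0 x X) (tproj 0 x Z) y * \<alpha> (tproj 0 x Y) y + G (tproj 0 x Y) (tproj 0 x Z) y * \<alpha> (tproj 0 x X) y))
    - \<phi>1 (\<sigma> y) * (\<iota> y * (\<alpha> (tproj 0 x X) y * G (tproj 0 x Y) (tproj 0 x Z) y))"])
  fix y assume "y \<in> N" "y \<noteq> 0"
  then show "cov_deriv 0 u (map (tproj 0 x) [X, Y, Z]) y = \<phi>3 (\<sigma> y) * (\<alpha> (tproj 0 x X) y * (\<alpha> (tproj 0 x Y) y * \<alpha> (tproj 0 x Z) y))
    - \<phi>2 (\<sigma> y) * (\<kappa> y * (G (tproj 0 x X) (tproj 0 x Y) y * \<alpha> (tproj 0 x Z) y + G (tproj 0 x X) (tproj 0 x Z) y * \<alpha> (tproj 0 x Y) y + G (tproj 0 x Y) (tproj 0 x Z) y * \<alpha> (tproj 0 x X) y))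
    - \<phi>1 (\<sigma> y) * (\<iota> y * (\<alpha> (tproj 0 x X) y * G (tproj 0 x Y) (tproj 0 x Z) y))"
    by (simp add: cov_deriv_3 del: cov_deriv.simps)
qed (rule dir_deriv_eq, (rule dir_deriv_intros dir_deriv_basic[OF assms] | assumption)+,
    simp add: \<alpha>_pr[OF assms] G_pr[OF assms] algebra_simps power2_eq_square)

end

text \<open>The rank-one lemmas ask for a unit vector; this supplies one even when
  \<open>z = 0\<close>, with \<open>\<zeta> = 0\<close>. That case occurs for the tangential part of
  \<open>x - p\<close> at the boundary point nearest to \<open>p\<close>.\<close>

lemma unit_multiple:
  fixes z :: "'a::euclidean_space"
  assumes "subspace V" "z \<in> V" "dim V > 0"
  obtains e \<zeta> where "e \<in> V" "norm e = 1" "z = \<zeta> *\<^sub>R e" "\<zeta>\<^sup>2 = z \<bullet> z"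
proof -
  obtain w where w: "w \<in> V" "w \<noteq> 0" "z = 0 \<or> w = z"
  proof (cases "z = 0")
    case True
    have "\<not> V \<subseteq> {0}" using assms(3) by (metis dim_eq_0 less_numeral_extra(3))
    then show ?thesis using that True by blast
  next
    case False then show ?thesis using that[of z] assms by auto
  qed
  show ?thesis
    by (rule that[of "sgn w" "norm z"])
       (use w assms in \<open>auto simp: sgn_div_norm subspace_scale power2_norm_eq_inner\<close>)
qed

section \<open>The equation and the boundary quantity for radial functions\<close>

context radial_profile begin

lemma F_A_op:
  assumes x: "x \<in> N" and W: "W = 1 + 4 * (\<phi>1 (\<sigma> x))\<^sup>2 * \<sigma> x"
  shows "F (A_op u x) = arctan ((4 * \<phi>2 (\<sigma> x) * \<sigma> x + 2 * \<phi>1 (\<sigma> x)) / (sqrt W * W))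
    + (real DIM('a) - 1) * arctan (2 * \<phi>1 (\<sigma> x) / sqrt W)"
proof -
  obtain e \<zeta> where e: "norm e = 1" "x - p = \<zeta> *\<^sub>R e" "\<zeta>\<^sup>2 = \<sigma> x"
    using unit_multiple[of UNIV "x - p"] by (auto simp: \<sigma>_def)
  have \<sigma>: "\<sigma> x \<ge> 0" by (simp add: \<sigma>_def)
  have g: "grad u x = (2 * \<phi>1 (\<sigma> x) * \<zeta>) *\<^sub>R e" using grad_u[OF x] e(2) by simp
  have nW: "1 + (norm (grad u x))\<^sup>2 = W"
    using e by (simp add: g W power_mult_distrib)
  define C where "C = (\<lambda>v. v + (grad u x \<bullet> v) *\<^sub>R grad u x)"
  have A: "A_op u x = (\<lambda>v. (1 / sqrt W) *\<^sub>R inv_sqrt_on UNIV C (hess u x (inv_sqrt_on UNIV C v)))"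
    by (rule ext) (simp add: A_op_def B_op_def C_def nW)
  have "F (A_op u x) = arctan ((1 / sqrt W) * (2 * \<phi>1 (\<sigma> x) + 4 * \<phi>2 (\<sigma> x) * \<sigma> x) / (1 * (1 + (W - 1))))
    + (real (dim (UNIV::'a set)) - 1) * arctan ((1 / sqrt W) * (2 * \<phi>1 (\<sigma> x)) / 1)"
    unfolding F_def A
  proof (rule sum_arctan_eig_conj_inv_sqrt[where P = "\<lambda>v. v" and e = e])
    show "C v = 1 *\<^sub>R (v + ((W - 1) * (e \<bullet> v)) *\<^sub>R e)" for v
      unfolding C_def g W e(3)[symmetric] by (simp add: power2_eq_square mult_ac)
    show "hess u x v = (2 * \<phi>1 (\<sigma> x)) *\<^sub>R v + (4 * \<phi>2 (\<sigma> x) * \<sigma> x * (e \<bullet> v)) *\<^sub>R e" for v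
      unfolding hess_u[OF x] e(2) e(3)[symmetric] by (simp add: power2_eq_square mult_ac)
    show "0 \<le> W - 1" using \<sigma> by (simp add: W)
  qed (use e in \<open>auto simp: linear_id[unfolded id_def]\<close>)
  then show ?thesis by (simp add: add.commute)
qed

lemma normal_deriv_u:
  assumes "x \<in> N" "x \<noteq> 0"
  shows "normal_deriv 0 u x = 2 * \<phi>1 (\<sigma> x) * (p \<bullet> x - x \<bullet> x) / norm x"
  using assms by (simp add: normal_deriv_def grad_u nu_0 inner_diff_left divide_inverse algebra_simps)

lemma tgrad_u:
  assumes "x \<in> N" "x \<noteq> 0"
  shows "tgrad 0 u x = (2 * \<phi>1 (\<sigma> x)) *\<^sub>R tproj 0 x (x - p)"
proof -
  have "(\<lambda>Y. cov_deriv 0 u [Y] x) = (\<lambda>Y. ((2 * \<phi>1 (\<sigma> x)) *\<^sub>R tproj 0 x (x - p)) \<bullet> Y)"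
    by (rule ext) (simp add: cov_deriv_1[OF assms] \<alpha>_inner2[OF assms] del: cov_deriv.simps)
  then show ?thesis unfolding tgrad_def by (simp only: riesz_inner)
qed

text \<open>By the Gauss formula, subtracting \<open>s\<close> times the second fundamental form
  with \<open>s\<close> the normal derivative undoes the bending of the sphere and leaves the
  tangential block of the ambient Hessian in \<open>hess_u\<close>.\<close>

lemma M_op_u:
  assumes x: "x \<in> N" "x \<noteq> 0"
  shows "M_op 0 u x (normal_deriv 0 u x) X = (2 * \<phi>1 (\<sigma> x)) *\<^sub>R tproj 0 x X
    + (4 * \<phi>2 (\<sigma> x) * (tproj 0 x (x - p) \<bullet> X)) *\<^sub>R tproj 0 x (x - p)"
proof -
  have \<kappa>: "\<kappa> x = - 2 * (p \<bullet> x) / (norm x * norm x)"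
    using x by (simp add: \<kappa>_def \<iota>_def dot_square_norm power2_eq_square inner_commute divide_inverse)
  have ff: "second_ff 0 x X Y = G X Y x / norm x" for Y
    using x by (simp add: second_ff_0 G_inner)
  \<comment> \<open>Along the sphere the intrinsic Hessian of \<open>\<sigma>\<close> is
    \<open>- \<kappa> G\<close>; together with the second fundamental form it restores the ambient
    Hessian, which is 2 times the metric.\<close>
  have sum: "- \<kappa> x - 2 * (p \<bullet> x - x \<bullet> x) / norm x / norm x = 2"
    using x by (simp add: \<kappa> dot_square_norm power2_eq_square field_simps)
  have "cov_deriv 0 u [X, Y] x - normal_deriv 0 u x * second_ff 0 x X Y
    = ((2 * \<phi>1 (\<sigma> x)) *\<^sub>R tproj 0 x X
    + (4 * \<phi>2 (\<sigma> x) * (tproj 0 x (x - p) \<bullet> X)) *\<^sub>R tproj 0 x (x - p)) \<bullet> Y" for Y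
  proof -
    have "cov_deriv 0 u [X, Y] x - normal_deriv 0 u x * second_ff 0 x X Y
      = \<phi>2 (\<sigma> x) * (\<alpha> X x * \<alpha> Y x)
        + \<phi>1 (\<sigma> x) * G X Y x * (- \<kappa> x - 2 * (p \<bullet> x - x \<bullet> x) / norm x / norm x)"
    proof -
      define c where "c = 2 * (p \<bullet> x - x \<bullet> x) / norm x"
      have "normal_deriv 0 u x = \<phi>1 (\<sigma> x) * c" by (simp add: normal_deriv_u[OF x] c_def)
      then show ?thesis
        unfolding cov_deriv_2[OF x] ff c_def[symmetric] by (simp add: algebra_simps)
    qed
    then show ?thesis
      unfolding sum \<alpha>_inner2[OF x] G_inner2[OF x] by (simp add: inner_add_left algebra_simps)
  qed
  then show ?thesis unfolding M_op_def by (simp only: riesz_inner)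
qed

text \<open>\<open>M_op\<close> and \<open>C1T_op\<close> have the same exceptional direction, the
  tangential part of \<open>x - p\<close>, so both are rank-one perturbations; its squared length is
  \<open>h\<close>. By Pythagoras for the gradient the scalar factor is \<open>sqrt W\<close>. At
  \<open>h = 0\<close> the separate arctan has the spherical curvature as its argument, and at
  \<open>h = \<sigma> x\<close> it would have the radial one.\<close>

lemma calB_u:
  assumes x: "x \<in> N" "x \<noteq> 0" and n: "DIM('a) \<ge> 2" and W: "W = 1 + 4 * (\<phi>1 (\<sigma> x))\<^sup>2 * \<sigma> x"
    and h: "h = (norm (tproj 0 x (x - p)))\<^sup>2"
  shows "calB 0 u x (normal_deriv 0 u x) = pi / 2
    + arctan ((2 * \<phi>1 (\<sigma> x) + 4 * \<phi>2 (\<sigma> x) * h) / (sqrt W * (1 + 4 * (\<phi>1 (\<sigma> x))\<^sup>2 * h)))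
    + (real DIM('a) - 2) * arctan (2 * \<phi>1 (\<sigma> x) / sqrt W)"
proof -
  let ?V = "tangent 0 x" and ?y = "tproj 0 x (x - p)"
  have V: "subspace ?V" "dim ?V = DIM('a) - 1"
    using subspace_tangent dim_tangent_0[OF x(2)] by auto
  have prV: "tproj 0 x v \<in> ?V" for v using x by (simp add: tangent_0 inner_tproj_0)
  obtain e \<zeta> where e: "e \<in> ?V" "norm e = 1" "?y = \<zeta> *\<^sub>R e" "\<zeta>\<^sup>2 = h"
    using unit_multiple[OF V(1) prV, of "x - p"] V(2) n unfolding h power2_norm_eq_inner
    by (metis One_nat_def Suc_1 Suc_le_lessD zero_less_diff)
  have \<sigma>: "\<sigma> x \<ge> 0" by (simp add: \<sigma>_def)
  have Wpos: "W > 0" using \<sigma> by (simp add: W add_pos_nonneg)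
  have tg: "tgrad 0 u x = tproj 0 x (grad u x)"
    by (simp add: tgrad_u[OF x] grad_u[OF x(1)] linear_cmul[OF linear_tproj])
  have nW: "1 + (norm (tgrad 0 u x))\<^sup>2 + (normal_deriv 0 u x)\<^sup>2 = W"
  proof -
    have "(norm (tgrad 0 u x))\<^sup>2 + (normal_deriv 0 u x)\<^sup>2 = (norm (grad u x))\<^sup>2"
      unfolding tg normal_deriv_def by (rule norm_tproj[OF x(2)])
    also have "\<dots> = 4 * (\<phi>1 (\<sigma> x))\<^sup>2 * \<sigma> x"
      by (simp add: grad_u[OF x(1)] power_mult_distrib \<sigma>_def power2_norm_eq_inner)
    finally show ?thesis by (simp add: W)
  qed
  let ?C = "C1T_op 0 u x (normal_deriv 0 u x)" and ?M = "M_op 0 u x (normal_deriv 0 u x)"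
  have "sum_arctan_eig ?V (\<lambda>v. 1 *\<^sub>R inv_sqrt_on ?V ?C (?M (inv_sqrt_on ?V ?C v)))
    = arctan (1 * (2 * \<phi>1 (\<sigma> x) + 4 * \<phi>2 (\<sigma> x) * h) / (sqrt W * (1 + 4 * (\<phi>1 (\<sigma> x))\<^sup>2 * h)))
      + (real (dim ?V) - 1) * arctan (1 * (2 * \<phi>1 (\<sigma> x)) / sqrt W)"
  proof (rule sum_arctan_eig_conj_inv_sqrt[where P = "tproj 0 x" and e = e])
    show "?C v = sqrt W *\<^sub>R (v + (4 * (\<phi>1 (\<sigma> x))\<^sup>2 * h * (e \<bullet> v)) *\<^sub>R e)" for v
      unfolding C1T_op_def nW unfolding tgrad_u[OF x] e(3) e(4)[symmetric]
      by (simp add: power2_eq_square mult_ac)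
    show "?M v = (2 * \<phi>1 (\<sigma> x)) *\<^sub>R v + (4 * \<phi>2 (\<sigma> x) * h * (e \<bullet> v)) *\<^sub>R e" if "v \<in> ?V" for v
      unfolding M_op_u[OF x] tproj_eq_self[OF x(2) that] e(3) e(4)[symmetric]
      by (simp add: power2_eq_square mult_ac)
    show "(v - tproj 0 x v) \<bullet> w = 0" if "w \<in> ?V" for v w
      using that x by (simp add: tproj_0 tangent_0)
    show "0 \<le> 4 * (\<phi>1 (\<sigma> x))\<^sup>2 * h" by (simp add: h)
  qed (use e V prV Wpos tproj_eq_self[OF x(2)] linear_tproj in auto)
  moreover have "real (dim ?V) - 1 = real DIM('a) - 2" using V(2) n by simp
  ultimately show ?thesis unfolding calB_def Let_def by simp
qed

end

section \<open>The radial profile near the edge\<close>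

text \<open>The identity behind the second claim is \<open>(cos t - sin t * tan (a + t/m)) * cos (a
  + t/m) = cos (a + t/m + t)\<close>, and the bound on \<open>H\<close> keeps both angles in (-pi/2,
  pi/2). For t > 0 the claim says that the radial curvature \<open>cot t\<close> exceeds the
  spherical one.\<close>

lemma edge_angles:
  fixes m a H t :: real
  assumes "m \<ge> 1" "a \<ge> 0" "H > 0" "a + H + H / m < pi / 2" "\<bar>t\<bar> \<le> H"
  shows "cos (a + t / m) > 0" "cos t - sin t * tan (a + t / m) > 0" "\<bar>t\<bar> < pi / 2"
proof -
  have "\<bar>t\<bar> / m \<le> H / m" using assms by (intro divide_right_mono) auto
  moreover have "H / m > 0" using assms by simp
  moreover have "\<bar>t / m\<bar> = \<bar>t\<bar> / m" using assms by simp
  ultimately have "- (pi / 2) < a + t / m" "a + t / m < pi / 2"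
    "- (pi / 2) < a + t / m + t" "a + t / m + t < pi / 2" and t: "\<bar>t\<bar> < pi / 2"
    using assms by linarith+
  then have c: "cos (a + t / m) > 0" "cos (a + t / m + t) > 0" by (simp_all only: cos_gt_zero_pi)
  have "(cos t - sin t * tan (a + t / m)) * cos (a + t / m)
      = cos t * cos (a + t / m) - sin t * (tan (a + t / m) * cos (a + t / m))"
    by (simp only: left_diff_distrib mult.assoc)
  also have "tan (a + t / m) * cos (a + t / m) = sin (a + t / m)"
    using c(1) by (simp add: tan_def)
  also have "cos t * cos (a + t / m) - sin t * sin (a + t / m) = cos (a + t / m + t)"
    by (simp only: cos_add mult.commute)
  finally show "cos t - sin t * tan (a + t / m) > 0" using c by (metis zero_less_mult_pos2)
  show "cos (a + t / m) > 0" "\<bar>t\<bar> < pi / 2" by (fact c(1) t)+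
qed

text \<open>\<open>m\<close> is n - 1 and \<open>a\<close> is the angle of the spherical curvature
  at the edge. \<open>S_deriv\<close> is the Codazzi equation written in \<open>t\<close>, and
  \<open>S_small\<close> keeps the slope of the graph finite. The interval reaches past t = 0 so
  that the coefficient functions are smooth, hence bounded, on the closed interval from 0 to
  \<open>H / 2\<close>.\<close>

locale edge_profile =
  fixes m a H :: real and S :: "real \<Rightarrow> real"
  assumes m: "m \<ge> 1" and a: "a \<ge> 0" and H: "H > 0" "H \<le> 1" "a + H + H / m < pi / 2"
    and S_pos: "\<And>t. \<bar>t\<bar> < H \<Longrightarrow> S t > 0"
    and S_deriv: "\<And>t. \<bar>t\<bar> < H \<Longrightarrow> (S has_real_derivative
        2 * S t * (sin t * (1 + (tan (a + t / m))\<^sup>2) / (m * (cos t - sin t * tan (a + t / m))))) (at t)"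
    and S_smooth: "smooth_on S {-H<..<H}"
    and S_small: "\<And>t. \<bar>t\<bar> < H \<Longrightarrow> S t * (tan (a + t / m))\<^sup>2 < 1"
begin

text \<open>The graph of a radial solution is parametrised by the gap \<open>t\<close> between \<open>\<pi>/2\<close> and the angle
  of the radial curvature \<open>cot t\<close>. Then all spherical curvatures are \<open>T t\<close>, the squared radius
  is \<open>S t\<close>, and the edge of the graph is at \<open>t = 0\<close>.\<close>

definition "T t = tan (a + t / m)"
definition "E t = cos t - sin t * T t"
definition "k t = 2 * S t * ((1 + (T t)\<^sup>2) / (m * E t))"
definition "q t = 1 - S t * (T t)\<^sup>2"
text \<open>\<open>A1\<close> comes from solving
  \<open>T = 2 * \<phi>1 / sqrt (1 + 4 * \<phi>1^2 * s)\<close> for \<open>\<phi>1\<close>, where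
  \<open>q\<close> is the reciprocal of 1 + |Du|^2. \<open>A2 t / sin t\<close> is the value of
  \<open>\<phi>2\<close> for which the radial curvature is \<open>cot t\<close>.\<close>

definition "A1 t = T t / (2 * sqrt (q t))"
definition "A2 t = (cos t - q t * T t * sin t) / (4 * S t * (q t * sqrt (q t)))"
text \<open>Since ds = \<open>sin t * k t\<close> dt, differentiating \<open>f / sin t ^ j\<close>
  in \<open>s\<close> gives a smooth numerator over the power \<open>j + 2\<close>.
  \<open>A3\<close> is the numerator produced from \<open>A2\<close> with j = 1, and
  \<open>A4\<close> the one produced from \<open>A3\<close> with j = 3.\<close>

definition "A3 t = (deriv A2 t * sin t - A2 t * cos t) / k t"
definition "A4 t = (deriv A3 t * sin t - 3 * (A3 t * cos t)) / k t"
abbreviation "J \<equiv> {-H<..<H}"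
abbreviation "h \<equiv> H / 2"

lemma angles:
  assumes "\<bar>t\<bar> \<le> H" shows "cos (a + t / m) > 0" "\<bar>t\<bar> < pi / 2"
  using edge_angles[OF m a H(1,3) assms] by auto

lemma E_pos: "\<bar>t\<bar> \<le> H \<Longrightarrow> E t > 0"
  unfolding E_def T_def by (rule edge_angles(2)[OF m a H(1,3)])

lemma k_pos: assumes "t \<in> J" shows "k t > 0"
proof -
  have t: "\<bar>t\<bar> < H" using assms by (simp add: abs_less_iff)
  have "E t > 0" "S t > 0" using E_pos[OF less_imp_le[OF t]] S_pos[OF t] by simp_all
  moreover have "1 + (T t)\<^sup>2 > 0" by (simp add: add_pos_nonneg)
  ultimately show ?thesis unfolding k_def using m by simp
qed

lemma q_pos: "t \<in> J \<Longrightarrow> q t > 0"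
  using S_small[of t] by (simp add: q_def T_def abs_less_iff)

lemma S'_k: "t \<in> J \<Longrightarrow> (S has_real_derivative sin t * k t) (at t)"
  by (rule DERIV_cong[OF S_deriv]) (auto simp: k_def E_def T_def)

lemma T_deriv: assumes "t \<in> J" shows "(T has_real_derivative (1 + (T t)\<^sup>2) / m) (at t)"
proof -
  have "\<bar>t\<bar> \<le> H" using assms by auto
  from angles(1)[OF this] have c: "cos (a + t / m) \<noteq> 0" by linarith
  have "((\<lambda>t. a + t / m) has_real_derivative 1 / m) (at t)"
    using m by (auto intro!: derivative_eq_intros)
  from DERIV_chain2[OF DERIV_tan[OF c] this]
  have "(T has_real_derivative inverse ((cos (a + t / m))\<^sup>2) * (1 / m)) (at t)"
    unfolding T_def .
  moreover have "inverse ((cos (a + t / m))\<^sup>2) = 1 + (T t)\<^sup>2"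
    unfolding T_def tan_sec[OF c] by (rule power_inverse[symmetric])
  ultimately show ?thesis by simp
qed

lemma T_nonneg: assumes "t \<in> {0..<H}" shows "T t \<ge> 0"
proof (cases "a + t / m = 0")
  case False
  then have "0 < a + t / m" using assms a m by (metis add_nonneg_nonneg atLeastLessThan_iff
      divide_nonneg_nonneg less_eq_real_def order_trans zero_le_one)
  moreover have "t / m \<le> H / m" using assms m by (auto simp: divide_right_mono)
  then have "a + t / m < pi / 2" using H by linarith
  ultimately show ?thesis unfolding T_def using tan_gt_zero less_imp_le by blast
qed (simp add: T_def)

lemma nonzero:
  assumes "t \<in> J"
  shows "cos (a + t / m) \<noteq> 0" "E t \<noteq> 0" "k t \<noteq> 0" "q t \<noteq> 0" "S t \<noteq> 0" "m * E t \<noteq> 0"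
    "2 * sqrt (q t) \<noteq> 0" "4 * S t * (q t * sqrt (q t)) \<noteq> 0"
proof -
  have t: "\<bar>t\<bar> < H" using assms by (simp add: abs_less_iff)
  have "cos (a + t / m) > 0" "E t > 0" "S t > 0"
    using angles(1)[OF less_imp_le[OF t]] E_pos[OF less_imp_le[OF t]] S_pos[OF t] by simp_all
  then show "cos (a + t / m) \<noteq> 0" "E t \<noteq> 0" "k t \<noteq> 0" "q t \<noteq> 0" "S t \<noteq> 0" "m * E t \<noteq> 0"
    "2 * sqrt (q t) \<noteq> 0" "4 * S t * (q t * sqrt (q t)) \<noteq> 0"
    using k_pos[OF assms] q_pos[OF assms] m by auto
qed

lemma smooth_T: "smooth_on T J"
  unfolding T_def tan_def using m by (intro smooth_intros nonzero) auto

lemma smooth_q: "smooth_on q J"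
  unfolding q_def by (intro smooth_intros smooth_T S_smooth) auto

lemma smooth_E: "smooth_on E J"
  unfolding E_def by (intro smooth_intros smooth_T) auto

lemma smooth_k: "smooth_on k J"
  unfolding k_def by (intro smooth_intros smooth_T S_smooth smooth_E nonzero) auto

lemma smooth_A1: "smooth_on A1 J"
  unfolding A1_def by (intro smooth_intros smooth_T smooth_q q_pos nonzero) auto

lemma smooth_A2: "smooth_on A2 J"
  unfolding A2_def by (intro smooth_intros smooth_T smooth_q S_smooth q_pos nonzero) auto

lemma smooth_A3: "smooth_on A3 J"
  unfolding A3_def
  by (intro smooth_intros smooth_A2 smooth_k smooth_on_real_deriv(1)[OF _ smooth_A2] nonzero) auto

lemma smooth_A4: "smooth_on A4 J"
  unfolding A4_def
  by (intro smooth_intros smooth_A3 smooth_k smooth_on_real_deriv(1)[OF _ smooth_A3] nonzero) auto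

text \<open>In this form the numerator of \<open>A2\<close> is visibly positive for \<open>t\<close>
  in \<open>{0..<H}\<close>: \<open>E\<close> is positive there, and \<open>S\<close>,
  \<open>T\<close>, \<open>sin t\<close> are nonnegative.\<close>

lemma A2_num: "cos t - q t * T t * sin t = E t + S t * (T t)^3 * sin t"
  by (simp add: E_def q_def power2_eq_square power3_eq_cube algebra_simps)

text \<open>\<open>A1\<close> and \<open>A2\<close> were read off from the two curvatures
  independently. That they are consistent, that is, \<open>\<phi>2\<close> is the derivative of
  \<open>\<phi>1\<close>, is exactly the Codazzi equation for \<open>S\<close>.\<close>

lemma A1_deriv: assumes t: "t \<in> J" shows "(A1 has_real_derivative A2 t * k t) (at t)"
proof -
  define T' where "T' = (1 + (T t)\<^sup>2) / m"
  define r where "r = sqrt (q t)"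
  have r: "r > 0" "q t = r * r" using q_pos[OF t] by (auto simp: r_def)
  have ST: "S t * (T t)\<^sup>2 = 1 - r * r" using r(2) by (simp add: q_def)
  have S: "S t > 0" and E: "E t > 0" using S_pos E_pos t by auto
  have k: "k t = 2 * S t * T' / E t" by (simp add: k_def T'_def)
  have q': "(q has_real_derivative - (sin t * k t * (T t)\<^sup>2 + S t * (2 * T t * T'))) (at t)"
    unfolding q_def T'_def
    by (auto intro!: derivative_eq_intros S'_k[OF t] T_deriv[OF t])
  have s': "((\<lambda>t. sqrt (q t)) has_real_derivative
      - (sin t * k t * (T t)\<^sup>2 + S t * (2 * T t * T')) / (2 * r)) (at t)"
    by (rule DERIV_cong[OF DERIV_chain2[OF DERIV_real_sqrt q']])
       (use q_pos[OF t] in \<open>auto simp: r_def field_simps\<close>)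
  have "(A1 has_real_derivative
      (T' * (2 * r) - T t * (2 * (- (sin t * k t * (T t)\<^sup>2 + S t * (2 * T t * T')) / (2 * r)))) / (2 * r)\<^sup>2) (at t)"
    unfolding A1_def
    by (rule DERIV_cong[OF DERIV_divide[OF T_deriv[OF t] DERIV_cmult[OF s']]])
       (use r in \<open>auto simp: T'_def r_def[symmetric] power2_eq_square\<close>)
  moreover have "(T' * (2 * r) - T t * (2 * (- (sin t * k t * (T t)\<^sup>2 + S t * (2 * T t * T')) / (2 * r)))) / (2 * r)\<^sup>2
      = A2 t * k t"
  proof -
    have "(T' * (2 * r) - T t * (2 * (- (sin t * k t * (T t)\<^sup>2 + S t * (2 * T t * T')) / (2 * r)))) / (2 * r)\<^sup>2
      = (2 * T' * (r * r + S t * (T t)\<^sup>2) + sin t * k t * (T t)^3) / (4 * (r * r * r))"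
      using r(1) by (simp add: field_simps power2_eq_square power3_eq_cube)
    also have "\<dots> = (2 * T' + sin t * k t * (T t)^3) / (4 * (r * r * r))" by (simp add: ST)
    also have "\<dots> = ((E t + S t * (T t)^3 * sin t) / (4 * S t * (r * r * r))) * k t"
      unfolding k using r(1) S E by (simp add: field_simps)
    also have "\<dots> = A2 t * k t" unfolding A2_def A2_num using r by (simp add: r_def[symmetric] mult.assoc)
    finally show ?thesis .
  qed
  ultimately show ?thesis by simp
qed

lemma A2_pos: assumes "t \<in> {0..<H}" shows "A2 t > 0"
proof -
  have t: "t \<in> J" "\<bar>t\<bar> < H" using assms H by auto
  have "sin t \<ge> 0" using angles(2)[of t] assms by (intro sin_ge_zero) auto
  then have "E t + S t * (T t)^3 * sin t > 0"
    using E_pos[of t] S_pos[of t] T_nonneg[OF assms] t by (intro add_pos_nonneg mult_nonneg_nonneg) auto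
  then show ?thesis unfolding A2_def A2_num using S_pos[of t] q_pos[OF t(1)] t by auto
qed

section \<open>Inverting the squared radius\<close>

lemma S_less: assumes "0 \<le> x" "x < y" "y < H" shows "S x < S y"
proof (rule DERIV_pos_imp_increasing_open[OF assms(2)])
  fix t assume t: "x < t" "t < y"
  then have "sin t > 0" using assms angles(2)[of t] by (intro sin_gt_zero2) auto
  then show "\<exists>d. (S has_real_derivative d) (at t) \<and> d > 0"
    using S'_k[of t] k_pos[of t] assms t by (intro exI[of _ "sin t * k t"]) auto
next
  show "continuous_on {x..y} S"
    by (rule continuous_on_subset[OF smooth_on_imp_continuous_on[OF S_smooth]]) (use assms in auto)
qed

text \<open>The gap as a function of the squared radius. Since the derivative of \<open>S\<close>
  vanishes at 0, \<open>\<tau>\<close> behaves like a square root at \<open>S 0\<close>; therefore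
  \<open>I\<close> is open and leaves the edge out, while \<open>S\<close> is inverted on the closed
  interval.\<close>

definition "\<tau> = the_inv_into {0..h} S"
abbreviation "I \<equiv> {S 0<..<S h}"

lemma inj_S: "inj_on S {0..h}"
  using H S_less by (intro linorder_inj_onI) (force+)

lemma \<tau>_S: "t \<in> {0..h} \<Longrightarrow> \<tau> (S t) = t"
  unfolding \<tau>_def by (rule the_inv_into_f_f[OF inj_S])

lemma S_cont: "continuous_on {0..h} S"
  by (rule continuous_on_subset[OF smooth_on_imp_continuous_on[OF S_smooth]]) (use H in auto)

lemma \<tau>: assumes "s \<in> I" shows "\<tau> s \<in> {0<..<h}" "S (\<tau> s) = s"
proof -
  obtain t where "0 \<le> t" "t \<le> h" "S t = s"
    using IVT'[of S 0 s h] assms S_cont H by auto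
  moreover from this have "t \<noteq> 0" "t \<noteq> h" using assms by auto
  ultimately show "\<tau> s \<in> {0<..<h}" "S (\<tau> s) = s" using \<tau>_S[of t] by auto
qed

lemma S_in_I: "t \<in> {0<..<h} \<Longrightarrow> S t \<in> I"
  using S_less[of 0 t] S_less[of t h] H by auto

lemma \<tau>_J: "s \<in> I \<Longrightarrow> \<tau> s \<in> J" using \<tau>(1)[of s] H by auto

lemma \<tau>_mono: assumes "s \<in> I" "s' \<in> I" "s \<le> s'" shows "\<tau> s \<le> \<tau> s'"
  using S_less[of "\<tau> s'" "\<tau> s"] \<tau>[OF assms(1)] \<tau>[OF assms(2)] assms(3) H by force

lemma sin_\<tau>: assumes "s \<in> I" shows "sin (\<tau> s) > 0"
  using \<tau>[OF assms] angles(2)[of "\<tau> s"] by (intro sin_gt_zero2) auto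

lemma \<tau>_deriv:
  assumes s: "s \<in> I" shows "(\<tau> has_real_derivative 1 / (sin (\<tau> s) * k (\<tau> s))) (at s)"
proof -
  have "continuous_on (S ` {0..h}) \<tau>"
    by (rule continuous_on_inv[OF S_cont]) (auto intro: \<tau>_S)
  moreover have "I \<subseteq> S ` {0..h}"
  proof
    fix s assume "s \<in> I"
    from \<tau>[OF this] show "s \<in> S ` {0..h}" by (intro image_eqI[of _ _ "\<tau> s"]) auto
  qed
  ultimately have "continuous_on I \<tau>" using continuous_on_subset by blast
  then have "isCont \<tau> s" using s by (simp add: continuous_on_eq_continuous_at)
  then have "(\<tau> has_real_derivative inverse (sin (\<tau> s) * k (\<tau> s))) (at s)"
    by (intro DERIV_inverse_function[where f = S and a = "S 0" and b = "S h"])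
       (use S'_k[OF \<tau>_J[OF s]] k_pos[OF \<tau>_J[OF s]] sin_\<tau>[OF s] s \<tau> in auto)
  then show ?thesis by (simp add: inverse_eq_divide)
qed

lemma smooth_\<tau>: "smooth_on \<tau> I"
proof (rule smooth_on_ode[where h = "\<lambda>t. 1 / (sin t * k t)" and V = "{0<..<h}"])
  show "smooth_on (\<lambda>t. 1 / (sin t * k t)) {0<..<h}"
  proof (intro smooth_intros)
    show "smooth_on k {0<..<h}" by (rule smooth_on_subset[OF smooth_k]) (use H in auto)
    fix t assume t: "t \<in> {0<..<h}"
    then have "sin t > 0" using H angles(2)[of t] by (intro sin_gt_zero2) auto
    then show "sin t * k t \<noteq> 0" using k_pos[of t] t H by auto
  qed auto
qed (use \<tau> \<tau>_deriv in auto)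

lemma deriv_comp_\<tau>:
  assumes "s \<in> I" "(f has_real_derivative d) (at (\<tau> s))" "d / (sin (\<tau> s) * k (\<tau> s)) = d'"
  shows "((\<lambda>s. f (\<tau> s)) has_real_derivative d') (at s)"
  by (rule DERIV_cong[OF DERIV_chain2[OF assms(2) \<tau>_deriv[OF assms(1)]]]) (use assms(3) in auto)

lemma deriv_quotient_sin_power:
  assumes t: "t \<in> J" "sin t \<noteq> 0" and f: "smooth_on f J" and j: "j > 0"
  shows "((\<lambda>t. f t / sin t ^ j) has_real_derivative
     (deriv f t * sin t - real j * (f t * cos t)) / sin t ^ (j + 1)) (at t)"
proof -
  have "(f has_real_derivative deriv f t) (at t)" using smooth_on_real_deriv(2)[OF _ f] t(1) by auto
  from DERIV_divide[OF this DERIV_power[OF DERIV_sin[of t], of j]] t(2)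
  have "((\<lambda>t. f t / sin t ^ j) has_real_derivative
     (deriv f t * sin t ^ j - f t * (real j * (cos t * sin t ^ (j - 1)))) / (sin t ^ j * sin t ^ j)) (at t)"
    by (simp add: mult_ac)
  moreover have "(deriv f t * sin t ^ j - f t * (real j * (cos t * sin t ^ (j - 1)))) / (sin t ^ j * sin t ^ j)
    = (deriv f t * sin t - real j * (f t * cos t)) / sin t ^ (j + 1)"
  proof -
    obtain i where i: "j = Suc i" using j by (cases j) auto
    show ?thesis unfolding i using t(2) by (simp add: field_simps)
  qed
  ultimately show ?thesis by simp
qed

lemma bounded_J:
  assumes "smooth_on f J" shows "\<exists>K>0. \<forall>t\<in>{0..h}. \<bar>f t\<bar> \<le> K"
proof -
  have "continuous_on {0..h} f"
    by (rule continuous_on_subset[OF smooth_on_imp_continuous_on[OF assms]]) (use H in auto)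
  then have "bounded (f ` {0..h})" using compact_continuous_image compact_imp_bounded by blast
  then show ?thesis unfolding bounded_pos by auto
qed

lemma sin_lower: obtains c where "c > 0" "\<And>t. t \<in> {0<..<h} \<Longrightarrow> c * t \<le> sin t"
proof
  show "cos h > 0" using angles(2)[of h] H by (intro cos_gt_zero_pi) auto
  fix t assume t: "t \<in> {0<..<h}"
  obtain z where z: "0 < z" "z < t" "sin t - sin 0 = (t - 0) * cos z"
    using MVT2[of 0 t sin cos] t by (auto intro: DERIV_sin)
  have "cos h \<le> cos z" using z t angles(2)[of h] H by (intro cos_monotone_0_pi_le) auto
  then show "cos h * t \<le> sin t" using z t by (simp add: mult.commute)
qed

text \<open>The factor \<open>sin\<close> in the derivative of \<open>S\<close> contributes the
  second power of \<open>t\<close>. This is the comparison of distance to the edge with the squared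
  gap that later controls tangential derivatives.\<close>

lemma S_quadratic:
  obtains K where "K > 0" "\<And>t. t \<in> {0<..<h} \<Longrightarrow> S t - S 0 \<le> K * t\<^sup>2"
proof -
  obtain K where K: "K > 0" "\<And>t. t \<in> {0..h} \<Longrightarrow> \<bar>k t\<bar> \<le> K" using bounded_J[OF smooth_k] by blast
  show ?thesis
  proof (rule that[OF K(1)])
    fix t assume t: "t \<in> {0<..<h}"
    obtain z where z: "0 < z" "z < t" "S t - S 0 = (t - 0) * (sin z * k z)"
      using MVT2[of 0 t S "\<lambda>t. sin t * k t"] t S'_k by auto
    have "sin z \<ge> 0" using z t angles(2)[of z] H by (intro sin_ge_zero) auto
    moreover have "sin z \<le> t" using sin_x_le_x[of z] z by simp
    moreover have "k z \<le> K" "0 \<le> k z" using K(2)[of z] z t k_pos[of z] H by (auto simp: less_imp_le)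
    ultimately have "sin z * k z \<le> t * K" using z by (intro mult_mono) auto
    then have "t * (sin z * k z) \<le> t * (t * K)" using t by (intro mult_left_mono) auto
    then show "S t - S 0 \<le> K * t\<^sup>2" using z(3) by (simp add: power2_eq_square mult_ac)
  qed
qed

lemma A2_lower: obtains c where "c > 0" "\<And>t. t \<in> {0..h} \<Longrightarrow> c \<le> A2 t"
proof -
  have "continuous_on {0..h} A2"
    by (rule continuous_on_subset[OF smooth_on_imp_continuous_on[OF smooth_A2]]) (use H in auto)
  then obtain z where "z \<in> {0..h}" "\<forall>t\<in>{0..h}. A2 z \<le> A2 t"
    using continuous_attains_inf[of "{0..h}" A2] H by auto
  then show ?thesis using that[of "A2 z"] A2_pos[of z] H by auto
qed

text \<open>\<open>\<Phi>\<close> is the profile itself in the variable \<open>t\<close>. Its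
  derivative \<open>A1 t * (sin t * k t)\<close> is continuous up to t = 0, so the profile stays
  bounded at the edge.\<close>

lemma A1_antideriv:
  obtains \<Phi> K where "\<And>t. t \<in> {0<..<h} \<Longrightarrow> (\<Phi> has_real_derivative A1 t * (sin t * k t)) (at t)"
    "\<And>t. t \<in> {0..h} \<Longrightarrow> \<bar>\<Phi> t\<bar> \<le> K"
proof -
  have "smooth_on (\<lambda>t. A1 t * (sin t * k t)) J" by (intro smooth_intros smooth_A1 smooth_k) auto
  then have "continuous_on {0..h} (\<lambda>t. A1 t * (sin t * k t))"
    by (rule continuous_on_subset[OF smooth_on_imp_continuous_on]) (use H in auto)
  then obtain \<Phi> where \<Phi>: "\<And>t. t \<in> {0..h} \<Longrightarrow>
      (\<Phi> has_vector_derivative A1 t * (sin t * k t)) (at t within {0..h})"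
    using antiderivative_continuous by blast
  have "(\<Phi> has_real_derivative A1 t * (sin t * k t)) (at t)" if t: "t \<in> {0<..<h}" for t
  proof -
    have "(\<Phi> has_real_derivative A1 t * (sin t * k t)) (at t within {0<..<h})"
      unfolding has_real_derivative_iff_has_vector_derivative
      by (rule has_vector_derivative_within_subset[OF \<Phi>[of t]]) (use t in auto)
    then show ?thesis using at_within_open[OF t] by simp
  qed
  moreover have "continuous_on {0..h} \<Phi>"
    unfolding continuous_on_eq_continuous_within using \<Phi> has_vector_derivative_continuous by blast
  then have "bounded (\<Phi> ` {0..h})" using compact_continuous_image compact_imp_bounded by blast
  then obtain K where "\<forall>t\<in>{0..h}. \<bar>\<Phi> t\<bar> \<le> K" unfolding bounded_iff by auto
  ultimately show ?thesis using that by blast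
qed

lemma quotient_bound:
  fixes A K c t :: real
  assumes "\<bar>A\<bar> \<le> K" "c > 0" "t > 0" "c * t \<le> sin t"
  shows "\<bar>A / sin t ^ j\<bar> \<le> (K / c ^ j) / t ^ j"
proof -
  have "(c * t) ^ j \<le> sin t ^ j" using assms(2,3) by (intro power_mono[OF assms(4)]) simp
  moreover have "0 < (c * t) ^ j" using assms by simp
  ultimately have "\<bar>A\<bar> / sin t ^ j \<le> K / (c * t) ^ j" using assms(1) by (intro frac_le) auto
  moreover have "sin t ^ j > 0"
    using \<open>0 < (c * t) ^ j\<close> \<open>(c * t) ^ j \<le> sin t ^ j\<close> by linarith
  ultimately show ?thesis by (simp only: power_mult_distrib abs_divide abs_of_pos divide_divide_eq_left)
qed

lemma deriv_sin_power_comp_\<tau>: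
  assumes "s \<in> I" "smooth_on f J" "j > 0"
  shows "((\<lambda>s. f (\<tau> s) / sin (\<tau> s) ^ j) has_real_derivative
    ((deriv f (\<tau> s) * sin (\<tau> s) - real j * (f (\<tau> s) * cos (\<tau> s))) / k (\<tau> s)) / sin (\<tau> s) ^ (j + 2)) (at s)"
  by (rule deriv_comp_\<tau>[OF assms(1) deriv_quotient_sin_power[OF \<tau>_J[OF assms(1)] _ assms(2,3)]])
     (use sin_\<tau>[OF assms(1)] in \<open>auto simp: mult_ac\<close>)

section \<open>The profile and its derivatives in the squared radius\<close>

definition "\<phi>1 s = A1 (\<tau> s)"
definition "\<phi>2 s = A2 (\<tau> s) / sin (\<tau> s) ^ 1"
definition "\<phi>3 s = A3 (\<tau> s) / sin (\<tau> s) ^ 3"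
definition "\<phi>4 s = A4 (\<tau> s) / sin (\<tau> s) ^ 5"

lemma \<phi>1_deriv: assumes "s \<in> I" shows "(\<phi>1 has_real_derivative \<phi>2 s) (at s)"
  unfolding \<phi>1_def \<phi>2_def
  by (rule deriv_comp_\<tau>[OF assms A1_deriv[OF \<tau>_J[OF assms]]])
     (use nonzero(3)[OF \<tau>_J[OF assms]] in simp)

lemma \<phi>2_deriv: assumes "s \<in> I" shows "(\<phi>2 has_real_derivative \<phi>3 s) (at s)"
  using deriv_sin_power_comp_\<tau>[OF assms smooth_A2, of 1] unfolding \<phi>2_def \<phi>3_def A3_def
  by (simp add: eval_nat_numeral)

lemma \<phi>3_deriv: assumes "s \<in> I" shows "(\<phi>3 has_real_derivative \<phi>4 s) (at s)"
  using deriv_sin_power_comp_\<tau>[OF assms smooth_A3, of 3] unfolding \<phi>3_def \<phi>4_def A4_def by simp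

lemma smooth_\<phi>1: "smooth_on \<phi>1 I"
  unfolding \<phi>1_def by (rule smooth_on_compose[OF smooth_A1 _ smooth_\<tau>]) (use \<tau>_J in auto)

text \<open>The constants belong to the one profile and hence do not involve \<delta>; this is the
  source of all uniformity in the family. The exponents 1, 3, 5 of \<open>\<tau>\<close> are those
  of \<open>sin\<close> in \<open>\<phi>2\<close>, \<open>\<phi>3\<close>, \<open>\<phi>4\<close>.
  The lower bound on \<open>\<phi>2\<close> follows from the positive minimum of \<open>A2\<close>
  and \<open>sin t \<le> t\<close>, and yields both divergence statements.\<close>

lemma profile_solution:
  obtains K c \<phi>0 where "K > 0" "c > 0" "smooth_on \<phi>0 I"
    "\<And>s. s \<in> I \<Longrightarrow> (\<phi>0 has_real_derivative \<phi>1 s) (at s)"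
    "\<And>s. s \<in> I \<Longrightarrow> \<bar>\<phi>0 s\<bar> \<le> K"
    "\<And>s. s \<in> I \<Longrightarrow> \<bar>\<phi>1 s\<bar> \<le> K"
    "\<And>s. s \<in> I \<Longrightarrow> c / \<tau> s \<le> \<phi>2 s"
    "\<And>s. s \<in> I \<Longrightarrow> \<bar>\<phi>2 s\<bar> \<le> K / \<tau> s"
    "\<And>s. s \<in> I \<Longrightarrow> \<bar>\<phi>3 s\<bar> \<le> K / \<tau> s ^ 3"
    "\<And>s. s \<in> I \<Longrightarrow> \<bar>\<phi>4 s\<bar> \<le> K / \<tau> s ^ 5"
    "\<And>s. s \<in> I \<Longrightarrow> s - S 0 \<le> K * (\<tau> s)\<^sup>2"
proof -
  obtain \<Phi> K0 where \<Phi>: "\<And>t. t \<in> {0<..<h} \<Longrightarrow> (\<Phi> has_real_derivative A1 t * (sin t * k t)) (at t)"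
    "\<And>t. t \<in> {0..h} \<Longrightarrow> \<bar>\<Phi> t\<bar> \<le> K0" using A1_antideriv by blast
  obtain K1 where K1: "\<And>t. t \<in> {0..h} \<Longrightarrow> \<bar>A1 t\<bar> \<le> K1" using bounded_J[OF smooth_A1] by blast
  obtain K2 where K2: "K2 > 0" "\<And>t. t \<in> {0..h} \<Longrightarrow> \<bar>A2 t\<bar> \<le> K2" using bounded_J[OF smooth_A2] by blast
  obtain K3 where K3: "\<And>t. t \<in> {0..h} \<Longrightarrow> \<bar>A3 t\<bar> \<le> K3" using bounded_J[OF smooth_A3] by blast
  obtain K4 where K4: "\<And>t. t \<in> {0..h} \<Longrightarrow> \<bar>A4 t\<bar> \<le> K4" using bounded_J[OF smooth_A4] by blast
  obtain K5 where K5: "\<And>t. t \<in> {0<..<h} \<Longrightarrow> S t - S 0 \<le> K5 * t\<^sup>2" using S_quadratic by blast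
  obtain c0 where c0: "c0 > 0" "\<And>t. t \<in> {0<..<h} \<Longrightarrow> c0 * t \<le> sin t" using sin_lower by blast
  obtain c where c: "c > 0" "\<And>t. t \<in> {0..h} \<Longrightarrow> c \<le> A2 t" using A2_lower by blast
  define K where "K = Max {1, K0, K1, K2 / c0 ^ 1, K3 / c0 ^ 3, K4 / c0 ^ 5, K5}"
  have K: "1 \<le> K" "K0 \<le> K" "K1 \<le> K" "K2 / c0 ^ 1 \<le> K" "K3 / c0 ^ 3 \<le> K" "K4 / c0 ^ 5 \<le> K" "K5 \<le> K"
    unfolding K_def by (intro Max_ge; simp)+
  have \<phi>0: "((\<lambda>s. \<Phi> (\<tau> s)) has_real_derivative \<phi>1 s) (at s)" if "s \<in> I" for s
    unfolding \<phi>1_def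
    by (rule deriv_comp_\<tau>[OF that \<Phi>(1)[OF \<tau>(1)[OF that]]])
       (use sin_\<tau>[OF that] nonzero(3)[OF \<tau>_J[OF that]] in simp)
  have quot: "\<bar>A (\<tau> s) / sin (\<tau> s) ^ j\<bar> \<le> K / \<tau> s ^ j"
    if "s \<in> I" "\<And>t. t \<in> {0..h} \<Longrightarrow> \<bar>A t\<bar> \<le> B" "B / c0 ^ j \<le> K" for A B s j
  proof -
    have t: "\<tau> s \<in> {0<..<h}" by (rule \<tau>(1)[OF that(1)])
    then have "\<bar>A (\<tau> s) / sin (\<tau> s) ^ j\<bar> \<le> (B / c0 ^ j) / \<tau> s ^ j"
      by (intro quotient_bound that c0) auto
    also have "\<dots> \<le> K / \<tau> s ^ j" using that(3) t by (intro divide_right_mono) auto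
    finally show ?thesis .
  qed
  show ?thesis
  proof (rule that[of K c "\<lambda>s. \<Phi> (\<tau> s)"])
    show "smooth_on (\<lambda>s. \<Phi> (\<tau> s)) I" by (rule smooth_on_antideriv[OF _ \<phi>0 smooth_\<phi>1]) auto
    fix s assume s: "s \<in> I"
    have t: "\<tau> s \<in> {0<..<h}" "\<tau> s \<in> {0..h}" using \<tau>(1)[OF s] by auto
    show "\<bar>\<Phi> (\<tau> s)\<bar> \<le> K" using \<Phi>(2)[OF t(2)] K by linarith
    show "\<bar>\<phi>1 s\<bar> \<le> K" using K1[OF t(2)] K unfolding \<phi>1_def by linarith
    show "\<bar>\<phi>2 s\<bar> \<le> K / \<tau> s" using quot[OF s K2(2) K(4)] by (simp add: \<phi>2_def)
    show "\<bar>\<phi>3 s\<bar> \<le> K / \<tau> s ^ 3" unfolding \<phi>3_def by (rule quot[OF s K3 K(5)])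
    show "\<bar>\<phi>4 s\<bar> \<le> K / \<tau> s ^ 5" unfolding \<phi>4_def by (rule quot[OF s K4 K(6)])
    have "sin (\<tau> s) \<le> \<tau> s" using sin_x_le_x[of "\<tau> s"] t by simp
    then show "c / \<tau> s \<le> \<phi>2 s"
      unfolding \<phi>2_def using c(1) c(2)[OF t(2)] sin_\<tau>[OF s] by (simp add: frac_le)
    have "s - S 0 \<le> K5 * (\<tau> s)\<^sup>2" using K5[OF t(1)] \<tau>(2)[OF s] by simp
    also have "\<dots> \<le> K * (\<tau> s)\<^sup>2" using K by (intro mult_right_mono) auto
    finally show "s - S 0 \<le> K * (\<tau> s)\<^sup>2" .
  qed (use K c \<phi>0 in auto)
qed

lemma \<phi>_values:
  assumes s: "s \<in> I"
  shows "s > 0" "q (\<tau> s) > 0" "q (\<tau> s) = 1 - s * (T (\<tau> s))\<^sup>2" "T (\<tau> s) \<ge> 0"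
    "cos (\<tau> s) > sin (\<tau> s) * T (\<tau> s)"
    "\<phi>1 s = T (\<tau> s) / (2 * sqrt (q (\<tau> s)))"
    "\<phi>2 s = (cos (\<tau> s) / sin (\<tau> s) - q (\<tau> s) * T (\<tau> s)) / (4 * s * (q (\<tau> s) * sqrt (q (\<tau> s))))"
proof -
  have t: "\<tau> s \<in> J" "\<bar>\<tau> s\<bar> < H" "\<tau> s \<in> {0..<H}" "\<tau> s \<in> {0<..<h}"
    using \<tau>(1)[OF s] \<tau>_J[OF s] H by auto
  show "s > 0" using S_pos[OF t(2)] \<tau>(2)[OF s] by simp
  show "q (\<tau> s) > 0" by (rule q_pos[OF t(1)])
  show "q (\<tau> s) = 1 - s * (T (\<tau> s))\<^sup>2" by (simp add: q_def \<tau>(2)[OF s])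
  show "T (\<tau> s) \<ge> 0" by (rule T_nonneg[OF t(3)])
  show "cos (\<tau> s) > sin (\<tau> s) * T (\<tau> s)"
    using E_pos[of "\<tau> s"] t(2) by (simp add: E_def)
  show "\<phi>1 s = T (\<tau> s) / (2 * sqrt (q (\<tau> s)))" by (simp add: \<phi>1_def A1_def)
  have "(cos (\<tau> s) / sin (\<tau> s) - q (\<tau> s) * T (\<tau> s)) * sin (\<tau> s)
    = cos (\<tau> s) - q (\<tau> s) * T (\<tau> s) * sin (\<tau> s)"
    using sin_\<tau>[OF s] by (simp add: left_diff_distrib)
  from this[symmetric]
  show "\<phi>2 s = (cos (\<tau> s) / sin (\<tau> s) - q (\<tau> s) * T (\<tau> s)) / (4 * s * (q (\<tau> s) * sqrt (q (\<tau> s))))"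
    unfolding \<phi>2_def A2_def \<tau>(2)[OF s] using sin_\<tau>[OF s] by simp
qed

end

text \<open>The equation for \<open>S\<close> is linear and homogeneous, so it is solved by an
  exponential with a free constant factor. Geometrically the factor rescales the radius, under which
  the Codazzi equation is invariant.\<close>

lemma edge_profile_exists:
  fixes m a :: real
  assumes m: "m \<ge> 1" and a: "0 \<le> a" "a < pi / 2"
  obtains H S where "edge_profile m a H S"
proof -
  \<comment> \<open>As \<open>H / m \<le> H\<close>, one third of the room below pi/2 gives
    \<open>a + H + H / m < pi / 2\<close>; the bound 1/2 ensures \<open>H \<le> 1\<close>.\<close>
  define H where "H = min (1 / 2) ((pi / 2 - a) / 3)"
  have H: "H > 0" "H \<le> 1" using a by (auto simp: H_def)
  have "H / m \<le> H" using H m by (simp add: field_simps)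
  moreover have "H \<le> (pi / 2 - a) / 3" unfolding H_def by (rule min.cobounded2)
  moreover have "a + 2 * H < pi / 2" using \<open>H \<le> (pi / 2 - a) / 3\<close> a by (simp add: field_simps)
  ultimately have aH: "a + H + H / m < pi / 2" "H / m \<le> H" by linarith+
  define E where "E t = cos t - sin t * tan (a + t / m)" for t
  define g where "g t = sin t * (1 + (tan (a + t / m))\<^sup>2) / (m * E t)" for t
  have pos: "cos (a + t / m) > 0" "E t > 0" if "\<bar>t\<bar> \<le> H" for t
    using edge_angles[OF m a(1) H(1) aH(1) that] by (simp_all add: E_def)
  have nz: "cos (a + t / m) \<noteq> 0" "m * E t \<noteq> 0" if "t \<in> {-H..H}" for t
  proof -
    have "\<bar>t\<bar> \<le> H" using that by (simp add: abs_le_iff)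
    from pos[OF this] show "cos (a + t / m) \<noteq> 0" "m * E t \<noteq> 0" using m by auto
  qed
  have "m \<noteq> 0" using m by simp
  have cE: "continuous_on {-H..H} E"
    unfolding E_def using nz(1) \<open>m \<noteq> 0\<close> by (intro continuous_intros) blast+
  have "continuous_on {-H..H} g"
    unfolding g_def using nz \<open>m \<noteq> 0\<close> by (intro continuous_intros cE) blast+
  then obtain \<Gamma> where \<Gamma>: "\<And>t. t \<in> {-H..H} \<Longrightarrow> (\<Gamma> has_vector_derivative g t) (at t within {-H..H})"
    using antiderivative_continuous by blast
  have \<Gamma>': "(\<Gamma> has_real_derivative g t) (at t)" if t: "t \<in> {-H<..<H}" for t
  proof -
    have "(\<Gamma> has_real_derivative g t) (at t within {-H<..<H})"
      unfolding has_real_derivative_iff_has_vector_derivative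
      by (rule has_vector_derivative_within_subset[OF \<Gamma>[of t]]) (use t in auto)
    then show ?thesis using at_within_open[OF t] by simp
  qed
  have "smooth_on (\<lambda>t. tan (a + t / m)) {-H<..<H}"
    unfolding tan_def using nz(1) m by (intro smooth_intros) auto
  moreover have "m * (cos t - sin t * tan (a + t / m)) \<noteq> 0" if "t \<in> {-H<..<H}" for t
    using nz(2)[of t] that unfolding E_def by (simp add: less_imp_le)
  ultimately have "smooth_on g {-H<..<H}"
    unfolding g_def E_def by (intro smooth_intros) auto
  then have s\<Gamma>: "smooth_on \<Gamma> {-H<..<H}" by (intro smooth_on_antideriv[OF _ \<Gamma>']) auto
  have "continuous_on {-H..H} \<Gamma>"
    unfolding continuous_on_eq_continuous_within using \<Gamma> has_vector_derivative_continuous by blast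
  then have "continuous_on {-H..H} (\<lambda>t. exp (2 * \<Gamma> t) * (tan (a + t / m))\<^sup>2)"
    using \<open>m \<noteq> 0\<close> nz(1) by (intro continuous_intros) blast+
  then have "bounded ((\<lambda>t. exp (2 * \<Gamma> t) * (tan (a + t / m))\<^sup>2) ` {-H..H})"
    using compact_continuous_image compact_imp_bounded by blast
  then obtain B where B: "B > 0" "\<And>t. t \<in> {-H..H} \<Longrightarrow> \<bar>exp (2 * \<Gamma> t) * (tan (a + t / m))\<^sup>2\<bar> \<le> B"
    unfolding bounded_pos by auto
  \<comment> \<open>The free factor is made small enough that
    \<open>S t * (tan (a + t / m))^2 < 1\<close>; \<open>B\<close> bounds this product for the
    unscaled exponential.\<close>
  define S where "S t = (1 / (B + 1)) * exp (2 * \<Gamma> t)" for t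
  have in_J: "t \<in> {-H<..<H}" "t \<in> {-H..H}" if "\<bar>t\<bar> < H" for t
    using that by (simp_all add: abs_less_iff)
  have "edge_profile m a H S"
  proof
    show "S t > 0" for t using B(1) by (simp add: S_def)
    show "(S has_real_derivative 2 * S t *
        (sin t * (1 + (tan (a + t / m))\<^sup>2) / (m * (cos t - sin t * tan (a + t / m))))) (at t)"
      if "\<bar>t\<bar> < H" for t
      unfolding S_def
      by (rule DERIV_cong[OF DERIV_cmult[OF DERIV_chain2[OF DERIV_exp DERIV_cmult[OF \<Gamma>'[OF in_J(1)[OF that]]]]]])
         (simp add: g_def E_def)
    show "smooth_on S {-H<..<H}" unfolding S_def by (intro smooth_intros s\<Gamma>) auto
    show "S t * (tan (a + t / m))\<^sup>2 < 1" if "\<bar>t\<bar> < H" for t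
    proof -
      have "exp (2 * \<Gamma> t) * (tan (a + t / m))\<^sup>2 < B + 1" using B(2)[OF in_J(2)[OF that]] by linarith
      then show ?thesis using B(1) by (simp add: S_def field_simps)
    qed
  qed (use m a H aH in auto)
  then show ?thesis by (rule that)
qed

section \<open>Bounds for covariant derivatives, weighted by powers of the gap\<close>

lemma abs_mult_le: "\<bar>a::real\<bar> \<le> A \<Longrightarrow> \<bar>b\<bar> \<le> B \<Longrightarrow> \<bar>a * b\<bar> \<le> A * B"
  unfolding abs_mult by (rule mult_mono) auto

lemma abs_add_le: "\<bar>a::real\<bar> \<le> A \<Longrightarrow> \<bar>b\<bar> \<le> B \<Longrightarrow> \<bar>a + b\<bar> \<le> A + B"
  by linarith

lemma abs_diff_le: "\<bar>a::real\<bar> \<le> A \<Longrightarrow> \<bar>b\<bar> \<le> B \<Longrightarrow> \<bar>a - b\<bar> \<le> A + B"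
  by linarith

lemma finite_basis_lists: "finite {Xs::'a::euclidean_space list. set Xs \<subseteq> Basis \<and> length Xs = j}"
  by (rule finite_lists_length_eq[OF finite_Basis])

lemma cov_norm_le:
  fixes f :: "'a::euclidean_space \<Rightarrow> real"
  assumes "\<And>Xs. set Xs \<subseteq> Basis \<Longrightarrow> length Xs = j \<Longrightarrow> \<bar>cov_deriv c f Xs x\<bar> \<le> B"
  shows "cov_norm j c f x \<le> real DIM('a) ^ j * B"
proof -
  let ?A = "{Xs::'a list. set Xs \<subseteq> Basis \<and> length Xs = j}"
  have "cov_norm j c f x \<le> (\<Sum>Xs\<in>?A. \<bar>cov_deriv c f Xs x\<bar>)"
    unfolding cov_norm_def by (rule L2_set_le_sum_abs)
  also have "\<dots> \<le> (\<Sum>Xs\<in>?A. B)" by (rule sum_mono) (use assms in auto)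
  also have "\<dots> = real DIM('a) ^ j * B" by (simp add: card_lists_length_eq[OF finite_Basis])
  finally show ?thesis .
qed

lemma cov_norm_ge:
  assumes "set Xs \<subseteq> Basis" "length Xs = j"
  shows "\<bar>cov_deriv c f Xs x\<bar> \<le> cov_norm j c f x"
proof -
  have "\<bar>cov_deriv c f Xs x\<bar> \<le> L2_set (\<lambda>Xs. \<bar>cov_deriv c f Xs x\<bar>) {Xs. set Xs \<subseteq> Basis \<and> length Xs = j}"
    by (rule member_le_L2_set[OF finite_basis_lists]) (use assms in auto)
  then show ?thesis by (simp add: cov_norm_def L2_set_def)
qed

lemma cov_norm_nonneg: "cov_norm j c f x \<ge> 0"
  unfolding cov_norm_def by (rule L2_set_nonneg)

context radial_profile begin

lemma \<alpha>_le: assumes "x \<in> N" "x \<noteq> 0"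
  shows "\<bar>\<alpha> X x\<bar> \<le> 2 * norm (tproj 0 x (x - p)) * norm X"
  using Cauchy_Schwarz_ineq2[of "tproj 0 x (x - p)" X] by (simp add: \<alpha>_inner2[OF assms] abs_mult)

lemma norm_tproj_le: assumes "x \<noteq> 0" shows "norm (tproj 0 x X) \<le> norm X"
proof (rule power2_le_imp_le)
  show "(norm (tproj 0 x X))\<^sup>2 \<le> (norm X)\<^sup>2"
    using norm_tproj[OF assms, of X] zero_le_power2[of "X \<bullet> nu 0 x"] by linarith
qed simp

lemma G_le: assumes "x \<in> N" "x \<noteq> 0" "norm X = 1" "norm Y = 1"
  shows "\<bar>G X Y x\<bar> \<le> 1"
proof -
  have "\<bar>G X Y x\<bar> \<le> norm (tproj 0 x X) * norm (tproj 0 x Y)"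
    unfolding G_inner[OF assms(1,2)] by (rule Cauchy_Schwarz_ineq2)
  also have "\<dots> \<le> 1 * 1"
    using norm_tproj_le[OF assms(2), of X] norm_tproj_le[OF assms(2), of Y] assms(3,4)
    by (intro mult_mono) auto
  finally show ?thesis by simp
qed

text \<open>Each \<open>\<alpha>\<close> gains a factor \<open>t\<close>, while
  \<open>\<phi>2\<close>, \<open>\<phi>3\<close>, \<open>\<phi>4\<close> lose 1, 3, 5 of them. Up to
  order three no negative power is left. At order four the terms with
  \<open>\<phi>4 \<alpha>^4\<close>, \<open>\<phi>3 \<alpha>^2\<close> and
  \<open>\<phi>2 \<kappa>^2\<close> are of order \<open>1 / t\<close>. The constant is 15 = 1 + 6 +
  4 + 3 + 1, the sum of the coefficients in the fourth-order bound, and \<open>D ^ 5\<close>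
  dominates all lower powers.\<close>

lemma cov_deriv_le:
  assumes x: "x \<in> N" "x \<noteq> 0" and t: "0 < t" "t \<le> 1" and D: "D \<ge> 1"
    and \<phi>: "\<bar>\<phi>0 (\<sigma> x)\<bar> \<le> D" "\<bar>\<phi>1 (\<sigma> x)\<bar> \<le> D" "\<bar>\<phi>2 (\<sigma> x)\<bar> \<le> D / t" "\<bar>\<phi>3 (\<sigma> x)\<bar> \<le> D / t ^ 3"
      "\<bar>\<phi>4 (\<sigma> x)\<bar> \<le> D / t ^ 5"
    and \<alpha>: "\<And>X. norm X = 1 \<Longrightarrow> \<bar>\<alpha> X x\<bar> \<le> D * t" and \<kappa>: "\<bar>\<kappa> x\<bar> \<le> D" and \<iota>: "\<bar>\<iota> x\<bar> \<le> D"
    and Xs: "\<And>X. X \<in> set Xs \<Longrightarrow> norm X = 1"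
  shows "length Xs \<le> 3 \<Longrightarrow> \<bar>cov_deriv 0 u Xs x\<bar> \<le> 15 * D ^ 5"
    and "length Xs = 4 \<Longrightarrow> \<bar>cov_deriv 0 u Xs x\<bar> \<le> 15 * D ^ 5 / t"
proof -
  have P: "D ^ i \<le> D ^ 5" if "i \<le> 5" for i using D that by (intro power_increasing) auto
  have P0: "0 \<le> D ^ i" for i using D by simp
  have Pt: "D ^ i * t \<le> D ^ 5" if "i \<le> 5" for i
  proof -
    have "D ^ i * t \<le> D ^ i * 1" using t P0 by (intro mult_left_mono) auto
    then show ?thesis using P[OF that] by linarith
  qed
  \<comment> \<open>These rules replace each factor by its bound, which is why the right-hand sides
    below mirror the formulas for the covariant derivatives term by term.\<close>
  note bounds = abs_add_le abs_diff_le abs_mult_le \<phi> \<alpha> \<kappa> \<iota> G_le[OF x] order_refl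
  note D5 = P[of 0] P[of 1] P[of 2] P[of 3] P[of 4] Pt[of 1] Pt[of 2] Pt[of 3] Pt[of 4]
  show "\<bar>cov_deriv 0 u Xs x\<bar> \<le> 15 * D ^ 5" if len: "length Xs \<le> 3"
  proof -
    consider "Xs = []" | X where "Xs = [X]" | X Y where "Xs = [X, Y]" | X Y Z where "Xs = [X, Y, Z]"
      using len by (auto simp: le_Suc_eq length_Suc_conv numeral_3_eq_3)
    then show ?thesis
    proof cases
      case 1
      then show ?thesis using \<phi>(1) D5 by (simp add: u_def)
    next
      case (2 X)
      then have "norm X = 1" using Xs by simp
      then have "\<bar>cov_deriv 0 u [X] x\<bar> \<le> D * (D * t)" unfolding cov_deriv_1[OF x] by (intro bounds)
      also have "\<dots> = D ^ 2 * t" by (simp add: power2_eq_square)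
      finally show ?thesis unfolding 2 using D5 P0[of 5] by linarith
    next
      case (3 X Y)
      then have "norm X = 1" "norm Y = 1" using Xs by simp_all
      then have "\<bar>cov_deriv 0 u [X, Y] x\<bar> \<le> D / t * (D * t * (D * t)) + D * (D * 1)"
        unfolding cov_deriv_2[OF x] by (intro bounds)
      also have "\<dots> = D ^ 3 * t + D ^ 2" using t by (simp add: field_simps eval_nat_numeral)
      finally show ?thesis unfolding 3 using D5 P0[of 5] by linarith
    next
      case (4 X Y Z)
      then have "norm X = 1" "norm Y = 1" "norm Z = 1" using Xs by simp_all
      then have "\<bar>cov_deriv 0 u [X, Y, Z] x\<bar> \<le> D / t ^ 3 * (D * t * (D * t * (D * t)))
          + D / t * (D * (1 * (D * t) + 1 * (D * t) + 1 * (D * t))) + D * (D * (D * t * 1))"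
        unfolding cov_deriv_3[OF x] by (intro bounds)
      also have "\<dots> = D ^ 4 + 3 * D ^ 3 + D ^ 3 * t" using t by (simp add: field_simps eval_nat_numeral)
      finally show ?thesis unfolding 4 using D5 P0[of 5] by linarith
    qed
  qed
  show "\<bar>cov_deriv 0 u Xs x\<bar> \<le> 15 * D ^ 5 / t" if len: "length Xs = 4"
  proof -
    obtain W X Y Z where W: "Xs = [W, X, Y, Z]"
      using len by (auto simp: length_Suc_conv eval_nat_numeral)
    then have "norm W = 1" "norm X = 1" "norm Y = 1" "norm Z = 1" using Xs by simp_all
    then have "\<bar>cov_deriv 0 u [W, X, Y, Z] x\<bar> \<le> D / t ^ 5 * (D * t * (D * t * (D * t * (D * t))))
        + D / t ^ 3 * (D * (1 * (D * t * (D * t)) + 1 * (D * t * (D * t)) + 1 * (D * t * (D * t))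
          + 1 * (D * t * (D * t)) + 1 * (D * t * (D * t)) + 1 * (D * t * (D * t))))
        + D / t * (D * (1 * (D * t * (D * t)) + 1 * (D * t * (D * t)) + 2 * (1 * (D * t * (D * t)))))
        + D / t * (D * D * (1 * 1 + 1 * 1 + 1 * 1))
        + D * (D * (D * (1 * 1)))"
      unfolding cov_deriv_4[OF x] power2_eq_square
      by (intro bounds) (auto simp: power2_eq_square)
    also have "\<dots> = (D ^ 5 + 6 * D ^ 4 + 4 * (D ^ 4 * t) * t + 3 * D ^ 3 + D ^ 3 * t) / t"
      using t by (simp add: field_simps eval_nat_numeral)
    also have "\<dots> \<le> 15 * D ^ 5 / t"
    proof (rule divide_right_mono)
      have "(D ^ 4 * t) * t \<le> D ^ 4 * t" using t P0[of 4] by (intro mult_right_le_one_le) auto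
      then show "D ^ 5 + 6 * D ^ 4 + 4 * (D ^ 4 * t) * t + 3 * D ^ 3 + D ^ 3 * t \<le> 15 * D ^ 5"
        using D5 by linarith
    qed (use t in auto)
    finally show ?thesis unfolding W .
  qed
qed

end

section \<open>Principal curvatures in terms of the gap\<close>

context edge_profile begin

lemma arctan_T: assumes "s \<in> I" shows "arctan (T (\<tau> s)) = a + \<tau> s / m"
proof (rule arctan_unique)
  have "\<tau> s \<ge> 0" "\<tau> s \<le> H" using \<tau>(1)[OF assms] H by auto
  then have "0 \<le> \<tau> s / m" "\<tau> s / m \<le> H / m" using m by (auto intro: divide_right_mono)
  then show "- (pi / 2) < a + \<tau> s / m" "a + \<tau> s / m < pi / 2"
    using H a pi_gt_zero by linarith+
qed (simp add: T_def)

lemma arctan_cot_\<tau>: assumes "s \<in> I" shows "arctan (cos (\<tau> s) / sin (\<tau> s)) = pi / 2 - \<tau> s"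
proof (rule arctan_unique)
  show "- (pi / 2) < pi / 2 - \<tau> s" "pi / 2 - \<tau> s < pi / 2"
    using \<tau>(1)[OF assms] angles(2)[of "\<tau> s"] by auto
qed (simp add: tan_def sin_diff cos_diff)

text \<open>The first two claims undo the construction of \<open>A1\<close> and \<open>A2\<close>,
  with \<open>W = 1 / q\<close>. In the third, the expression equals \<open>T\<close> at
  \<open>y = 0\<close> and the radial curvature at \<open>y = s\<close>; after clearing denominators
  the inequality reduces to \<open>T \<le> cot\<close>, which holds because \<open>E\<close> is
  positive.\<close>

lemma curvature_values:
  assumes s: "s \<in> I" and W: "W = 1 + 4 * (\<phi>1 s)\<^sup>2 * s"
  shows "2 * \<phi>1 s / sqrt W = T (\<tau> s)"
    "(4 * \<phi>2 s * s + 2 * \<phi>1 s) / (sqrt W * W) = cos (\<tau> s) / sin (\<tau> s)"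
    "y \<ge> 0 \<Longrightarrow> T (\<tau> s) \<le> (2 * \<phi>1 s + 4 * \<phi>2 s * y) / (sqrt W * (1 + 4 * (\<phi>1 s)\<^sup>2 * y))"
proof -
  note v = \<phi>_values[OF s]
  define Q where "Q = q (\<tau> s)"
  define R where "R = sqrt Q"
  define C where "C = cos (\<tau> s) / sin (\<tau> s)"
  define U where "U = T (\<tau> s)"
  have R: "R > 0" "Q = R * R" using v(2) by (auto simp: R_def Q_def)
  have \<phi>1: "\<phi>1 s = U / (2 * R)" using v(6) by (simp add: U_def R_def Q_def)
  have \<phi>2: "\<phi>2 s = (C - R * R * U) / (4 * s * (R * R * R))"
    using v(7) R(2) by (simp add: C_def U_def R_def Q_def)
  have sU: "s * U\<^sup>2 = 1 - R * R" using v(3) R(2) by (simp add: U_def Q_def)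
  have C: "C > U" using v(5) sin_\<tau>[OF s] by (simp add: C_def U_def field_simps)
  have p4: "4 * (\<phi>1 s)\<^sup>2 = U\<^sup>2 / (R * R)" using R(1) by (simp add: \<phi>1 power2_eq_square)
  have W1: "W = 1 / (R * R)"
  proof -
    have "W = 1 + (s * U\<^sup>2) / (R * R)" by (simp add: W p4 mult.commute)
    then show ?thesis unfolding sU using R(1) by (simp add: field_simps)
  qed
  have W2: "sqrt W = 1 / R" unfolding W1 using R(1) by (simp add: real_sqrt_divide real_sqrt_mult)
  show "2 * \<phi>1 s / sqrt W = T (\<tau> s)" unfolding W2 \<phi>1 using R(1) by (simp add: U_def)
  show "(4 * \<phi>2 s * s + 2 * \<phi>1 s) / (sqrt W * W) = cos (\<tau> s) / sin (\<tau> s)"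
    unfolding W2 unfolding W1 \<phi>1 \<phi>2 C_def[symmetric] using R(1) v(1) by (simp add: field_simps)
  show "T (\<tau> s) \<le> (2 * \<phi>1 s + 4 * \<phi>2 s * y) / (sqrt W * (1 + 4 * (\<phi>1 s)\<^sup>2 * y))" if y: "y \<ge> 0"
  proof -
    have "U * (s * U\<^sup>2) \<le> C - R * R * U" unfolding sU using C by (simp add: algebra_simps)
    then have "y * (U * (s * U\<^sup>2)) \<le> y * (C - R * R * U)" using y by (rule mult_left_mono)
    then have "y * (U * (s * U\<^sup>2)) / (s * (R * R)) \<le> y * (C - R * R * U) / (s * (R * R))"
      using v(1) R(1) by (intro divide_right_mono) auto
    moreover have "y * (U * (s * U\<^sup>2)) / (s * (R * R)) = U * (4 * (\<phi>1 s)\<^sup>2 * y)"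
      unfolding p4 using v(1) by simp
    moreover have "y * (C - R * R * U) / (s * (R * R)) = 4 * \<phi>2 s * y * R"
      unfolding \<phi>2 using v(1) R(1) by (simp add: field_simps)
    moreover have "2 * \<phi>1 s * R = U" unfolding \<phi>1 using R(1) by simp
    ultimately have "U * (1 + 4 * (\<phi>1 s)\<^sup>2 * y) \<le> (2 * \<phi>1 s + 4 * \<phi>2 s * y) * R"
      by (simp add: algebra_simps)
    moreover have "1 + 4 * (\<phi>1 s)\<^sup>2 * y > 0" using y by (simp add: add_pos_nonneg)
    ultimately show ?thesis unfolding W2 U_def[symmetric] using R(1) by (simp add: field_simps)
  qed
qed

end

section \<open>The family of solutions\<close>

text \<open>\<open>e\<close> is the axis through \<open>p\<close> and the centre of the ball, and
  \<open>b\<close> a direction orthogonal to it, used to test the fourth derivative.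
  \<open>fit\<close> says that a ball of diameter \<open>2 * r\<close> touching the sphere of gap
  \<open>\<delta>\<close> from outside stays within the range of the profile.\<close>

locale edge_ball = edge_profile m a H S for m a H S +
  fixes e b :: "'a::euclidean_space" and r K c \<delta> :: real and \<phi>0 :: "real \<Rightarrow> real"
  assumes e: "e \<in> Basis" and b: "b \<in> Basis" and be: "b \<noteq> e" and dim: "m = real DIM('a) - 1"
    and r: "r > 0" and \<delta>: "0 < \<delta>" "\<delta> < h" and fit: "sqrt (S \<delta>) + 2 * r < sqrt (S h)"
    and K: "K > 0" and c: "c > 0" and smooth_\<phi>0: "smooth_on \<phi>0 I"
    and \<phi>0_deriv: "\<And>s. s \<in> I \<Longrightarrow> (\<phi>0 has_real_derivative \<phi>1 s) (at s)"
    and \<phi>0_le: "\<And>s. s \<in> I \<Longrightarrow> \<bar>\<phi>0 s\<bar> \<le> K"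
    and \<phi>1_le: "\<And>s. s \<in> I \<Longrightarrow> \<bar>\<phi>1 s\<bar> \<le> K"
    and \<phi>2_ge: "\<And>s. s \<in> I \<Longrightarrow> c / \<tau> s \<le> \<phi>2 s"
    and \<phi>2_le: "\<And>s. s \<in> I \<Longrightarrow> \<bar>\<phi>2 s\<bar> \<le> K / \<tau> s"
    and \<phi>3_le: "\<And>s. s \<in> I \<Longrightarrow> \<bar>\<phi>3 s\<bar> \<le> K / \<tau> s ^ 3"
    and \<phi>4_le: "\<And>s. s \<in> I \<Longrightarrow> \<bar>\<phi>4 s\<bar> \<le> K / \<tau> s ^ 5"
    and S_le: "\<And>s. s \<in> I \<Longrightarrow> s - S 0 \<le> K * (\<tau> s)\<^sup>2"
begin

text \<open>The distance from \<open>p\<close> to the ball, chosen so that the nearest boundary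
  point has gap exactly \<open>\<delta>\<close>.\<close>

definition "\<rho> = sqrt (S \<delta>)"
definition "R = r + \<rho>"

sublocale radial_profile "- (R *\<^sub>R e)" I \<phi>0 \<phi>1 \<phi>2 \<phi>3 \<phi>4
  by unfold_locales (simp_all add: \<phi>0_deriv \<phi>1_deriv \<phi>2_deriv \<phi>3_deriv)

lemma S\<delta>: "S \<delta> \<in> I" "\<tau> (S \<delta>) = \<delta>" "S \<delta> > 0"
  using S_in_I[of \<delta>] \<tau>_S[of \<delta>] S_pos[of \<delta>] \<delta> H by auto

lemma \<rho>: "\<rho> > 0" "\<rho>\<^sup>2 = S \<delta>" using S\<delta> by (auto simp: \<rho>_def)

lemma S_0_pos: "S 0 > 0" using S_pos[of 0] H by simp

lemma R: "R > 0" "R \<ge> r" "R \<le> r + sqrt (S h)"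
  unfolding R_def using r \<rho>(1) fit[folded \<rho>_def] by linarith+

lemma ee: "e \<bullet> e = 1" "norm e = 1" using e by auto

lemma \<sigma>_eq: "\<sigma> x = x \<bullet> x + R\<^sup>2 + 2 * R * (e \<bullet> x)"
  using ee by (simp add: \<sigma>_def inner_add_left inner_add_right inner_commute power2_eq_square)

lemma \<sigma>_norm: "\<sigma> x = (norm (x + R *\<^sub>R e))\<^sup>2"
  by (simp add: \<sigma>_def power2_norm_eq_inner)

lemma \<sigma>_cball:
  assumes "x \<in> cball 0 r"
  shows "S \<delta> \<le> \<sigma> x" "\<sigma> x \<in> I" "x \<in> N" "\<delta> \<le> \<tau> (\<sigma> x)" "\<tau> (\<sigma> x) \<le> 1" "\<sigma> x \<le> S h"
    "norm (x + R *\<^sub>R e) \<le> sqrt (S h)"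
proof -
  have nx: "norm x \<le> r" using assms by simp
  have nR: "norm (R *\<^sub>R e) = R" using R by (simp add: ee(2))
  have 1: "\<rho> \<le> norm (x + R *\<^sub>R e)"
    using norm_triangle_ineq2[of "R *\<^sub>R e" "- x"] nx nR by (simp add: R_def add.commute)
  have 2: "norm (x + R *\<^sub>R e) < sqrt (S h)"
    using norm_triangle_ineq[of x "R *\<^sub>R e"] nx nR fit by (simp add: R_def \<rho>_def)
  show ge: "S \<delta> \<le> \<sigma> x"
    unfolding \<sigma>_norm \<rho>(2)[symmetric] using 1 \<rho>(1) by (intro power_mono) auto
  have "\<sigma> x < (sqrt (S h))\<^sup>2"
    unfolding \<sigma>_norm using 2 by (intro power_strict_mono) auto
  moreover have "S h > 0" using S_pos[of h] H by auto
  ultimately have lt: "\<sigma> x < S h" by simp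
  show \<sigma>I: "\<sigma> x \<in> I" using ge lt S\<delta>(1) by auto
  then show "x \<in> N" by (simp add: N_def)
  show "\<delta> \<le> \<tau> (\<sigma> x)" using \<tau>_mono[OF S\<delta>(1) \<sigma>I ge] S\<delta>(2) by simp
  show "\<tau> (\<sigma> x) \<le> 1" using \<tau>(1)[OF \<sigma>I] H by auto
  show "\<sigma> x \<le> S h" using lt by simp
  show "norm (x + R *\<^sub>R e) \<le> sqrt (S h)" using 2 by simp
qed

lemma sphere_cball: "x \<in> sphere 0 r \<Longrightarrow> x \<in> cball 0 r \<and> x \<noteq> 0 \<and> norm x = r"
  using r by auto

lemma smooth_up: "smooth_up_to u (cball 0 r)"
  unfolding smooth_up_to_def
  using smooth_u[OF smooth_\<phi>0] open_N \<sigma>_cball(3) by (auto simp: smooth_on_def)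

lemma \<phi>1_nonneg: "s \<in> I \<Longrightarrow> \<phi>1 s \<ge> 0"
  using \<phi>_values[of s] by (simp add: less_imp_le)

lemma strictly_convex: "strictly_convex_on (cball 0 r) u"
  unfolding strictly_convex_on_def
proof (intro ballI allI impI)
  fix x v :: 'a assume x: "x \<in> cball 0 r" and v: "v \<noteq> 0"
  let ?s = "\<sigma> x" and ?y = "x + R *\<^sub>R e"
  note \<sigma>x = \<sigma>_cball[OF x]
  have t: "\<tau> ?s > 0" using \<sigma>x(4) \<delta> by simp
  have "0 < c / \<tau> ?s" using c t by simp
  then have \<phi>2: "\<phi>2 ?s > 0" using \<phi>2_ge[OF \<sigma>x(2)] by linarith
  \<comment> \<open>For \<open>\<theta> = pi / 2\<close> the angle \<open>a\<close> is 0, so strict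
    positivity of the spherical curvature comes from the positive gap.\<close>
  have "T (\<tau> ?s) > 0"
  proof -
    have "a + \<tau> ?s / m > 0" using a m t by (intro add_nonneg_pos) auto
    then have "arctan (T (\<tau> ?s)) > 0" using arctan_T[OF \<sigma>x(2)] by simp
    then show ?thesis by simp
  qed
  then have \<phi>1: "\<phi>1 ?s > 0" using \<phi>_values(2,6)[OF \<sigma>x(2)] by simp
  have "v \<bullet> hess u x v = 2 * \<phi>1 ?s * (v \<bullet> v) + 4 * \<phi>2 ?s * (?y \<bullet> v)\<^sup>2"
    unfolding hess_u[OF \<sigma>x(3)]
    by (simp add: inner_add_right inner_add_left inner_commute power2_eq_square algebra_simps)
  also have "\<dots> > 0" using \<phi>1 \<phi>2 v by (intro add_pos_nonneg mult_pos_pos) auto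
  finally show "v \<bullet> hess u x v > 0" .
qed

text \<open>The radial angle falls short of pi/2 by \<open>\<tau>\<close>, and the \<open>m\<close>
  spherical angles \<open>a + \<tau> / m\<close> make up for it.\<close>

lemma equation: assumes "x \<in> cball 0 r" shows "F (A_op u x) = pi / 2 + m * a"
proof -
  note \<sigma>x = \<sigma>_cball[OF assms]
  have "F (A_op u x) = arctan (cos (\<tau> (\<sigma> x)) / sin (\<tau> (\<sigma> x))) + (real DIM('a) - 1) * arctan (T (\<tau> (\<sigma> x)))"
    unfolding F_A_op[OF \<sigma>x(3) refl] curvature_values(1,2)[OF \<sigma>x(2) refl] ..
  also have "\<dots> = pi / 2 + m * a"
    unfolding arctan_cot_\<tau>[OF \<sigma>x(2)] arctan_T[OF \<sigma>x(2)] dim[symmetric] using m by (simp add: field_simps)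
  finally show ?thesis .
qed

text \<open>The tangential gradient of \<open>\<sigma>\<close> is of the order of \<open>\<tau>\<close>, the square root of the distance to
  the edge; this is what keeps the first three derivatives of the boundary trace bounded.\<close>

lemma norm_tproj_center:
  assumes x: "x \<in> sphere 0 r"
  shows "(norm (tproj 0 x (x - - (R *\<^sub>R e))))\<^sup>2 \<le> (R * K / r) * (\<tau> (\<sigma> x))\<^sup>2"
proof -
  note \<sigma>x = \<sigma>_cball[OF conjunct1[OF sphere_cball[OF x]]]
  have x0: "x \<noteq> 0" and nx: "norm x = r" using sphere_cball[OF x] by auto
  define l where "l = e \<bullet> x"
  have l: "\<bar>l\<bar> \<le> r" using Cauchy_Schwarz_ineq2[of e x] nx ee by (simp add: l_def)
  have "tproj 0 x x = 0" using x0 by (simp add: tproj_0)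
  then have pr: "tproj 0 x (x - - (R *\<^sub>R e)) = R *\<^sub>R tproj 0 x e"
    by (simp add: linear_add[OF linear_tproj] linear_cmul[OF linear_tproj])
  have "(norm (tproj 0 x e))\<^sup>2 + (l / r)\<^sup>2 = 1"
    using norm_tproj[OF x0, of e] by (simp add: nu_0[OF x0] nx ee l_def divide_inverse mult.commute)
  then have "(norm (tproj 0 x e))\<^sup>2 = 1 - (l / r)\<^sup>2" by linarith
  then have "(norm (tproj 0 x (x - - (R *\<^sub>R e))))\<^sup>2 = R\<^sup>2 * (1 - (l / r)\<^sup>2)"
    unfolding pr by (simp add: power_mult_distrib)
  also have "\<dots> = (R\<^sup>2 / r\<^sup>2) * ((r - l) * (r + l))"
    using r by (simp add: field_simps power2_eq_square)
  \<comment> \<open>Only \<open>r + l\<close> matters: it vanishes at the point nearest to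
    \<open>p\<close> and equals \<open>(\<sigma> x - S \<delta>) / (2 * R)\<close>; the other factor
    is at most \<open>2 * r\<close>.\<close>
  also have "\<dots> \<le> (R\<^sup>2 / r\<^sup>2) * ((2 * r) * (r + l))"
    using l by (intro mult_left_mono mult_right_mono) auto
  also have "\<dots> = (R / r) * (2 * R * (r + l))" using r by (simp add: field_simps power2_eq_square)
  also have "2 * R * (r + l) = \<sigma> x - S \<delta>"
  proof -
    have "\<sigma> x = r\<^sup>2 + R\<^sup>2 + 2 * R * l" unfolding \<sigma>_eq by (simp add: l_def nx flip: power2_norm_eq_inner)
    moreover have "S \<delta> = (R - r)\<^sup>2" by (simp add: R_def \<rho>(2))
    ultimately show ?thesis by (simp add: power2_eq_square algebra_simps)
  qed
  also have "(R / r) * (\<sigma> x - S \<delta>) \<le> (R / r) * (K * (\<tau> (\<sigma> x))\<^sup>2)"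
    using S_le[OF \<sigma>x(2)] S\<delta>(1) R r by (intro mult_left_mono) auto
  finally show ?thesis by simp
qed

text \<open>\<open>R\<close> varies with \<open>\<delta>\<close>; replacing it by the upper bound
  \<open>R1\<close> makes \<open>D\<close> and \<open>M\<close> independent of
  \<open>\<delta>\<close>.\<close>

definition "R1 = r + sqrt (S h)"
definition "D = 1 + K + 2 * sqrt (R1 * K / r) + 2 * R1 / r + 1 / r\<^sup>2"

lemma S_h_pos: "S h > 0" using S_pos[of h] H by auto

lemma R1: "R1 \<ge> R" "R1 > 0" "R1 \<ge> sqrt (S h)" 
  using R S_h_pos r by (auto simp: R1_def add_pos_pos)

lemma D: "1 \<le> D" "K \<le> D" "2 * sqrt (R1 * K / r) \<le> D" "2 * R1 / r \<le> D" "1 / r\<^sup>2 \<le> D"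
proof -
  have "0 \<le> sqrt (R1 * K / r)" "0 \<le> R1 / r" "0 \<le> 1 / r\<^sup>2" using R1 r K by auto
  then show "1 \<le> D" "K \<le> D" "2 * sqrt (R1 * K / r) \<le> D" "2 * R1 / r \<le> D" "1 / r\<^sup>2 \<le> D"
    using K unfolding D_def by auto
qed

lemma norm_tproj_center_D:
  assumes x: "x \<in> sphere 0 r"
  shows "2 * norm (tproj 0 x (x - - (R *\<^sub>R e))) \<le> D * \<tau> (\<sigma> x)"
proof -
  note \<sigma>x = \<sigma>_cball[OF conjunct1[OF sphere_cball[OF x]]]
  have t: "\<tau> (\<sigma> x) > 0" using \<sigma>x(4) \<delta> by simp
  have "R * K / r \<le> R1 * K / r" using R1 K r by (intro divide_right_mono mult_right_mono) auto
  then have "(norm (tproj 0 x (x - - (R *\<^sub>R e))))\<^sup>2 \<le> (R1 * K / r) * (\<tau> (\<sigma> x))\<^sup>2"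
    using norm_tproj_center[OF x] by (meson mult_right_mono order_trans zero_le_power2)
  also have "\<dots> = (sqrt (R1 * K / r) * \<tau> (\<sigma> x))\<^sup>2"
    using R1 K r by (simp add: power_mult_distrib)
  finally have "norm (tproj 0 x (x - - (R *\<^sub>R e))) \<le> sqrt (R1 * K / r) * \<tau> (\<sigma> x)"
    using R1 K r t by (intro power2_le_imp_le[of "norm (tproj 0 x (x - - (R *\<^sub>R e)))"]) auto
  then have "2 * norm (tproj 0 x (x - - (R *\<^sub>R e))) \<le> (2 * sqrt (R1 * K / r)) * \<tau> (\<sigma> x)" by simp
  also have "\<dots> \<le> D * \<tau> (\<sigma> x)" using D(3) t by (intro mult_right_mono) auto
  finally show ?thesis .
qed

lemma \<iota>_sphere: "x \<in> sphere 0 r \<Longrightarrow> \<iota> x = 1 / r\<^sup>2"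
  by (simp add: \<iota>_def inverse_eq_divide flip: power2_norm_eq_inner)

lemma \<kappa>_sphere: "x \<in> sphere 0 r \<Longrightarrow> \<kappa> x = 2 * R * (e \<bullet> x) / r\<^sup>2"
  by (simp add: \<kappa>_def \<iota>_sphere inner_commute)

lemma cov_deriv_sphere:
  assumes x: "x \<in> sphere 0 r" and Xs: "set Xs \<subseteq> Basis"
  shows "length Xs \<le> 3 \<Longrightarrow> \<bar>cov_deriv 0 u Xs x\<bar> \<le> 15 * D ^ 5"
    and "length Xs = 4 \<Longrightarrow> \<bar>cov_deriv 0 u Xs x\<bar> \<le> 15 * D ^ 5 / \<tau> (\<sigma> x)"
proof -
  note \<sigma>x = \<sigma>_cball[OF conjunct1[OF sphere_cball[OF x]]]
  have x0: "x \<noteq> 0" and nx: "norm x = r" using sphere_cball[OF x] by auto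
  have t: "\<tau> (\<sigma> x) > 0" using \<sigma>x(4) \<delta> by simp
  have KD: "K / \<tau> (\<sigma> x) ^ j \<le> D / \<tau> (\<sigma> x) ^ j" for j
    using D t by (intro divide_right_mono) auto
  have \<alpha>: "\<bar>\<alpha> X x\<bar> \<le> D * \<tau> (\<sigma> x)" if "norm X = 1" for X
    using \<alpha>_le[OF \<sigma>x(3) x0, of X] norm_tproj_center_D[OF x] that by simp
  have \<iota>: "\<bar>\<iota> x\<bar> \<le> D" using D(5) by (simp add: \<iota>_sphere[OF x])
  have "\<bar>e \<bullet> x\<bar> \<le> r" using Cauchy_Schwarz_ineq2[of e x] nx ee by simp
  then have "\<bar>\<kappa> x\<bar> \<le> 2 * R * r / r\<^sup>2"
    unfolding \<kappa>_sphere[OF x] using R r by (simp add: abs_mult divide_right_mono)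
  also have "\<dots> = 2 * R / r" using r by (simp add: power2_eq_square)
  also have "\<dots> \<le> 2 * R1 / r" using R1 r by (intro divide_right_mono) auto
  finally have \<kappa>: "\<bar>\<kappa> x\<bar> \<le> D" using D(4) by linarith
  have nX: "\<And>X. X \<in> set Xs \<Longrightarrow> norm X = 1" using Xs by auto
  have \<phi>: "\<bar>\<phi>0 (\<sigma> x)\<bar> \<le> D" "\<bar>\<phi>1 (\<sigma> x)\<bar> \<le> D" "\<bar>\<phi>2 (\<sigma> x)\<bar> \<le> D / \<tau> (\<sigma> x)"
    "\<bar>\<phi>3 (\<sigma> x)\<bar> \<le> D / \<tau> (\<sigma> x) ^ 3" "\<bar>\<phi>4 (\<sigma> x)\<bar> \<le> D / \<tau> (\<sigma> x) ^ 5"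
    using \<phi>0_le[OF \<sigma>x(2)] \<phi>1_le[OF \<sigma>x(2)] \<phi>2_le[OF \<sigma>x(2)] \<phi>3_le[OF \<sigma>x(2)] \<phi>4_le[OF \<sigma>x(2)]
      D(2) KD[of 1] KD[of 3] KD[of 5] by auto
  show "length Xs \<le> 3 \<Longrightarrow> \<bar>cov_deriv 0 u Xs x\<bar> \<le> 15 * D ^ 5"
    and "length Xs = 4 \<Longrightarrow> \<bar>cov_deriv 0 u Xs x\<bar> \<le> 15 * D ^ 5 / \<tau> (\<sigma> x)"
    using cov_deriv_le[OF \<sigma>x(3) x0 t \<sigma>x(5) D(1) \<phi> \<alpha> \<kappa> \<iota> nX] by blast+
qed

definition "M = real DIM('a) ^ 4 * (15 * D ^ 5)"

lemma M_pos: "M > 0" using D(1) by (simp add: M_def)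

lemma cov_norm_sphere:
  assumes x: "x \<in> sphere 0 r"
  shows "j \<le> 3 \<Longrightarrow> cov_norm j 0 u x \<le> M" and "cov_norm 4 0 u x \<le> M / \<delta>"
proof -
  note \<sigma>x = \<sigma>_cball[OF conjunct1[OF sphere_cball[OF x]]]
  have D5: "0 \<le> 15 * D ^ 5" using D(1) by simp
  show "cov_norm j 0 u x \<le> M" if j: "j \<le> 3"
  proof -
    have "cov_norm j 0 u x \<le> real DIM('a) ^ j * (15 * D ^ 5)"
      by (rule cov_norm_le) (use cov_deriv_sphere(1)[OF x] j in auto)
    also have "\<dots> \<le> M" unfolding M_def
      using j DIM_positive[where 'a='a] D5 by (intro mult_right_mono power_increasing) (auto simp: Suc_leI)
    finally show ?thesis .
  qed
  have "cov_norm 4 0 u x \<le> real DIM('a) ^ 4 * (15 * D ^ 5 / \<delta>)"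
  proof (rule cov_norm_le)
    fix Xs :: "'a list" assume "set Xs \<subseteq> Basis" "length Xs = 4"
    then have "\<bar>cov_deriv 0 u Xs x\<bar> \<le> 15 * D ^ 5 / \<tau> (\<sigma> x)" by (rule cov_deriv_sphere(2)[OF x])
    also have "\<dots> \<le> 15 * D ^ 5 / \<delta>" using \<sigma>x(4) \<delta> D5 by (intro divide_left_mono) auto
    finally show "\<bar>cov_deriv 0 u Xs x\<bar> \<le> 15 * D ^ 5 / \<delta>" .
  qed
  then show "cov_norm 4 0 u x \<le> M / \<delta>" by (simp add: M_def)
qed

text \<open>The boundary point nearest to \<open>p\<close>. Its inward normal \<open>e\<close> is
  the radial direction from \<open>p\<close>, so the tangential part of \<open>x0 - p\<close>
  vanishes; all extremal values are attained or tested here.\<close>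

definition "x0 = - (r *\<^sub>R e)"

lemma x0: "x0 \<in> sphere 0 r" "x0 - - (R *\<^sub>R e) = \<rho> *\<^sub>R e" "\<sigma> x0 = S \<delta>" "nu 0 x0 = e" "x0 \<noteq> 0"
proof -
  show s: "x0 \<in> sphere 0 r" using r by (simp add: x0_def ee)
  show d: "x0 - - (R *\<^sub>R e) = \<rho> *\<^sub>R e" by (simp add: x0_def R_def algebra_simps)
  show "\<sigma> x0 = S \<delta>" unfolding \<sigma>_def d using \<rho>(2) by (simp add: ee power2_eq_square)
  show "x0 \<noteq> 0" using sphere_cball[OF s] by simp
  then show "nu 0 x0 = e" using r by (simp add: nu_0) (simp add: x0_def ee)
qed

lemma cSUP_sphere_le:
  fixes f :: "'a \<Rightarrow> real"
  assumes "\<And>x. x \<in> sphere 0 r \<Longrightarrow> f x \<le> B" shows "(SUP x\<in>sphere 0 r. f x) \<le> B"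
  by (rule cSUP_least) (use x0(1) assms in blast)+

lemma le_cSUP_sphere:
  fixes f :: "'a \<Rightarrow> real"
  assumes "\<And>x. x \<in> sphere 0 r \<Longrightarrow> f x \<le> B" shows "f x0 \<le> (SUP x\<in>sphere 0 r. f x)"
  by (rule cSUP_upper[OF x0(1)]) (rule bdd_aboveI2[OF assms])

section \<open>Norms of the boundary trace\<close>

lemma Ck_norm_3: "Ck_norm_sphere 3 0 r u \<le> 4 * M"
proof -
  have "Ck_norm_sphere 3 0 r u \<le> (\<Sum>j\<le>(3::nat). M)"
    unfolding Ck_norm_sphere_def by (intro sum_mono cSUP_sphere_le cov_norm_sphere(1)) auto
  then show ?thesis by simp
qed

lemma Ck_norm_4_split:
  "Ck_norm_sphere 4 0 r u = Ck_norm_sphere 3 0 r u + (SUP x\<in>sphere 0 r. cov_norm 4 0 u x)"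
proof -
  have "{..4::nat} = insert 4 {..3}" by auto
  then show ?thesis unfolding Ck_norm_sphere_def by simp
qed

lemma Ck_norm_4_le: "Ck_norm_sphere 4 0 r u \<le> 5 * M / \<delta>"
proof -
  have "M \<le> M / \<delta>" using \<delta> H M_pos by (simp add: field_simps)
  moreover have "(SUP x\<in>sphere 0 r. cov_norm 4 0 u x) \<le> M / \<delta>"
    by (rule cSUP_sphere_le[OF cov_norm_sphere(2)])
  ultimately show ?thesis unfolding Ck_norm_4_split using Ck_norm_3 by simp
qed

text \<open>At \<open>x0\<close> the differential of \<open>\<sigma>\<close> along the sphere is 0,
  so every term with a factor \<open>\<alpha>\<close> drops out. In the direction \<open>b\<close>
  there remain \<open>3 * \<phi>2 * \<kappa>^2\<close>, of order \<open>1 / \<delta>\<close>, and a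
  bounded term with \<open>\<phi>1\<close>.\<close>

lemma Ck_norm_4_ge:
  assumes small: "2 * K * R1 / r ^ 3 \<le> 11 * c / \<delta>"
  shows "c / \<delta> \<le> Ck_norm_sphere 4 0 r u"
proof -
  note \<sigma>x = \<sigma>_cball[OF conjunct1[OF sphere_cball[OF x0(1)]]]
  have "tproj 0 x0 (x0 - - (R *\<^sub>R e)) = 0"
    unfolding x0(2) linear_cmul[OF linear_tproj] by (simp add: tproj_def x0(4) ee)
  then have \<alpha>: "\<alpha> b x0 = 0" by (simp add: \<alpha>_inner2[OF \<sigma>x(3) x0(5)])
  have "b \<bullet> e = 0" using e b be by (simp add: inner_Basis)
  then have "tproj 0 x0 b = b" by (simp add: tproj_def x0(4))
  then have G: "G b b x0 = 1" using b by (simp add: G_inner[OF \<sigma>x(3) x0(5)])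
  have \<kappa>: "\<kappa> x0 = - 2 * (R / r)"
    unfolding \<kappa>_sphere[OF x0(1)] using r by (simp add: x0_def ee power2_eq_square)
  have "cov_deriv 0 u [b, b, b, b] x0
      = 3 * \<phi>2 (S \<delta>) * (2 * (R / r))\<^sup>2 - \<phi>1 (S \<delta>) * ((1 / r\<^sup>2) * (2 * (R / r)))"
    unfolding cov_deriv_4[OF \<sigma>x(3) x0(5)] \<alpha> G \<kappa> x0(3) \<iota>_sphere[OF x0(1)] by simp
  \<comment> \<open>\<open>R \<ge> r\<close> makes the square at least 4, so the leading term is at
    least \<open>12 * c / \<delta>\<close>; \<open>small\<close> allows the bounded term to use up
    11 of these 12 units.\<close>
  also have "\<dots> \<ge> 3 * (c / \<delta>) * 4 - K * ((1 / r\<^sup>2) * (2 * (R1 / r)))"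
  proof (intro diff_mono mult_mono)
    show "c / \<delta> \<le> \<phi>2 (S \<delta>)" using \<phi>2_ge[OF S\<delta>(1)] S\<delta>(2) by simp
    have "1 \<le> R / r" using R r by simp
    then have "2 \<le> 2 * (R / r)" by linarith
    then have "2\<^sup>2 \<le> (2 * (R / r))\<^sup>2" by (intro power_mono) auto
    then show "4 \<le> (2 * (R / r))\<^sup>2" by simp
    show "\<phi>1 (S \<delta>) \<le> K" using \<phi>1_le[OF S\<delta>(1)] by simp
    show "R / r \<le> R1 / r" using R1 r by (intro divide_right_mono) auto
    have "0 < c / \<delta>" using c \<delta> by simp
    then show "0 \<le> 3 * \<phi>2 (S \<delta>)" using \<phi>2_ge[OF S\<delta>(1)] S\<delta>(2) by simp
  qed (use K R R1 r c \<delta> in auto)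
  finally have "3 * (c / \<delta>) * 4 - K * ((1 / r\<^sup>2) * (2 * (R1 / r))) \<le> cov_deriv 0 u [b, b, b, b] x0" .
  moreover have "K * ((1 / r\<^sup>2) * (2 * (R1 / r))) = 2 * K * R1 / r ^ 3"
    by (simp add: power2_eq_square power3_eq_cube)
  moreover have "11 * c / \<delta> = 11 * (c / \<delta>)" by simp
  ultimately have "c / \<delta> \<le> cov_deriv 0 u [b, b, b, b] x0" using small by linarith
  also have "\<dots> \<le> cov_norm 4 0 u x0"
    using cov_norm_ge[of "[b, b, b, b]" 4 0 u x0] b by (simp del: cov_deriv.simps)
  also have "\<dots> \<le> (SUP x\<in>sphere 0 r. cov_norm 4 0 u x)"
    by (rule le_cSUP_sphere[OF cov_norm_sphere(2)])
  also have "\<dots> \<le> Ck_norm_sphere 4 0 r u"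
  proof -
    have "0 \<le> (SUP x\<in>sphere 0 r. cov_norm j 0 u x)" if "j \<le> 3" for j
      using cov_norm_nonneg[of j 0 u x0] le_cSUP_sphere[of "cov_norm j 0 u", OF cov_norm_sphere(1)] that
      by linarith
    then show ?thesis unfolding Ck_norm_4_split unfolding Ck_norm_sphere_def by (auto intro: sum_nonneg)
  qed
  finally show ?thesis .
qed

section \<open>Gradient, mixed and double normal derivatives\<close>

lemma C1: "C1_norm (cball 0 r) u \<le> K + 2 * K * sqrt (S h)"
  unfolding C1_norm_def
proof (intro add_mono cSUP_least)
  fix x :: 'a assume x: "x \<in> cball 0 r"
  note \<sigma>x = \<sigma>_cball[OF x]
  show "\<bar>u x\<bar> \<le> K" unfolding u_def by (rule \<phi>0_le[OF \<sigma>x(2)])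
  have "norm (grad u x) = 2 * \<bar>\<phi>1 (\<sigma> x)\<bar> * norm (x + R *\<^sub>R e)"
    by (simp add: grad_u[OF \<sigma>x(3)] abs_mult)
  also have "\<dots> \<le> 2 * K * sqrt (S h)"
    using \<phi>1_le[OF \<sigma>x(2)] \<sigma>x(7) K by (intro mult_mono) auto
  finally show "norm (grad u x) \<le> 2 * K * sqrt (S h)" .
qed (use r in auto)

text \<open>The multiple of the identity in the Hessian does not pair a tangent vector with the
  normal. In the rank-one part the factor \<open>\<phi>2\<close>, at most \<open>K / \<tau>\<close>,
  meets the tangential component of \<open>x - p\<close>, which is O(\<open>\<tau>\<close>), so the
  singularity cancels.\<close>

lemma mixed: "sup_mixed 0 r u \<le> 2 * K * D * sqrt (S h)"
  unfolding sup_mixed_def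
proof (intro cSUP_sphere_le cSUP_least)
  fix x :: 'a assume x: "x \<in> sphere 0 r"
  note \<sigma>x = \<sigma>_cball[OF conjunct1[OF sphere_cball[OF x]]]
  have x0: "x \<noteq> 0" using sphere_cball[OF x] by auto
  have t: "\<tau> (\<sigma> x) > 0" using \<sigma>x(4) \<delta> by simp
  let ?y = "x - - (R *\<^sub>R e)"
  have "dim (tangent 0 x) > 0"
    using dim_tangent_0[OF x0] dim m by simp
  from unit_multiple[OF subspace_tangent _ this, of 0]
  show "{\<xi> \<in> tangent 0 x. norm \<xi> = 1} \<noteq> {}" by (auto simp: tangent_def)
  fix \<xi> assume "\<xi> \<in> {\<xi> \<in> tangent 0 x. norm \<xi> = 1}"
  then have \<xi>: "\<xi> \<in> tangent 0 x" "norm \<xi> = 1" by auto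
  have "\<xi> \<bullet> nu 0 x = 0" using \<xi>(1) by (simp add: tangent_def)
  then have eq: "\<xi> \<bullet> hess u x (nu 0 x) = 4 * \<phi>2 (\<sigma> x) * ((?y \<bullet> nu 0 x) * (?y \<bullet> \<xi>))"
    unfolding hess_u[OF \<sigma>x(3)] by (simp add: inner_add_right inner_add_left inner_commute mult_ac)
  have "norm (nu 0 x) = 1" using x0 by (simp add: nu_def norm_sgn)
  then have 1: "\<bar>?y \<bullet> nu 0 x\<bar> \<le> sqrt (S h)"
    using Cauchy_Schwarz_ineq2[of ?y "nu 0 x"] \<sigma>x(7) by simp
  have "?y \<bullet> \<xi> = tproj 0 x ?y \<bullet> \<xi>"
    using tproj_eq_self[OF x0 \<xi>(1)] tproj_self_adjoint[of 0 x ?y \<xi>] by simp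
  then have 2: "\<bar>?y \<bullet> \<xi>\<bar> \<le> D * \<tau> (\<sigma> x) / 2"
    using Cauchy_Schwarz_ineq2[of "tproj 0 x ?y" \<xi>] norm_tproj_center_D[OF x] \<xi>(2) by simp
  have "\<bar>\<xi> \<bullet> hess u x (nu 0 x)\<bar> \<le> (4 * (K / \<tau> (\<sigma> x))) * (sqrt (S h) * (D * \<tau> (\<sigma> x) / 2))"
    unfolding eq by (intro abs_mult_le 1 2 \<phi>2_le \<sigma>x) simp
  also have "\<dots> = 2 * K * D * sqrt (S h)" using t by simp
  finally show "\<bar>\<xi> \<bullet> hess u x (nu 0 x)\<bar> \<le> 2 * K * D * sqrt (S h)" .
qed

lemma double_normal_eq:
  assumes x: "x \<in> sphere 0 r"
  shows "nu 0 x \<bullet> hess u x (nu 0 x)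
    = 2 * \<phi>1 (\<sigma> x) + 4 * \<phi>2 (\<sigma> x) * ((x - - (R *\<^sub>R e)) \<bullet> nu 0 x)\<^sup>2"
proof -
  note \<sigma>x = \<sigma>_cball[OF conjunct1[OF sphere_cball[OF x]]]
  have "nu 0 x \<bullet> nu 0 x = 1"
    using sphere_cball[OF x] by (simp add: nu_def norm_sgn flip: power2_norm_eq_inner)
  then show ?thesis unfolding hess_u[OF \<sigma>x(3)]
    by (simp add: inner_add_right inner_add_left inner_commute power2_eq_square mult_ac)
qed

lemma double_normal_le:
  assumes x: "x \<in> sphere 0 r"
  shows "nu 0 x \<bullet> hess u x (nu 0 x) \<le> (2 * K + 4 * K * S h) / \<delta>"
proof -
  note \<sigma>x = \<sigma>_cball[OF conjunct1[OF sphere_cball[OF x]]]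
  let ?y = "x - - (R *\<^sub>R e)"
  have "norm (nu 0 x) = 1" using sphere_cball[OF x] by (simp add: nu_def norm_sgn)
  then have "\<bar>?y \<bullet> nu 0 x\<bar> \<le> sqrt (S h)"
    using Cauchy_Schwarz_ineq2[of ?y "nu 0 x"] \<sigma>x(7) by simp
  then have "(?y \<bullet> nu 0 x)\<^sup>2 \<le> (sqrt (S h))\<^sup>2" using abs_le_square_iff by fastforce
  then have y: "(?y \<bullet> nu 0 x)\<^sup>2 \<le> S h" using S_h_pos by simp
  have "\<phi>2 (\<sigma> x) \<le> K / \<tau> (\<sigma> x)" using \<phi>2_le[OF \<sigma>x(2)] by simp
  also have "\<dots> \<le> K / \<delta>" using \<sigma>x(4) \<delta> K by (intro divide_left_mono) auto
  finally have "4 * \<phi>2 (\<sigma> x) * (?y \<bullet> nu 0 x)\<^sup>2 \<le> 4 * (K / \<delta>) * S h"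
    using y K \<delta> by (intro mult_mono mult_left_mono) auto
  moreover have "\<phi>1 (\<sigma> x) \<le> K" using \<phi>1_le[OF \<sigma>x(2)] by simp
  moreover have "K \<le> K / \<delta>" using K \<delta> H by (simp add: field_simps)
  ultimately show ?thesis unfolding double_normal_eq[OF x] by (simp add: add_divide_distrib)
qed

text \<open>The lower bound is taken at \<open>x0\<close>, where \<open>x - p\<close> is
  \<open>\<rho>\<close> times the normal: no cancellation occurs, and
  \<open>\<rho>^2 = S \<delta>\<close> stays above \<open>S 0\<close> as \<open>\<delta>\<close>
  tends to 0.\<close>

lemma double_normal:
  "4 * c * S 0 / \<delta> \<le> sup_double_normal 0 r u" "sup_double_normal 0 r u \<le> (2 * K + 4 * K * S h) / \<delta>"
proof -
  show "sup_double_normal 0 r u \<le> (2 * K + 4 * K * S h) / \<delta>"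
    unfolding sup_double_normal_def by (rule cSUP_sphere_le[OF double_normal_le])
  have "4 * (c / \<delta>) * S 0 \<le> 4 * \<phi>2 (S \<delta>) * S \<delta>"
  proof (intro mult_mono)
    show "c / \<delta> \<le> \<phi>2 (S \<delta>)" using \<phi>2_ge[OF S\<delta>(1)] S\<delta>(2) by simp
    moreover have "0 < c / \<delta>" using c \<delta> by simp
    ultimately show "0 \<le> 4 * \<phi>2 (S \<delta>)" by simp
  qed (use S\<delta>(1) S_0_pos c \<delta> in auto)
  also have "\<dots> \<le> nu 0 x0 \<bullet> hess u x0 (nu 0 x0)"
    unfolding double_normal_eq[OF x0(1)] unfolding x0(2,3,4)
    using \<phi>1_nonneg[OF S\<delta>(1)] \<rho>(2) by (simp add: ee)
  also have "\<dots> \<le> sup_double_normal 0 r u"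
    unfolding sup_double_normal_def by (rule le_cSUP_sphere[OF double_normal_le])
  finally show "4 * c * S 0 / \<delta> \<le> sup_double_normal 0 r u" by simp
qed

text \<open>All tangential curvatures are \<open>T\<close> except the one along the tangential part
  of \<open>x - p\<close>, which is at least \<open>T\<close>. Replacing it by \<open>T\<close>
  leaves \<open>pi/2 + m * (a + \<tau> / m)\<close>. At \<open>x0\<close> this tangential part is 0,
  so the bound is an equality there.\<close>

lemma calB_sphere:
  assumes x: "x \<in> sphere 0 r"
  shows "pi / 2 + m * a + \<tau> (\<sigma> x) \<le> calB 0 u x (normal_deriv 0 u x)"
    and "x = x0 \<Longrightarrow> calB 0 u x (normal_deriv 0 u x) = pi / 2 + m * a + \<delta>"
proof -
  note \<sigma>x = \<sigma>_cball[OF conjunct1[OF sphere_cball[OF x]]]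
  have xn: "x \<noteq> 0" using sphere_cball[OF x] by auto
  have D2: "DIM('a) \<ge> 2" using dim m by simp
  have dm: "real DIM('a) - 2 = m - 1" using dim by linarith
  define y where "y = (norm (tproj 0 x (x - - (R *\<^sub>R e))))\<^sup>2"
  define W where "W = 1 + 4 * (\<phi>1 (\<sigma> x))\<^sup>2 * \<sigma> x"
  note cv = curvature_values[OF \<sigma>x(2) W_def]
  let ?\<mu> = "(2 * \<phi>1 (\<sigma> x) + 4 * \<phi>2 (\<sigma> x) * y) / (sqrt W * (1 + 4 * (\<phi>1 (\<sigma> x))\<^sup>2 * y))"
  have calB: "calB 0 u x (normal_deriv 0 u x) = pi / 2 + arctan ?\<mu> + (m - 1) * (a + \<tau> (\<sigma> x) / m)"
    unfolding calB_u[OF \<sigma>x(3) xn D2 W_def y_def] cv(1) arctan_T[OF \<sigma>x(2)] dm ..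
  have val: "pi / 2 + (a + \<tau> (\<sigma> x) / m) + (m - 1) * (a + \<tau> (\<sigma> x) / m) = pi / 2 + m * a + \<tau> (\<sigma> x)"
    using m by (simp add: field_simps)
  have "T (\<tau> (\<sigma> x)) \<le> ?\<mu>" by (rule cv(3)) (simp add: y_def)
  then have "arctan (T (\<tau> (\<sigma> x))) \<le> arctan ?\<mu>" by (rule arctan_monotone')
  then show "pi / 2 + m * a + \<tau> (\<sigma> x) \<le> calB 0 u x (normal_deriv 0 u x)"
    unfolding calB val[symmetric] arctan_T[OF \<sigma>x(2)] by simp
  show "calB 0 u x (normal_deriv 0 u x) = pi / 2 + m * a + \<delta>" if "x = x0"
  proof -
    have "tproj 0 x (x - - (R *\<^sub>R e)) = 0"
      unfolding that x0(2) linear_cmul[OF linear_tproj] by (simp add: tproj_def x0(4) ee)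
    then have "?\<mu> = T (\<tau> (\<sigma> x))" by (simp add: y_def cv(1)[symmetric])
    then have "calB 0 u x (normal_deriv 0 u x) = pi / 2 + m * a + \<tau> (\<sigma> x)"
      unfolding calB val[symmetric] using arctan_T[OF \<sigma>x(2)] by simp
    then show ?thesis by (simp add: that x0(3) S\<delta>(2))
  qed
qed

lemma delta_star_u: "delta_star 0 r (pi / 2 + m * a) u = \<delta>"
  unfolding delta_star_def
proof (rule cInf_eq_minimum)
  show "\<delta> \<in> (\<lambda>x. calB 0 u x (normal_deriv 0 u x) - (pi / 2 + m * a)) ` sphere 0 r"
    by (rule image_eqI[of _ _ x0]) (use calB_sphere(2)[OF x0(1)] x0(1) in auto)
  fix z assume "z \<in> (\<lambda>x. calB 0 u x (normal_deriv 0 u x) - (pi / 2 + m * a)) ` sphere 0 r"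
  then obtain x where x: "x \<in> sphere 0 r" "z = calB 0 u x (normal_deriv 0 u x) - (pi / 2 + m * a)"
    by blast
  have "\<delta> \<le> \<tau> (\<sigma> x)" by (rule \<sigma>_cball(4)[OF conjunct1[OF sphere_cball[OF x(1)]]])
  then show "\<delta> \<le> z" using calB_sphere(1)[OF x(1)] x(2) by linarith
qed

end

lemma exists_family:
  fixes \<theta> :: real
  assumes n: "DIM('a::euclidean_space) \<ge> 2"
    and \<theta>: "pi / 2 \<le> \<theta>" "\<theta> < real DIM('a) * pi / 2"
  shows "\<exists>r \<delta>\<^sub>0 (u :: real \<Rightarrow> 'a \<Rightarrow> real).
    r > 0 \<and> \<delta>\<^sub>0 > 0 \<and>
    (\<forall>\<delta>\<in>{0<..<\<delta>\<^sub>0}.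
        smooth_up_to (u \<delta>) (cball 0 r) \<and>
        strictly_convex_on (cball 0 r) (u \<delta>) \<and>
        (\<forall>x\<in>ball 0 r. F (A_op (u \<delta>) x) = \<theta>) \<and>
        delta_star 0 r \<theta> (u \<delta>) = \<delta>) \<and>
    (\<exists>K. \<forall>\<delta>\<in>{0<..<\<delta>\<^sub>0}.
        C1_norm (cball 0 r) (u \<delta>) + Ck_norm_sphere 3 0 r (u \<delta>) + sup_mixed 0 r (u \<delta>) \<le> K) \<and>
    comparable_on {0<..<\<delta>\<^sub>0} (\<lambda>\<delta>. sup_double_normal 0 r (u \<delta>)) (\<lambda>\<delta>. 1 / \<delta>) \<and>
    comparable_on {0<..<\<delta>\<^sub>0} (\<lambda>\<delta>. Ck_norm_sphere 4 0 r (u \<delta>)) (\<lambda>\<delta>. 1 / \<delta>)"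
proof -
  define m where "m = real DIM('a) - 1"
  have m: "m \<ge> 1" using n by (simp add: m_def)
  define a where "a = (\<theta> - pi / 2) / m"
  have angle: "0 \<le> a" "a < pi / 2" "pi / 2 + m * a = \<theta>"
  proof -
    show "0 \<le> a" using \<theta> m by (simp add: a_def)
    have "\<theta> - pi / 2 < pi / 2 * m" using \<theta>(2) by (simp add: m_def algebra_simps)
    then show "a < pi / 2" using m by (simp add: a_def divide_less_eq)
    show "pi / 2 + m * a = \<theta>" using m by (simp add: a_def)
  qed
  obtain H S where "edge_profile m a H S" using edge_profile_exists[OF m angle(1,2)] by blast
  then interpret edge_profile m a H S .
  obtain K c \<phi>0 where \<phi>0: "K > 0" "c > 0" "smooth_on \<phi>0 I"
    "\<And>s. s \<in> I \<Longrightarrow> (\<phi>0 has_real_derivative \<phi>1 s) (at s)"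
    "\<And>s. s \<in> I \<Longrightarrow> \<bar>\<phi>0 s\<bar> \<le> K"
    "\<And>s. s \<in> I \<Longrightarrow> \<bar>\<phi>1 s\<bar> \<le> K"
    "\<And>s. s \<in> I \<Longrightarrow> c / \<tau> s \<le> \<phi>2 s"
    "\<And>s. s \<in> I \<Longrightarrow> \<bar>\<phi>2 s\<bar> \<le> K / \<tau> s"
    "\<And>s. s \<in> I \<Longrightarrow> \<bar>\<phi>3 s\<bar> \<le> K / \<tau> s ^ 3"
    "\<And>s. s \<in> I \<Longrightarrow> \<bar>\<phi>4 s\<bar> \<le> K / \<tau> s ^ 5"
    "\<And>s. s \<in> I \<Longrightarrow> s - S 0 \<le> K * (\<tau> s)\<^sup>2"
    using profile_solution by blast
  obtain e :: 'a where e: "e \<in> Basis" using nonempty_Basis by blast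
  obtain b :: 'a where b: "b \<in> Basis" "b \<noteq> e"
  proof -
    have "\<not> Basis \<subseteq> {e}" using n card_mono[of "{e}" "Basis :: 'a set"] by auto
    then show ?thesis using that by blast
  qed
  have S: "S (h / 2) < S h" "S 0 < S (h / 2)" "S 0 > 0"
    using S_less[of "h / 2" h] S_less[of 0 "h / 2"] S_pos[of 0] H by auto
  \<comment> \<open>With this choice \<open>2 * r\<close> is half the difference of the two radii,
    so the ball fits for every \<delta> below \<open>h / 2\<close> while \<open>r\<close> itself
    does not depend on \<delta>.\<close>
  define r where "r = (sqrt (S h) - sqrt (S (h / 2))) / 4"
  have r: "r > 0" using S(1) by (simp add: r_def)
  define R1 where "R1 = r + sqrt (S h)"
  have R1: "R1 > 0" using r S by (simp add: R1_def add_pos_nonneg)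
  \<comment> \<open>The second bound is the condition \<open>small\<close> of the lower estimate for
    the fourth derivatives, solved for \<delta>.\<close>
  define \<delta>0 where "\<delta>0 = min (h / 2) (11 * c * r ^ 3 / (2 * K * R1))"
  have \<delta>0: "\<delta>0 > 0" using H \<phi>0(1,2) r R1 by (simp add: \<delta>0_def)
  \<comment> \<open>The family has to be a function on all reals, so it is built from the bare
    constant with an explicit centre \<open>p\<close>; for admissible \<delta> the fact
    \<open>u\<close> below identifies it with the function of the locale.\<close>
  define u :: "real \<Rightarrow> 'a \<Rightarrow> real"
    where "u \<delta> = radial_profile.u (- ((r + sqrt (S \<delta>)) *\<^sub>R e)) \<phi>0" for \<delta>
  have eb: "edge_ball m a H S e b r K c \<delta> \<phi>0" if "\<delta> \<in> {0<..<\<delta>0}" for \<delta>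
  proof unfold_locales
    show "0 < \<delta>" "\<delta> < h" using that H by (auto simp: \<delta>0_def)
    have "S \<delta> < S (h / 2)" using that H S_less[of \<delta> "h / 2"] by (auto simp: \<delta>0_def)
    then have "sqrt (S \<delta>) < sqrt (S (h / 2))" by simp
    moreover have "4 * r = sqrt (S h) - sqrt (S (h / 2))" by (simp add: r_def)
    ultimately show "sqrt (S \<delta>) + 2 * r < sqrt (S h)" using r by linarith
  qed (use \<phi>0 e b r in \<open>auto simp: m_def\<close>)
  have u: "u \<delta> = radial_profile.u (- (edge_ball.R S r \<delta> *\<^sub>R e)) \<phi>0" if "\<delta> \<in> {0<..<\<delta>0}" for \<delta>
    unfolding u_def edge_ball.R_def[OF eb[OF that]] edge_ball.\<rho>_def[OF eb[OF that]] ..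
  have small: "2 * K * R1 / r ^ 3 \<le> 11 * c / \<delta>" if "\<delta> \<in> {0<..<\<delta>0}" for \<delta>
  proof -
    have "\<delta> \<le> 11 * c * r ^ 3 / (2 * K * R1)" "\<delta> > 0" using that by (auto simp: \<delta>0_def)
    then show ?thesis using r R1 \<phi>0(1,2) by (simp add: field_simps)
  qed
  define D where "D = 1 + K + 2 * sqrt (R1 * K / r) + 2 * R1 / r + 1 / r\<^sup>2"
  define M where "M = real DIM('a) ^ 4 * (15 * D ^ 5)"
  have all: "smooth_up_to (u \<delta>) (cball 0 r)" "strictly_convex_on (cball 0 r) (u \<delta>)"
    "\<forall>x\<in>ball 0 r. F (A_op (u \<delta>) x) = \<theta>" "delta_star 0 r \<theta> (u \<delta>) = \<delta>"
    "C1_norm (cball 0 r) (u \<delta>) \<le> K + 2 * K * sqrt (S h)" "Ck_norm_sphere 3 0 r (u \<delta>) \<le> 4 * M"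
    "sup_mixed 0 r (u \<delta>) \<le> 2 * K * D * sqrt (S h)"
    "4 * c * S 0 / \<delta> \<le> sup_double_normal 0 r (u \<delta>)"
    "sup_double_normal 0 r (u \<delta>) \<le> (2 * K + 4 * K * S h) / \<delta>"
    "c / \<delta> \<le> Ck_norm_sphere 4 0 r (u \<delta>)" "Ck_norm_sphere 4 0 r (u \<delta>) \<le> 5 * M / \<delta>"
    if "\<delta> \<in> {0<..<\<delta>0}" for \<delta>
  proof -
    interpret B: edge_ball m a H S e b r K c \<delta> \<phi>0 by (rule eb[OF that])
    have R1: "B.R1 = R1" by (simp add: B.R1_def R1_def)
    have D: "B.D = D" by (simp add: B.D_def D_def R1)
    have M: "B.M = M" by (simp add: B.M_def M_def D)
    show "smooth_up_to (u \<delta>) (cball 0 r)" "strictly_convex_on (cball 0 r) (u \<delta>)"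
      "\<forall>x\<in>ball 0 r. F (A_op (u \<delta>) x) = \<theta>" "delta_star 0 r \<theta> (u \<delta>) = \<delta>"
      "C1_norm (cball 0 r) (u \<delta>) \<le> K + 2 * K * sqrt (S h)" "Ck_norm_sphere 3 0 r (u \<delta>) \<le> 4 * M"
      "sup_mixed 0 r (u \<delta>) \<le> 2 * K * D * sqrt (S h)"
      "4 * c * S 0 / \<delta> \<le> sup_double_normal 0 r (u \<delta>)"
      "sup_double_normal 0 r (u \<delta>) \<le> (2 * K + 4 * K * S h) / \<delta>"
      "c / \<delta> \<le> Ck_norm_sphere 4 0 r (u \<delta>)" "Ck_norm_sphere 4 0 r (u \<delta>) \<le> 5 * M / \<delta>"
      unfolding u[OF that]
      using B.smooth_up B.strictly_convex B.equation B.delta_star_u B.C1 B.Ck_norm_3 B.mixed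
        B.double_normal B.Ck_norm_4_ge B.Ck_norm_4_le small[OF that]
      by (simp_all add: R1 D M angle(3))
  qed
  show ?thesis
  proof (rule exI[of _ r], rule exI[of _ \<delta>0], rule exI[of _ u], intro conjI)
    show "\<exists>K. \<forall>\<delta>\<in>{0<..<\<delta>0}.
        C1_norm (cball 0 r) (u \<delta>) + Ck_norm_sphere 3 0 r (u \<delta>) + sup_mixed 0 r (u \<delta>) \<le> K"
      by (intro exI[of _ "(K + 2 * K * sqrt (S h)) + 4 * M + 2 * K * D * sqrt (S h)"]
          ballI add_mono all(5,6,7))
    have "M > 0"
    proof -
      have "D > 0" unfolding D_def using \<phi>0(1) r R1
        by (intro add_pos_nonneg) auto
      then show ?thesis by (simp add: M_def)
    qed
    then show "comparable_on {0<..<\<delta>0} (\<lambda>\<delta>. Ck_norm_sphere 4 0 r (u \<delta>)) (\<lambda>\<delta>. 1 / \<delta>)"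
      unfolding comparable_on_def using all(10,11) \<phi>0(2)
      by (intro exI[of _ c] exI[of _ "5 * M"] conjI ballI) auto
    show "comparable_on {0<..<\<delta>0} (\<lambda>\<delta>. sup_double_normal 0 r (u \<delta>)) (\<lambda>\<delta>. 1 / \<delta>)"
      unfolding comparable_on_def using all(8,9) \<phi>0(1,2) S
      by (intro exI[of _ "4 * c * S 0"] exI[of _ "2 * K + 4 * K * S h"] conjI ballI)
         (auto intro!: add_pos_pos mult_pos_pos)
  qed (use r \<delta>0 all(1-4) in auto)
qed

theorem theorem1p8:
  fixes \<theta> :: real
  assumes "CARD('n::finite) \<ge> 2"
    and "pi / 2 \<le> \<theta>" and "\<theta> < real CARD('n) * pi / 2"
  shows "\<exists>(c :: real ^ 'n) r \<delta>\<^sub>0 (u :: real \<Rightarrow> real ^ 'n \<Rightarrow> real).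
    r > 0 \<and> \<delta>\<^sub>0 > 0 \<and>
    (\<forall>\<delta>\<in>{0<..<\<delta>\<^sub>0}.
        smooth_up_to (u \<delta>) (cball c r) \<and>
        strictly_convex_on (cball c r) (u \<delta>) \<and>
        (\<forall>x\<in>ball c r. F (A_op (u \<delta>) x) = \<theta>) \<and>
        delta_star c r \<theta> (u \<delta>) = \<delta>) \<and>
    (\<exists>K. \<forall>\<delta>\<in>{0<..<\<delta>\<^sub>0}.
        C1_norm (cball c r) (u \<delta>) + Ck_norm_sphere 3 c r (u \<delta>) + sup_mixed c r (u \<delta>) \<le> K) \<and>
    comparable_on {0<..<\<delta>\<^sub>0} (\<lambda>\<delta>. sup_double_normal c r (u \<delta>)) (\<lambda>\<delta>. 1 / \<delta>) \<and>
    comparable_on {0<..<\<delta>\<^sub>0} (\<lambda>\<delta>. Ck_norm_sphere 4 c r (u \<delta>)) (\<lambda>\<delta>. 1 / \<delta>)"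
  by (rule exI[of _ 0], rule exists_family) (use assms in simp_all)

end
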